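(* Let $\mu\in\mathbb R$ and $r>3/2$. Consider the cubic Schrödinger equation $i\partial_tu=-\partial_x^2u+\mu|u|^2u$ on $\mathbb T$, let $\mathcal F_\tau$ be its exact propagator, and let $\mathcal G_\tau(u)=e^{i\tau\partial_x^2}u+\Phi_{c,2}(\tau;u)$ with $$\begin{aligned}\Phi_{c,2}(\tau;u)&=e^{i\tau\partial_x^2}\big(e^{-2i\mu\tau(M(u)+P(u)\partial_x^{-1})}-1\big)u-i\mu\tau\,\Pi_0(|u|^2u)+2i\mu\tau M(u)\Pi_0(u)\\&\quad-\frac{\mu}{2}\partial_x^{-2}\Big[\big(e^{-i\tau\partial_x^2}\bar u\big)\,e^{i\tau\partial_x^2}(u^2)\Big]+\frac{\mu}{2}e^{i\tau\partial_x^2}\partial_x^{-2}\big[|u|^2u\big]\\&\quad+\mu\,\partial_x^{-1}\Big[\big(e^{i\tau\partial_x^2}u\big)\,\partial_x^{-1}\big(|e^{i\tau\partial_x^2}u|^2\big)\Big]-\mu\,e^{i\tau\partial_x^2}\partial_x^{-1}\Big[u\,\partial_x^{-1}\big(|u|^2\big)\Big].\end{aligned}$$ Then for every $R>0$ there exists $C_R>0$ such that for all $0<\tau\le1$ and all $w_0,v_0\in B_R=\{v\in H^r(\mathbb T):\|v\|_{H^r}\le R\}$: (i) $\|\Phi_{c,2}(\tau;w_0)-\Phi_{c,2}(\tau;v_0)\|_{H^r}\le C_R\,\tau\,\|w_0-v_0\|_{H^r}$; (ii) $\|(\mathcal F_\tau-\mathcal G_\tau)(w_0)-(\mathcal F_\tau-\mathcal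 G_\tau)(v_0)\|_{H^r}\le C_R\,\tau^2\,\|w_0-v_0\|_{H^r}$.
   Context: $\mathbb T=(0,2\pi)$ with periodic boundary conditions. Fourier series: $f(x)=\sum_{k\in\mathbb Z}\hat f_k e^{ikx}$. $\Pi_0(f)=\frac1{2\pi}\int_{\mathbb T}f\,dx$, $M(u)=\Pi_0(|u|^2)$, $P(u)=\Pi_0(u\,\partial_x\bar u)$. The regularized inverse derivative is $\partial_x^{-1}f(x)=\sum_{k\ne0}(ik)^{-1}\hat f_k e^{ikx}$ (zero mode set to $0$), and $\partial_x^{-2}=(\partial_x^{-1})^2$. The operator $e^{-2i\mu\tau(M(u)+P(u)\partial_x^{-1})}$ is the Fourier multiplier with symbol $e^{-2i\mu\tau(M(u)+P(u)(ik)^{-1})}$ for $k\ne0$ and $e^{-2i\mu\tau M(u)}$ for $k=0$. $\mathcal F_\tau(v)$ is the value at time $\tau$ of the exact ($C([0,\tau];H^r)$, mild/Duhamel) solution of the equation with initial value $v\in H^r(\mathbb T)$ at time $0$. The constant $C_R$ may depend on $R,r,\mu$ but not on $w_0,v_0,\tau$. *)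

theory Defs
  imports "HOL-Analysis.Analysis"
begin

text \<open>
  Functions on the torus are 2 pi-periodic functions from the reals to the complex numbers.
\<close>

definition mean0 :: "(real \<Rightarrow> complex) \<Rightarrow> complex" where
  "mean0 f = integral {0..2 * pi} f / of_real (2 * pi)"

definition fourier_coeff :: "(real \<Rightarrow> complex) \<Rightarrow> int \<Rightarrow> complex" where
  "fourier_coeff f k = mean0 (\<lambda>x. f x * exp (- (\<i> * of_int k * of_real x)))"

definition fourier_mult :: "(int \<Rightarrow> complex) \<Rightarrow> (real \<Rightarrow> complex) \<Rightarrow> real \<Rightarrow> complex" where
  "fourier_mult m f = (\<lambda>x. \<Sum>\<^sub>\<infinity>k\<in>UNIV. m k * fourier_coeff f k * exp (\<i> * of_int k * of_real x))"

text \<open>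
  The Sobolev space of order r, for r > 1/2: every class of almost everywhere equal functions
  then has exactly one continuous periodic representative, and that representative stands for
  the class.  The value of \<open>sobolev_norm\<close> is meaningful only on \<open>sobolev r\<close>, since \<open>infsum\<close>
  returns 0 on families that are not summable.
\<close>

definition sobolev :: "real \<Rightarrow> (real \<Rightarrow> complex) set" where
  "sobolev r = {f. continuous_on UNIV f \<and> (\<forall>x. f (x + 2 * pi) = f x) \<and>
     (\<lambda>k::int. (1 + (of_int k)\<^sup>2) powr r * (cmod (fourier_coeff f k))\<^sup>2) summable_on UNIV}"

definition sobolev_norm :: "real \<Rightarrow> (real \<Rightarrow> complex) \<Rightarrow> real" where
  "sobolev_norm r f =
     sqrt (\<Sum>\<^sub>\<infinity>k::int\<in>UNIV. (1 + (of_int k)\<^sup>2) powr r * (cmod (fourier_coeff f k))\<^sup>2)"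

definition sobolev_ball :: "real \<Rightarrow> real \<Rightarrow> (real \<Rightarrow> complex) set" where
  "sobolev_ball r R = {f \<in> sobolev r. sobolev_norm r f \<le> R}"

definition schroedinger_group :: "real \<Rightarrow> (real \<Rightarrow> complex) \<Rightarrow> real \<Rightarrow> complex" where
  "schroedinger_group t = fourier_mult (\<lambda>k. exp (- (\<i> * of_real t * (of_int k)\<^sup>2)))"

definition dinv_symbol :: "int \<Rightarrow> complex" where
  "dinv_symbol k = (if k = 0 then 0 else 1 / (\<i> * of_int k))"

definition dinv :: "(real \<Rightarrow> complex) \<Rightarrow> real \<Rightarrow> complex" where
  "dinv = fourier_mult dinv_symbol"

definition abs_sq :: "(real \<Rightarrow> complex) \<Rightarrow> real \<Rightarrow> complex" where
  "abs_sq u = (\<lambda>x. of_real ((cmod (u x))\<^sup>2))"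

definition cubic :: "(real \<Rightarrow> complex) \<Rightarrow> real \<Rightarrow> complex" where
  "cubic u = (\<lambda>x. of_real ((cmod (u x))\<^sup>2) * u x)"

definition mass :: "(real \<Rightarrow> complex) \<Rightarrow> complex" where
  "mass u = mean0 (abs_sq u)"

text \<open>
  The derivative is the classical one, as the Sobolev space of order r > 3/2 consists of
  continuously differentiable functions.  The value of \<open>momentum\<close> is purely imaginary.
\<close>

definition momentum :: "(real \<Rightarrow> complex) \<Rightarrow> complex" where
  "momentum u = mean0 (\<lambda>x. u x * vector_derivative (\<lambda>y. cnj (u y)) (at x))"

definition resonant_op :: "real \<Rightarrow> real \<Rightarrow> (real \<Rightarrow> complex) \<Rightarrow> (real \<Rightarrow> complex) \<Rightarrow> real \<Rightarrow> complex" where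
  "resonant_op \<mu> \<tau> u =
     fourier_mult (\<lambda>k. exp (- 2 * \<i> * of_real \<mu> * of_real \<tau> * (mass u + momentum u * dinv_symbol k)))"

definition Phi_c2 :: "real \<Rightarrow> real \<Rightarrow> (real \<Rightarrow> complex) \<Rightarrow> real \<Rightarrow> complex" where
  "Phi_c2 \<mu> \<tau> u = (let S = schroedinger_group \<tau> in (\<lambda>x.
       S (\<lambda>y. resonant_op \<mu> \<tau> u u y - u y) x
     - \<i> * of_real \<mu> * of_real \<tau> * mean0 (cubic u)
     + 2 * \<i> * of_real \<mu> * of_real \<tau> * mass u * mean0 u
     - of_real \<mu> / 2 * dinv (dinv
         (\<lambda>y. schroedinger_group (- \<tau>) (\<lambda>z. cnj (u z)) y * S (\<lambda>z. (u z)\<^sup>2) y)) x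
     + of_real \<mu> / 2 * S (dinv (dinv (cubic u))) x
     + of_real \<mu> * dinv (\<lambda>y. S u y * dinv (abs_sq (S u)) y) x
     - of_real \<mu> * S (dinv (\<lambda>y. u y * dinv (abs_sq u) y)) x))"

definition G_c2 :: "real \<Rightarrow> real \<Rightarrow> (real \<Rightarrow> complex) \<Rightarrow> real \<Rightarrow> complex" where
  "G_c2 \<mu> \<tau> u = (\<lambda>x. schroedinger_group \<tau> u x + Phi_c2 \<mu> \<tau> u x)"

text \<open>
  Mild solutions in C([0,T]; H^r) of i u_t = - u_xx + \<mu> |u|^2 u, with r > 1/2.  The Duhamel integral is evaluated
  at each point x: point evaluation is a continuous linear functional on the Sobolev space, so it
  commutes with the vector-valued integral, and the evaluations separate points.
\<close>

definition nls_mild_solution ::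
  "real \<Rightarrow> real \<Rightarrow> real \<Rightarrow> (real \<Rightarrow> complex) \<Rightarrow> (real \<Rightarrow> real \<Rightarrow> complex) \<Rightarrow> bool" where
  "nls_mild_solution \<mu> r T v u \<longleftrightarrow>
     (\<forall>t\<in>{0..T}. u t \<in> sobolev r) \<and>
     (\<forall>t\<in>{0..T}. ((\<lambda>s. sobolev_norm r (u s - u t)) \<longlongrightarrow> 0) (at t within {0..T})) \<and>
     (\<forall>t\<in>{0..T}. \<forall>x. u t x = schroedinger_group t v x
        - \<i> * of_real \<mu> * integral {0..t} (\<lambda>s. schroedinger_group (t - s) (cubic (u s)) x))"

definition nls_propagator :: "real \<Rightarrow> real \<Rightarrow> real \<Rightarrow> (real \<Rightarrow> complex) \<Rightarrow> real \<Rightarrow> complex" where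
  "nls_propagator \<mu> r \<tau> v = (THE w. \<exists>u. nls_mild_solution \<mu> r \<tau> v u \<and> u \<tau> = w)"

end

theory Submission
  imports Defs
begin

text \<open>
  In the interaction picture the Fourier coefficients of a solution satisfy an ordinary differential
  equation in a weighted \<open>\<ell>\<^sup>2\<close> space, whose right-hand side is the trilinear convolution with
  the multiplier \<open>exp (2 i t (k - i) (k - j))\<close> over \<open>k = i + j - l\<close>.  For \<open>r > 3/2\<close> such a
  convolution is bounded as soon as its multiplier is at most a constant times
  \<open>\<langle>i\<rangle> \<langle>j\<rangle> \<langle>l\<rangle> / \<langle>k\<rangle>\<close>.  Mass and energy bound the \<open>H\<^sup>1\<close> norm, hence
  the sum of the moduli of the coefficients, and a tame estimate with Gronwall's inequality bounds the
  \<open>H\<^sup>r\<close> norm up to time 1; so the flow exists, is Lipschitz on balls, and its distance to the first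
  Picard iterate is Lipschitz with constant \<open>O(\<tau>\<^sup>2)\<close>.

  For \<open>k \<noteq> 0\<close> the identity \<open>(k - i) + (k - j) = k - l\<close> writes the phase integral of the first
  Picard iterate as a combination with weights \<open>l / k\<close> and \<open>1 - l / k\<close>.  The scheme integrates the
  second part exactly and replaces the phase \<open>2 (i j - k l)\<close> of the first by \<open>- 2 k l\<close>, which costs
  \<open>\<tau>\<^sup>2 |i j l| / |k|\<close>, an admissible multiplier.  The resonant terms add up to
  \<open>- 2 i \<mu> \<tau> (M + P / (i k))\<close>, the linear part of the exponential factor.
\<close>

section \<open>Square-summable families\<close>

text \<open>Since \<open>R\<close> is arbitrary while \<open>\<tau>\<close> runs up to 1, a
  contraction on a short interval does not produce the flow: a bound on all of \<open>[0, 1]\<close>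
  that depends on the data through \<open>R\<close> alone is required, for either sign of
  \<open>\<mu>\<close>. This is what the conservation laws are for. The propagator is moreover a
  definite description, so uniqueness has to hold among all mild solutions, not only among those
  constructed.

  In the interaction picture the unbounded Laplacian turns into a unimodular phase. Everything then
  happens in one Banach space, \<open>int ell2\<close>, onto which each weighted space is mapped
  isometrically.

  The obstacle in (ii) is that the error has to be measured in \<open>H^r\<close> itself. Replacing
  a phase costs a product of two frequencies, which could lose two derivatives. Here the cost
  \<open>i j\<close> comes with the prefactor \<open>l / k\<close>: one derivative falls on each of
  the three distinct factors and one is gained on the output. The part of the phase integral that
  lacks this form has to be integrated exactly, and at \<open>k = 0\<close>, where no division is
  possible, the zero-mode terms of the scheme take over.\<close>

typedef 'a ell2 = "{f :: 'a \<Rightarrow> complex. (\<lambda>i. (cmod (f i))\<^sup>2) summable_on UNIV}"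
  morphisms coord ell2_of
  by (rule exI[of _ "\<lambda>_. 0"]) simp

lemma coord_sq_summable: "(\<lambda>i. (cmod (coord x i))\<^sup>2) summable_on UNIV"
  using coord[of x] by simp

lemma coord_ell2_of: "(\<lambda>i. (cmod (f i))\<^sup>2) summable_on UNIV \<Longrightarrow> coord (ell2_of f) = f"
  by (rule ell2_of_inverse) simp

lemma ell2_eqI: "(\<And>i. coord x i = coord y i) \<Longrightarrow> x = y"
  by (metis coord_inject ext)

lemma sq_summable_add:
  fixes f g :: "'a \<Rightarrow> complex"
  assumes "(\<lambda>i. (cmod (f i))\<^sup>2) summable_on UNIV" "(\<lambda>i. (cmod (g i))\<^sup>2) summable_on UNIV"
  shows "(\<lambda>i. (cmod (f i + g i))\<^sup>2) summable_on UNIV"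
proof (rule summable_on_comparison_test)
  show "(\<lambda>i. 2 * (cmod (f i))\<^sup>2 + 2 * (cmod (g i))\<^sup>2) summable_on UNIV"
    by (intro summable_on_add summable_on_cmult_right assms)
  fix i
  have "(cmod (f i + g i))\<^sup>2 \<le> (cmod (f i) + cmod (g i))\<^sup>2"
    by (intro power_mono norm_triangle_ineq) simp
  also have "\<dots> \<le> 2 * (cmod (f i))\<^sup>2 + 2 * (cmod (g i))\<^sup>2"
    using sum_squares_bound[of "cmod (f i)" "cmod (g i)"] by (simp add: power2_sum)
  finally show "(cmod (f i + g i))\<^sup>2 \<le> 2 * (cmod (f i))\<^sup>2 + 2 * (cmod (g i))\<^sup>2" .
qed auto

lemma sq_summable_mono:
  fixes f g :: "'a \<Rightarrow> complex"
  assumes "(\<lambda>i. (cmod (f i))\<^sup>2) summable_on UNIV" "\<And>i. cmod (g i) \<le> C * cmod (f i)"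
  shows "(\<lambda>i. (cmod (g i))\<^sup>2) summable_on UNIV"
proof (rule summable_on_comparison_test)
  show "(\<lambda>i. C\<^sup>2 * (cmod (f i))\<^sup>2) summable_on UNIV"
    by (intro summable_on_cmult_right assms)
  show "(cmod (g i))\<^sup>2 \<le> C\<^sup>2 * (cmod (f i))\<^sup>2" for i
    using power_mono[OF assms(2)[of i], of 2] by (simp add: power_mult_distrib)
qed auto

instantiation ell2 :: (type) ab_group_add
begin
definition zero_ell2 :: "'a ell2" where "zero_ell2 = ell2_of (\<lambda>_. 0)"
definition plus_ell2 :: "'a ell2 \<Rightarrow> 'a ell2 \<Rightarrow> 'a ell2"
  where "plus_ell2 x y = ell2_of (\<lambda>i. coord x i + coord y i)"
definition uminus_ell2 :: "'a ell2 \<Rightarrow> 'a ell2"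
  where "uminus_ell2 x = ell2_of (\<lambda>i. - coord x i)"
definition minus_ell2 :: "'a ell2 \<Rightarrow> 'a ell2 \<Rightarrow> 'a ell2"
  where "minus_ell2 x y = ell2_of (\<lambda>i. coord x i + - coord y i)"

lemma coord_zero [simp]: "coord 0 i = 0"
  unfolding zero_ell2_def by (subst coord_ell2_of) auto
lemma coord_add [simp]: "coord (x + y) i = coord x i + coord y i"
  unfolding plus_ell2_def by (subst coord_ell2_of) (auto intro!: sq_summable_add coord_sq_summable)
lemma coord_uminus [simp]: "coord (- x) i = - coord x i"
  unfolding uminus_ell2_def by (subst coord_ell2_of) (auto intro!: coord_sq_summable)
lemma coord_diff [simp]: "coord (x - y) i = coord x i - coord y i"
  unfolding minus_ell2_def
  by (subst coord_ell2_of, rule sq_summable_add)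
    (use coord_sq_summable[of y] in \<open>simp_all add: coord_sq_summable\<close>)

instance
  by standard (auto intro!: ell2_eqI)
end

text \<open>Polarisation: \<open>2 Re (x cnj y)\<close> is \<open>|x + y|^2 - |x|^2 - |y|^2\<close>,
  a combination of three summable families. The real part is taken because \<open>real_inner\<close>
  asks for a real inner product.\<close>

lemma Re_mult_cnj_summable:
  "(\<lambda>i. Re (coord x i * cnj (coord y i))) summable_on UNIV"
proof -
  have "(\<lambda>i. 2 * Re (coord x i * cnj (coord y i))) summable_on UNIV"
  proof (rule summable_on_cong[THEN iffD1])
    show "(\<lambda>i. (cmod (coord (x + y) i))\<^sup>2 - ((cmod (coord x i))\<^sup>2 + (cmod (coord y i))\<^sup>2)) summable_on UNIV"
      unfolding diff_conv_add_uminus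
      by (rule summable_on_add[OF coord_sq_summable summable_on_uminus[THEN iffD2, OF summable_on_add[OF coord_sq_summable coord_sq_summable]]])
    show "(cmod (coord (x + y) i))\<^sup>2 - ((cmod (coord x i))\<^sup>2 + (cmod (coord y i))\<^sup>2)
        = 2 * Re (coord x i * cnj (coord y i))" for i
      by (simp add: cmod_power2) (simp add: power2_eq_square algebra_simps)
  qed
  from summable_on_cmult_right[OF this, of "1/2"] show ?thesis
    by (simp del: times_complex.simps)
qed

instantiation ell2 :: (type) real_vector
begin
definition scaleR_ell2 :: "real \<Rightarrow> 'a ell2 \<Rightarrow> 'a ell2"
  where "scaleR_ell2 c x = ell2_of (\<lambda>i. c *\<^sub>R coord x i)"

lemma coord_scaleR [simp]: "coord (c *\<^sub>R x) i = c *\<^sub>R coord x i"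
  unfolding scaleR_ell2_def
  by (subst coord_ell2_of, rule sq_summable_mono[OF coord_sq_summable[of x], of _ "\<bar>c\<bar>"]) auto

instance
  by standard (auto intro!: ell2_eqI simp: algebra_simps)
end

instantiation ell2 :: (type) real_inner
begin
definition inner_ell2 :: "'a ell2 \<Rightarrow> 'a ell2 \<Rightarrow> real"
  where "inner_ell2 x y = (\<Sum>\<^sub>\<infinity>i. Re (coord x i * cnj (coord y i)))"
definition norm_ell2 :: "'a ell2 \<Rightarrow> real" where "norm_ell2 x = sqrt (inner x x)"
definition dist_ell2 :: "'a ell2 \<Rightarrow> 'a ell2 \<Rightarrow> real" where "dist_ell2 x y = norm (x - y)"
definition sgn_ell2 :: "'a ell2 \<Rightarrow> 'a ell2" where "sgn_ell2 x = x /\<^sub>R norm x"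
definition uniformity_ell2 :: "('a ell2 \<times> 'a ell2) filter"
  where "uniformity_ell2 = (INF e\<in>{0 <..}. principal {(x, y). dist x y < e})"
definition open_ell2 :: "'a ell2 set \<Rightarrow> bool"
  where "open_ell2 S \<longleftrightarrow> (\<forall>x\<in>S. \<forall>\<^sub>F (x', y) in uniformity. x' = x \<longrightarrow> y \<in> S)"

instance
proof
  fix x y z :: "'a ell2" and a b :: real
  show "dist x y = norm (x - y)" by (rule dist_ell2_def)
  show "sgn x = x /\<^sub>R norm x" by (rule sgn_ell2_def)
  show "uniformity = (INF e\<in>{0 <..}. principal {(x::'a ell2, y). dist x y < e})"
    by (rule uniformity_ell2_def)
  show "open U \<longleftrightarrow> (\<forall>x\<in>U. \<forall>\<^sub>F (x', y) in uniformity. x' = x \<longrightarrow> y \<in> U)" for U :: "'a ell2 set"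
    by (rule open_ell2_def)
  show "inner x y = inner y x"
    unfolding inner_ell2_def by (intro infsum_cong) (simp add: algebra_simps)
  show "inner (x + y) z = inner x z + inner y z"
    unfolding inner_ell2_def
    by (subst infsum_add[symmetric, OF Re_mult_cnj_summable Re_mult_cnj_summable]) (auto intro!: infsum_cong simp: algebra_simps)
  show "inner (a *\<^sub>R x) y = a * inner x y"
    unfolding inner_ell2_def
    by (subst infsum_cmult_right'[symmetric]) (auto intro!: infsum_cong simp: algebra_simps)
  show "0 \<le> inner x x"
    unfolding inner_ell2_def by (intro infsum_nonneg) simp
  show "inner x x = 0 \<longleftrightarrow> x = 0"
  proof
    assume "inner x x = 0"
    then have "Re (coord x i * cnj (coord x i)) = 0" for i
      unfolding inner_ell2_def
      using finite_sum_le_infsum[OF Re_mult_cnj_summable[of x x], of "{i}"]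
      by (simp add: sum_squares_le_zero_iff)
    then have "coord x i = 0" for i
      by (simp add: complex_eq_iff sum_squares_eq_zero_iff)
    then show "x = 0" by (intro ell2_eqI) simp
  qed (simp add: inner_ell2_def)
  show "norm x = sqrt (inner x x)" by (rule norm_ell2_def)
qed
end

lemma norm_ell2_eq: "norm x = sqrt (\<Sum>\<^sub>\<infinity>i. (cmod (coord x i))\<^sup>2)"
proof -
  have "Re (coord x i * cnj (coord x i)) = (cmod (coord x i))\<^sup>2" for i
    unfolding cmod_power2 by (simp add: power2_eq_square)
  then show ?thesis unfolding norm_ell2_def inner_ell2_def by (simp only:)
qed

lemma norm_ell2_sq: "(norm x)\<^sup>2 = (\<Sum>\<^sub>\<infinity>i. (cmod (coord x i))\<^sup>2)"
  by (simp add: norm_ell2_eq infsum_nonneg)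

lemma sum_coord_le: "finite F \<Longrightarrow> (\<Sum>i\<in>F. (cmod (coord x i))\<^sup>2) \<le> (norm x)\<^sup>2"
  unfolding norm_ell2_sq by (rule finite_sum_le_infsum[OF coord_sq_summable]) auto

lemma norm_coord_le: "cmod (coord x i) \<le> norm x"
  using sum_coord_le[of "{i}" x] by (simp add: power2_le_iff_abs_le)

text \<open>Membership and norm bound at once from finite partial sums, which is what injective
  reindexing and coordinatewise limits can control.\<close>

lemma ell2_ofI:
  assumes "\<And>F. finite F \<Longrightarrow> (\<Sum>i\<in>F. (cmod (f i))\<^sup>2) \<le> B\<^sup>2" "B \<ge> 0"
  shows "coord (ell2_of f) = f" "norm (ell2_of f) \<le> B"
proof -
  have s: "(\<lambda>i. (cmod (f i))\<^sup>2) summable_on UNIV"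
    by (rule nonneg_bdd_above_summable_on) (use assms in \<open>auto intro!: bdd_aboveI2[where M = "B\<^sup>2"]\<close>)
  then show c: "coord (ell2_of f) = f" by (rule coord_ell2_of)
  have "(norm (ell2_of f))\<^sup>2 \<le> B\<^sup>2"
    unfolding norm_ell2_sq c by (rule infsum_le_finite_sums[OF s]) (use assms in auto)
  then show "norm (ell2_of f) \<le> B" using assms(2) by (rule power2_le_imp_le)
qed

lemma norm_ell2_mono:
  assumes "\<And>i. cmod (coord x i) \<le> C * cmod (coord y i)" "0 \<le> C"
  shows "norm x \<le> C * norm y"
proof -
  have "(norm x)\<^sup>2 \<le> (\<Sum>\<^sub>\<infinity>i. C\<^sup>2 * (cmod (coord y i))\<^sup>2)"
    unfolding norm_ell2_sq
  proof (intro infsum_mono summable_on_cmult_right coord_sq_summable)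
    show "(cmod (coord x i))\<^sup>2 \<le> C\<^sup>2 * (cmod (coord y i))\<^sup>2" for i
      using power_mono[OF assms(1)[of i], of 2] by (simp add: power_mult_distrib)
  qed
  also have "\<dots> = (C * norm y)\<^sup>2"
    unfolding power_mult_distrib norm_ell2_sq by (rule infsum_cmult_right')
  finally show ?thesis by (rule power2_le_imp_le) (simp add: assms(2))
qed

instance ell2 :: (type) banach
proof
  fix X :: "nat \<Rightarrow> 'a ell2"
  assume X: "Cauchy X"
  have "Cauchy (\<lambda>n. coord (X n) i)" for i
  proof (rule CauchyI)
    fix e :: real assume "0 < e"
    then obtain M where "\<forall>m\<ge>M. \<forall>n\<ge>M. norm (X m - X n) < e" using CauchyD[OF X] by blast
    then show "\<exists>M. \<forall>m\<ge>M. \<forall>n\<ge>M. norm (coord (X m) i - coord (X n) i) < e"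
      by (metis coord_diff le_less_trans norm_coord_le)
  qed
  then have "\<exists>l. (\<lambda>n. coord (X n) i) \<longlonglongrightarrow> l" for i
    by (simp add: Cauchy_convergent_iff convergent_def)
  then obtain y where y: "\<And>i. (\<lambda>n. coord (X n) i) \<longlonglongrightarrow> y i" by metis
  \<comment> \<open>Coordinatewise limits give no norm bound by themselves: \<open>m\<close> tends
    to infinity inside a finite partial sum, where the bound \<open>e\<close> does not depend on the
    finite set.\<close>
  have key: "coord (ell2_of (\<lambda>i. coord (X n) i - y i)) = (\<lambda>i. coord (X n) i - y i) \<and>
      norm (ell2_of (\<lambda>i. coord (X n) i - y i)) \<le> e"
    if e: "e > 0" and N: "\<And>m. m \<ge> N \<Longrightarrow> norm (X n - X m) < e" for e n N
  proof -
    have "(\<Sum>i\<in>F. (cmod (coord (X n) i - y i))\<^sup>2) \<le> e\<^sup>2" if "finite F" for F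
    proof (rule LIMSEQ_le_const2)
      show "(\<lambda>m. \<Sum>i\<in>F. (cmod (coord (X n) i - coord (X m) i))\<^sup>2) \<longlonglongrightarrow> (\<Sum>i\<in>F. (cmod (coord (X n) i - y i))\<^sup>2)"
        by (intro tendsto_intros y)
      have "(\<Sum>i\<in>F. (cmod (coord (X n) i - coord (X m) i))\<^sup>2) \<le> e\<^sup>2" if "m \<ge> N" for m
        using sum_coord_le[OF \<open>finite F\<close>, of "X n - X m"] power_mono[of "norm (X n - X m)" e 2] N[OF that]
        by simp
      then show "\<exists>N. \<forall>m\<ge>N. (\<Sum>i\<in>F. (cmod (coord (X n) i - coord (X m) i))\<^sup>2) \<le> e\<^sup>2" by blast
    qed
    from ell2_ofI[OF this] e show ?thesis by auto
  qed
  obtain N1 where "\<forall>m\<ge>N1. \<forall>n\<ge>N1. norm (X m - X n) < 1" using CauchyD[OF X, of 1] by auto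
  then have c1: "coord (ell2_of (\<lambda>i. coord (X N1) i - y i)) = (\<lambda>i. coord (X N1) i - y i)"
    using key[of 1 N1 N1] by auto
  \<comment> \<open>Only the differences \<open>X n - y\<close> are known to be square-summable so
    far, so the limit is obtained by subtracting one of them from \<open>X N1\<close>.\<close>
  define Y where "Y = X N1 - ell2_of (\<lambda>i. coord (X N1) i - y i)"
  have Y: "coord Y i = y i" for i by (simp add: Y_def c1)
  have "X \<longlonglongrightarrow> Y"
  proof (rule LIMSEQ_I)
    fix e :: real assume e: "0 < e"
    then obtain N where N: "\<forall>m\<ge>N. \<forall>n\<ge>N. norm (X m - X n) < e / 2" using CauchyD[OF X, of "e/2"] by auto
    have "norm (X n - Y) < e" if "n \<ge> N" for n
    proof -
      have "coord (ell2_of (\<lambda>i. coord (X n) i - y i)) = (\<lambda>i. coord (X n) i - y i)"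
        and le: "norm (ell2_of (\<lambda>i. coord (X n) i - y i)) \<le> e / 2"
        using key[of "e/2" N n] N that e by auto
      then have "X n - Y = ell2_of (\<lambda>i. coord (X n) i - y i)"
        by (intro ell2_eqI) (simp add: Y)
      with le e show ?thesis by simp
    qed
    then show "\<exists>N. \<forall>n\<ge>N. norm (X n - Y) < e" by blast
  qed
  then show "convergent X" by (auto simp: convergent_def)
qed

lemma bounded_linear_coord: "bounded_linear (\<lambda>x. coord x i)"
  by (rule bounded_linear_intro[where K = 1]) (auto simp: norm_coord_le)

text \<open>Young's inequality in the form of an absolutely convergent series of operators
  \<open>x \<mapsto> x \<circ> \<sigma> p\<close>, each a contraction because \<open>\<sigma> p\<close> is injective.\<close>

lemma ell2_young:
  fixes g :: "'p \<Rightarrow> real" and \<sigma> :: "'p \<Rightarrow> 'a \<Rightarrow> 'b" and x :: "'b ell2"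
  assumes g: "g summable_on UNIV" "\<And>p. g p \<ge> 0" and inj: "\<And>p. inj (\<sigma> p)"
  obtains y :: "'a ell2" where "norm y \<le> (\<Sum>\<^sub>\<infinity>p. g p) * norm x"
    "\<And>k. coord y k = (\<Sum>\<^sub>\<infinity>p. g p *\<^sub>R coord x (\<sigma> p k))"
    "\<And>k. (\<lambda>p. g p *\<^sub>R coord x (\<sigma> p k)) summable_on UNIV"
proof -
  define U where "U p = ell2_of (\<lambda>k. coord x (\<sigma> p k))" for p
  have U: "coord (U p) = (\<lambda>k. coord x (\<sigma> p k))" "norm (U p) \<le> norm x" for p
  proof -
    have "(\<Sum>k\<in>F. (cmod (coord x (\<sigma> p k)))\<^sup>2) \<le> (norm x)\<^sup>2" if "finite F" for F
      using sum_coord_le[of "\<sigma> p ` F" x] that inj_on_subset[OF inj[of p], of F]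
      by (simp add: sum.reindex)
    from ell2_ofI[OF this] show "coord (U p) = (\<lambda>k. coord x (\<sigma> p k))" "norm (U p) \<le> norm x"
      unfolding U_def by auto
  qed
  have "(\<lambda>p. norm (g p *\<^sub>R U p)) summable_on UNIV"
  proof (rule summable_on_comparison_test)
    show "(\<lambda>p. g p * norm x) summable_on UNIV" by (intro summable_on_cmult_left g)
  qed (use g U in \<open>auto intro!: mult_left_mono\<close>)
  then have s: "(\<lambda>p. g p *\<^sub>R U p) summable_on UNIV" by (rule abs_summable_summable)
  show thesis
  proof
    show "norm (\<Sum>\<^sub>\<infinity>p. g p *\<^sub>R U p) \<le> (\<Sum>\<^sub>\<infinity>p. g p) * norm x"
    proof (rule norm_infsum_le)
      show "((\<lambda>p. g p *\<^sub>R U p) has_sum (\<Sum>\<^sub>\<infinity>p. g p *\<^sub>R U p)) UNIV" using s by simp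
      show "((\<lambda>p. g p * norm x) has_sum ((\<Sum>\<^sub>\<infinity>p. g p) * norm x)) UNIV"
        using g by (intro has_sum_cmult_left) simp
    qed (use g U in \<open>auto intro!: mult_left_mono\<close>)
    have h: "((\<lambda>p. coord (g p *\<^sub>R U p) k) has_sum coord (\<Sum>\<^sub>\<infinity>p. g p *\<^sub>R U p) k) UNIV" for k
      using has_sum_bounded_linear[OF bounded_linear_coord[of k] has_sum_infsum[OF s]] by simp
    show "coord (\<Sum>\<^sub>\<infinity>p. g p *\<^sub>R U p) k = (\<Sum>\<^sub>\<infinity>p. g p *\<^sub>R coord x (\<sigma> p k))" for k
      using infsumI[OF h[of k]] by (simp add: U)
    show "(\<lambda>p. g p *\<^sub>R coord x (\<sigma> p k)) summable_on UNIV" for k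
      using h[of k] by (auto simp: U summable_on_def)
  qed
qed

section \<open>Weighted sequences and trilinear convolutions\<close>

text \<open>The Japanese bracket \<open><k>^s\<close>. The halved exponent makes \<open>wt s\<close>
  the weight of a coefficient, while \<open>hseq s\<close> and \<open>hnorm s\<close> carry its
  square.\<close>

definition wt :: "real \<Rightarrow> int \<Rightarrow> real"
  where "wt s k = (1 + (of_int k)\<^sup>2) powr (s / 2)"

definition hseq :: "real \<Rightarrow> (int \<Rightarrow> complex) set"
  where "hseq s = {a. (\<lambda>k. (1 + (of_int k)\<^sup>2) powr s * (cmod (a k))\<^sup>2) summable_on UNIV}"

definition hnorm :: "real \<Rightarrow> (int \<Rightarrow> complex) \<Rightarrow> real"
  where "hnorm s a = sqrt (\<Sum>\<^sub>\<infinity>k. (1 + (of_int k)\<^sup>2) powr s * (cmod (a k))\<^sup>2)"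

text \<open>Multiplication by the weight is an isometry of \<open>hseq s\<close> onto
  \<open>int ell2\<close>, so a single complete space serves all regularities.\<close>

definition emb :: "real \<Rightarrow> (int \<Rightarrow> complex) \<Rightarrow> int ell2"
  where "emb s a = ell2_of (\<lambda>k. of_real (wt s k) * a k)"

abbreviation l1seq :: "(int \<Rightarrow> complex) \<Rightarrow> bool"
  where "l1seq c \<equiv> (\<lambda>k. cmod (c k)) summable_on UNIV"

lemma wt_pos [simp]: "0 < wt s k" "0 \<le> wt s k" "wt s k \<noteq> 0"
proof -
  have "0 < 1 + (of_int k :: real)\<^sup>2" by (smt (verit) zero_le_power2)
  then show "0 < wt s k" by (simp add: wt_def)
  then show "0 \<le> wt s k" "wt s k \<noteq> 0" by auto
qed

lemma wt_sq: "(wt s k)\<^sup>2 = (1 + (of_int k)\<^sup>2) powr s"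
proof -
  have "1 + (of_int k :: real)\<^sup>2 \<noteq> 0" by (smt (verit) zero_le_power2)
  then show ?thesis by (simp add: wt_def powr_power)
qed

lemma wt_add: "wt (s + t) k = wt s k * wt t k"
  by (simp add: wt_def add_divide_distrib powr_add)

lemma wt_0 [simp]: "wt 0 k = 1"
  using wt_pos(3)[of 1 k] by (simp add: wt_def)

lemma wt_minus: "wt (- s) k = inverse (wt s k)"
  by (simp add: wt_def powr_minus)

lemma wt_mono: "s \<le> t \<Longrightarrow> wt s k \<le> wt t k"
  unfolding wt_def by (intro powr_mono) auto

lemma wt_ge1: "0 \<le> s \<Longrightarrow> 1 \<le> wt s k"
  using wt_mono[of 0 s k] by simp

lemma wt_1: "wt 1 k = sqrt (1 + (of_int k)\<^sup>2)"
  by (simp add: wt_def powr_half_sqrt)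

lemma wt_2: "wt 2 k = 1 + (of_int k)\<^sup>2"
proof -
  have "0 < 1 + (of_int k :: real)\<^sup>2" by (smt (verit) zero_le_power2)
  then show ?thesis by (simp add: wt_def)
qed

lemma abs_le_wt_1: "\<bar>of_int k\<bar> \<le> wt 1 k"
  unfolding wt_1 by (rule real_le_rsqrt) simp

lemma wt_1_triangle: "wt 1 (i + j - l) \<le> wt 1 i + wt 1 j + wt 1 l"
proof -
  have *: "sqrt (1 + (x + y)\<^sup>2) \<le> sqrt (1 + x\<^sup>2) + sqrt (1 + y\<^sup>2)" for x y :: real
  proof (rule real_le_lsqrt)
    have "x * y \<le> sqrt (1 + x\<^sup>2) * sqrt (1 + y\<^sup>2)"
      by (rule order_trans[OF abs_ge_self])
        (auto simp: abs_mult intro!: mult_mono real_le_rsqrt)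
    then show "1 + (x + y)\<^sup>2 \<le> (sqrt (1 + x\<^sup>2) + sqrt (1 + y\<^sup>2))\<^sup>2"
      by (simp add: power2_sum)
  qed auto
  have "wt 1 (i + j - l) \<le> wt 1 (i + j) + wt 1 l"
    using *[of "of_int (i + j)" "- of_int l"] by (simp add: wt_1)
  also have "\<dots> \<le> wt 1 i + wt 1 j + wt 1 l"
    using *[of "of_int i" "of_int j"] by (simp add: wt_1)
  finally show ?thesis .
qed

lemma wt_eq_powr: "wt s k = wt 1 k powr s"
  by (simp add: wt_def powr_powr)

text \<open>The bracket of the sum is at most three times the largest of the three brackets, so the
  whole power falls on one factor. This is the origin of the tame form of the estimates
  below.\<close>

lemma wt_triangle:
  assumes "0 \<le> s"
  shows "wt s (i + j - l) \<le> 3 powr s * (wt s i + wt s j + wt s l)"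
proof -
  define x where "x = max (wt 1 i) (max (wt 1 j) (wt 1 l))"
  have "wt 1 (i + j - l) \<le> 3 * x"
    using wt_1_triangle[of i j l] by (auto simp: x_def)
  then have "wt s (i + j - l) \<le> (3 * x) powr s"
    unfolding wt_eq_powr[of s] using assms by (intro powr_mono2) auto
  also have "\<dots> = 3 powr s * x powr s"
    by (rule powr_mult)
  also have "x powr s \<le> wt s i + wt s j + wt s l"
    unfolding wt_eq_powr[of s] x_def max_def by auto
  finally show ?thesis by simp
qed

text \<open>Brackets are at least 1, so each summand of the triangle inequality is below the
  product.\<close>

lemma wt_1_product: "wt 1 (i + j - l) \<le> 3 * (wt 1 i * wt 1 l * wt 1 j)"
proof -
  have ge: "1 \<le> wt 1 i" "1 \<le> wt 1 j" "1 \<le> wt 1 l" by (auto intro: wt_ge1)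
  have a: "1 \<le> x * y" if "1 \<le> x" "1 \<le> y" for x y :: real
    using mult_mono[OF that] that by simp
  have "wt 1 i \<le> wt 1 i * (wt 1 l * wt 1 j)" "wt 1 j \<le> wt 1 j * (wt 1 i * wt 1 l)"
    "wt 1 l \<le> wt 1 l * (wt 1 i * wt 1 j)"
    using a ge by (simp_all add: mult_le_cancel_left1)
  with wt_1_triangle[of i j l] show ?thesis by (simp only: mult_ac)
qed

lemma hseq_iff: "a \<in> hseq s \<longleftrightarrow> (\<lambda>k. (cmod (of_real (wt s k) * a k))\<^sup>2) summable_on UNIV"
  by (simp add: hseq_def norm_mult power_mult_distrib wt_sq)

lemma coord_emb: "a \<in> hseq s \<Longrightarrow> coord (emb s a) k = of_real (wt s k) * a k"
  unfolding emb_def hseq_iff by (subst coord_ell2_of) auto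

lemma norm_emb: "a \<in> hseq s \<Longrightarrow> norm (emb s a) = hnorm s a"
  unfolding norm_ell2_eq hnorm_def
  by (simp add: coord_emb norm_mult power_mult_distrib wt_sq)

lemma hnorm_nonneg [simp]: "0 \<le> hnorm s a"
  by (simp add: hnorm_def infsum_nonneg)

lemma hseq_coord: "(\<lambda>k. coord x k / of_real (wt s k)) \<in> hseq s"
  "emb s (\<lambda>k. coord x k / of_real (wt s k)) = x"
proof -
  show 1: "(\<lambda>k. coord x k / of_real (wt s k)) \<in> hseq s"
    unfolding hseq_iff using coord_sq_summable[of x] by simp
  show "emb s (\<lambda>k. coord x k / of_real (wt s k)) = x"
    by (rule ell2_eqI) (simp add: coord_emb[OF 1])
qed

lemma hseqI_le:
  assumes "\<And>k. wt s k * cmod (a k) \<le> C * cmod (coord x k)" "0 \<le> C"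
  shows "a \<in> hseq s" "hnorm s a \<le> C * norm x"
proof -
  show a: "a \<in> hseq s"
    unfolding hseq_iff
    by (rule sq_summable_mono[OF coord_sq_summable[of x], of _ C]) (use assms in \<open>auto simp: norm_mult\<close>)
  show "hnorm s a \<le> C * norm x"
    unfolding norm_emb[OF a, symmetric]
    by (rule norm_ell2_mono) (use assms in \<open>auto simp: norm_mult coord_emb[OF a]\<close>)
qed

lemma hseq_mono:
  assumes "b \<in> hseq t" "\<And>k. wt s k * cmod (a k) \<le> C * (wt t k * cmod (b k))" "0 \<le> C"
  shows "a \<in> hseq s" "hnorm s a \<le> C * hnorm t b"
proof -
  have "wt s k * cmod (a k) \<le> C * cmod (coord (emb t b) k)" for k
    using assms(2)[of k] by (simp add: coord_emb[OF assms(1)] norm_mult)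
  from hseqI_le[OF this assms(3)] show "a \<in> hseq s" "hnorm s a \<le> C * hnorm t b"
    by (auto simp: norm_emb[OF assms(1)])
qed

lemma hseq_add:
  assumes "a \<in> hseq s" "b \<in> hseq s"
  shows "(\<lambda>k. a k + b k) \<in> hseq s" "emb s (\<lambda>k. a k + b k) = emb s a + emb s b"
proof -
  have "wt s k * cmod (a k + b k) \<le> 1 * cmod (coord (emb s a + emb s b) k)" for k
    by (simp add: coord_emb assms norm_mult flip: distrib_left)
  from hseqI_le(1)[OF this] show 1: "(\<lambda>k. a k + b k) \<in> hseq s" by simp
  show "emb s (\<lambda>k. a k + b k) = emb s a + emb s b"
    by (rule ell2_eqI) (simp add: coord_emb assms 1 algebra_simps)
qed

lemma hseq_diff:
  assumes "a \<in> hseq s" "b \<in> hseq s"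
  shows "(\<lambda>k. a k - b k) \<in> hseq s" "emb s (\<lambda>k. a k - b k) = emb s a - emb s b"
proof -
  have "wt s k * cmod (a k - b k) \<le> 1 * cmod (coord (emb s a - emb s b) k)" for k
    by (simp add: coord_emb assms norm_mult flip: right_diff_distrib)
  from hseqI_le(1)[OF this] show 1: "(\<lambda>k. a k - b k) \<in> hseq s" by simp
  show "emb s (\<lambda>k. a k - b k) = emb s a - emb s b"
    by (rule ell2_eqI) (simp add: coord_emb assms 1 algebra_simps)
qed

lemma hnorm_triangle:
  assumes "a \<in> hseq s" "b \<in> hseq s"
  shows "hnorm s (\<lambda>k. a k + b k) \<le> hnorm s a + hnorm s b"
  using norm_triangle_ineq[of "emb s a" "emb s b"] assms
  by (simp add: hseq_add(2)[symmetric] norm_emb hseq_add(1))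

lemma hseq_weaken:
  assumes "a \<in> hseq t" "s \<le> t"
  shows "a \<in> hseq s" "hnorm s a \<le> hnorm t a"
  using hseq_mono[OF assms(1), of s a 1] mult_right_mono[OF wt_mono[OF assms(2)] norm_ge_zero] by auto

lemma hseq_wt:
  assumes "a \<in> hseq (s + t)"
  shows "(\<lambda>k. of_real (wt t k) * a k) \<in> hseq s" "hnorm s (\<lambda>k. of_real (wt t k) * a k) \<le> hnorm (s + t) a"
  using hseq_mono[OF assms, of s "\<lambda>k. of_real (wt t k) * a k" 1]
  by (auto simp: norm_mult wt_add)

section \<open>The embedding of weighted sequences into absolutely summable ones\<close>

lemma wt_neg_summable:
  assumes "s > 1 / 2"
  shows "(\<lambda>k. (wt (- s) k)\<^sup>2) summable_on (UNIV :: int set)"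
proof -
  \<comment> \<open>\<open>s > 1/2\<close> is the convergence of the p-series with exponent
    \<open>2 s\<close>; the integers are then split into positive, negative and zero.\<close>
  have "summable (\<lambda>n. real n powr (- 2 * s))"
    by (subst summable_real_powr_iff) (use assms in auto)
  then have "(\<lambda>n. real n powr (- 2 * s)) summable_on UNIV"
    by (intro norm_summable_imp_summable_on) simp
  then have *: "(\<lambda>n. real n powr (- 2 * s)) summable_on {1..}"
    by (rule summable_on_subset_banach) simp
  have le: "(wt (- s) k)\<^sup>2 \<le> \<bar>of_int k\<bar> powr (- 2 * s)" if "k \<noteq> 0" for k
  proof -
    have "(wt (- s) k)\<^sup>2 = wt 1 k powr (- 2 * s)"
      by (simp add: wt_eq_powr[of "- s"] powr_power mult.commute)
    also have "\<dots> \<le> \<bar>of_int k\<bar> powr (- 2 * s)"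
      using that assms by (intro powr_mono2' abs_le_wt_1) auto
    finally show ?thesis .
  qed
  have pos: "(\<lambda>k. (wt (- s) k)\<^sup>2) summable_on (int ` {1..})"
  proof (subst summable_on_reindex)
    show "(\<lambda>k. (wt (- s) k)\<^sup>2) \<circ> int summable_on {1..}"
    proof (rule summable_on_comparison_test[OF *])
      show "((\<lambda>k. (wt (- s) k)\<^sup>2) \<circ> int) n \<le> real n powr (- 2 * s)" if "n \<in> {1..}" for n
        using le[of "int n"] that by simp
    qed auto
  qed simp
  have neg: "(\<lambda>k. (wt (- s) k)\<^sup>2) summable_on ((\<lambda>n. - int n) ` {1..})"
  proof (subst summable_on_reindex)
    show "(\<lambda>k. (wt (- s) k)\<^sup>2) \<circ> (\<lambda>n. - int n) summable_on {1..}"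
    proof (rule summable_on_comparison_test[OF *])
      show "((\<lambda>k. (wt (- s) k)\<^sup>2) \<circ> (\<lambda>n. - int n)) n \<le> real n powr (- 2 * s)" if "n \<in> {1..}" for n
        using le[of "- int n"] that by simp
    qed auto
  qed (simp add: inj_on_def)
  have "(\<lambda>k. (wt (- s) k)\<^sup>2) summable_on ((int ` {1..} \<union> (\<lambda>n. - int n) ` {1..}) \<union> {0})"
    by (intro summable_on_union pos neg summable_on_finite) auto
  moreover have "(int ` {1..} \<union> (\<lambda>n. - int n) ` {1..}) \<union> {0} = (UNIV :: int set)"
  proof -
    have "k \<in> (int ` {1..} \<union> (\<lambda>n. - int n) ` {1..}) \<union> {0}" for k :: int
    proof (cases "k > 0")
      case True
      then show ?thesis by (auto intro!: image_eqI[of _ _ "nat k"])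
    next
      case False
      then show ?thesis by (cases "k = 0") (auto intro!: image_eqI[of _ _ "nat (- k)"])
    qed
    then show ?thesis by blast
  qed
  ultimately show ?thesis by simp
qed

definition sob_const :: "real \<Rightarrow> real"
  where "sob_const s = sqrt (\<Sum>\<^sub>\<infinity>k. (wt (- s) k)\<^sup>2)"

lemma sob_const_nonneg [simp]: "0 \<le> sob_const s"
  by (simp add: sob_const_def infsum_nonneg)

text \<open>The norm of the Wiener algebra; it dominates the supremum of the Fourier series.\<close>

definition l1norm :: "(int \<Rightarrow> complex) \<Rightarrow> real"
  where "l1norm a = (\<Sum>\<^sub>\<infinity>k. cmod (a k))"

lemma l1norm_nonneg [simp]: "0 \<le> l1norm a"
  by (simp add: l1norm_def infsum_nonneg)

text \<open>Cauchy-Schwarz for \<open>wt (- s)\<close> against \<open>wt s * |a|\<close>, read off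
  the inner product of \<open>ell2\<close>; \<open>sob_const s\<close> is the norm of the first
  factor.\<close>

lemma hseq_l1:
  assumes "s > 1 / 2" "a \<in> hseq s"
  shows "l1seq a" "l1norm a \<le> sob_const s * hnorm s a"
proof -
  define x where "x = ell2_of (\<lambda>k. complex_of_real (wt (- s) k))"
  have x: "coord x k = of_real (wt (- s) k)" for k
    unfolding x_def by (subst coord_ell2_of) (use wt_neg_summable[OF assms(1)] in auto)
  define y where "y = ell2_of (\<lambda>k. complex_of_real (wt s k * cmod (a k)))"
  have "(\<lambda>k. (wt s k * cmod (a k))\<^sup>2) summable_on UNIV"
    using assms(2) by (simp add: hseq_iff norm_mult)
  then have y: "coord y k = of_real (wt s k * cmod (a k))" for k
    unfolding y_def by (subst coord_ell2_of) (auto simp: norm_mult)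
  have eq: "Re (coord x k * cnj (coord y k)) = cmod (a k)" for k
    by (simp add: x y wt_minus power2_eq_square field_simps)
  show "l1seq a"
    using Re_mult_cnj_summable[of x y] unfolding eq .
  have "l1norm a = inner x y" by (simp only: l1norm_def inner_ell2_def eq)
  also have "\<dots> \<le> norm x * norm y" by (rule norm_cauchy_schwarz)
  also have "norm x = sob_const s" by (simp add: norm_ell2_eq x sob_const_def)
  also have "norm y = hnorm s a"
    by (simp add: norm_ell2_eq y hnorm_def norm_mult power_mult_distrib wt_sq)
  finally show "l1norm a \<le> sob_const s * hnorm s a" .
qed

lemma product_summable:
  fixes f :: "'a \<Rightarrow> real" and g :: "'b \<Rightarrow> real"
  assumes "f summable_on UNIV" "g summable_on UNIV" "\<And>i. 0 \<le> f i" "\<And>j. 0 \<le> g j"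
  shows "(\<lambda>p. f (fst p) * g (snd p)) summable_on UNIV"
    "(\<Sum>\<^sub>\<infinity>p. f (fst p) * g (snd p)) = (\<Sum>\<^sub>\<infinity>i. f i) * (\<Sum>\<^sub>\<infinity>j. g j)"
proof -
  have "(\<lambda>p. f (fst p) * g (snd p)) summable_on (Sigma UNIV (\<lambda>_. UNIV))"
  proof (rule summable_on_SigmaI)
    show "((\<lambda>y. f (fst (x, y)) * g (snd (x, y))) has_sum f x * (\<Sum>\<^sub>\<infinity>j. g j)) UNIV" for x
      using assms by (auto intro!: has_sum_cmult_right)
  qed (use assms in \<open>auto intro!: summable_on_cmult_left\<close>)
  then show s: "(\<lambda>p. f (fst p) * g (snd p)) summable_on UNIV" by simp
  have "(\<Sum>\<^sub>\<infinity>p. f (fst p) * g (snd p)) = (\<Sum>\<^sub>\<infinity>i. \<Sum>\<^sub>\<infinity>j. f i * g j)"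
    using infsum_Sigma_banach[of "\<lambda>p. f (fst p) * g (snd p)" UNIV "\<lambda>_. UNIV"] s by simp
  also have "\<dots> = (\<Sum>\<^sub>\<infinity>i. f i) * (\<Sum>\<^sub>\<infinity>j. g j)"
    by (simp add: infsum_cmult_right' infsum_cmult_left')
  finally show "(\<Sum>\<^sub>\<infinity>p. f (fst p) * g (snd p)) = (\<Sum>\<^sub>\<infinity>i. f i) * (\<Sum>\<^sub>\<infinity>j. g j)" .
qed

section \<open>Cubic convolutions and Young's inequality\<close>

definition conv3 :: "(int \<Rightarrow> complex) \<Rightarrow> (int \<Rightarrow> complex) \<Rightarrow> (int \<Rightarrow> complex) \<Rightarrow> int \<Rightarrow> real"
  where "conv3 a b c k = (\<Sum>\<^sub>\<infinity>(i, j). cmod (a i) * cmod (b (i + j - k)) * cmod (c j))"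

lemma conv3_summable:
  fixes a b c :: "int \<Rightarrow> complex"
  assumes "l1seq a" "l1seq b"
    "l1seq c"
  shows "(\<lambda>(i, j). cmod (a i) * cmod (b (i + j - k)) * cmod (c j)) summable_on UNIV"
proof (rule summable_on_comparison_test)
  show "(\<lambda>p. l1norm b * (cmod (a (fst p)) * cmod (c (snd p)))) summable_on UNIV"
    by (intro summable_on_cmult_right product_summable assms) auto
  have "cmod (b l) \<le> l1norm b" for l
    unfolding l1norm_def using finite_sum_le_infsum[OF assms(2), of "{l}"] by simp
  then have "cmod (b l) * x \<le> l1norm b * x" if "0 \<le> x" for l x
    using that by (intro mult_right_mono) auto
  from this[of "cmod (a _) * cmod (c _)"]
  show "(case p of (i, j) \<Rightarrow> cmod (a i) * cmod (b (i + j - k)) * cmod (c j))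
      \<le> l1norm b * (cmod (a (fst p)) * cmod (c (snd p)))" for p
    by (cases p) (simp add: mult.assoc mult.left_commute[of "cmod (a _)" "cmod (b _)"])
qed auto

text \<open>Young's inequality with two \<open>l1\<close> factors and one \<open>l2\<close> factor:
  \<open>p\<close> collects the frequencies of the summable factors and \<open>\<sigma> p k\<close>
  is the one then left for the square-summable factor. The series \<open>u k\<close> enters only
  through its sums, so each later case supplies its own change of variables.\<close>

lemma conv3_young_aux:
  fixes x :: "int ell2"
  assumes "l1seq f" "l1seq g"
    "\<And>p. inj (\<sigma> p)" "\<And>k. coord x k = of_real (cmod (h k))"
    "\<And>k S. (u k has_sum S) UNIV \<longleftrightarrow>
       ((\<lambda>p. cmod (f (fst p)) * cmod (g (snd p)) * cmod (h (\<sigma> p k))) has_sum S) UNIV"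
  shows "\<exists>y :: int ell2. norm y \<le> l1norm f * l1norm g * norm x \<and>
    (\<forall>k. u k summable_on UNIV \<and> coord y k = of_real (infsum (u k) UNIV))"
proof -
  note P = product_summable[OF assms(1,2)]
  obtain y :: "int ell2" where y: "norm y \<le> (\<Sum>\<^sub>\<infinity>p. cmod (f (fst p)) * cmod (g (snd p))) * norm x"
    "\<And>k. coord y k = (\<Sum>\<^sub>\<infinity>p. (cmod (f (fst p)) * cmod (g (snd p))) *\<^sub>R coord x (\<sigma> p k))"
    "\<And>k. (\<lambda>p. (cmod (f (fst p)) * cmod (g (snd p))) *\<^sub>R coord x (\<sigma> p k)) summable_on UNIV"
    using ell2_young[of "\<lambda>p. cmod (f (fst p)) * cmod (g (snd p))" \<sigma> x] P(1) assms(3) by auto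
  let ?v = "\<lambda>k p. cmod (f (fst p)) * cmod (g (snd p)) * cmod (h (\<sigma> p k))"
  have "(\<lambda>p. complex_of_real (?v k p)) summable_on UNIV" for k
    using y(3)[of k] by (simp add: assms(4) scaleR_conv_of_real)
  then have "?v k summable_on UNIV" for k
    using summable_on_Re by force
  then have v: "(?v k has_sum infsum (?v k) UNIV) UNIV" for k by simp
  then have u: "(u k has_sum infsum (?v k) UNIV) UNIV" for k unfolding assms(5) .
  have "coord y k = of_real (infsum (u k) UNIV)" for k
    unfolding infsumI[OF u[of k]] y(2) assms(4) scaleR_conv_of_real of_real_mult[symmetric]
    by (rule infsumI[OF has_sum_of_real[OF v[of k]]])
  then show ?thesis using y(1) P(2) u by (auto simp: l1norm_def summable_on_def)
qed

text \<open>One case for each position of the square-summable factor \<open>h\<close>; the changes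
  of variables make the other two frequencies the free ones.\<close>

lemma conv3_young:
  fixes x :: "int ell2"
  assumes l: "l1seq f" "l1seq g"
    "\<And>k. coord x k = of_real (cmod (h k))"
  shows "\<exists>y :: int ell2. norm y \<le> l1norm f * l1norm g * norm x \<and>
      (\<forall>k. (\<lambda>(i, j). cmod (h i) * cmod (f (i + j - k)) * cmod (g j)) summable_on UNIV \<and>
        coord y k = of_real (conv3 h f g k))"
    "\<exists>y :: int ell2. norm y \<le> l1norm f * l1norm g * norm x \<and>
      (\<forall>k. (\<lambda>(i, j). cmod (f i) * cmod (h (i + j - k)) * cmod (g j)) summable_on UNIV \<and>
        coord y k = of_real (conv3 f h g k))"
    "\<exists>y :: int ell2. norm y \<le> l1norm f * l1norm g * norm x \<and>
      (\<forall>k. (\<lambda>(i, j). cmod (f i) * cmod (g (i + j - k)) * cmod (h j)) summable_on UNIV \<and>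
        coord y k = of_real (conv3 f g h k))"
  unfolding conv3_def
proof -
  have 1: "((\<lambda>(i, j). cmod (h i) * cmod (f (i + j - k)) * cmod (g j)) has_sum S) UNIV \<longleftrightarrow>
      ((\<lambda>p. cmod (f (fst p)) * cmod (g (snd p)) * cmod (h (k + fst p - snd p))) has_sum S) UNIV" for k S
    by (rule has_sum_reindex_bij_witness[of _ "\<lambda>(l, j). (k + l - j, j)" "\<lambda>(i, j). (i + j - k, j)"]) auto
  show "\<exists>y :: int ell2. norm y \<le> l1norm f * l1norm g * norm x \<and>
      (\<forall>k. (\<lambda>(i, j). cmod (h i) * cmod (f (i + j - k)) * cmod (g j)) summable_on UNIV \<and>
        coord y k = of_real (\<Sum>\<^sub>\<infinity>(i, j). cmod (h i) * cmod (f (i + j - k)) * cmod (g j)))"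
    by (rule conv3_young_aux[OF l(1,2) _ l(3) 1]) (auto simp: inj_def)
  have 2: "((\<lambda>(i, j). cmod (f i) * cmod (h (i + j - k)) * cmod (g j)) has_sum S) UNIV \<longleftrightarrow>
      ((\<lambda>p. cmod (f (fst p)) * cmod (g (snd p)) * cmod (h (fst p + snd p - k))) has_sum S) UNIV" for k S
    by (rule has_sum_cong) auto
  show "\<exists>y :: int ell2. norm y \<le> l1norm f * l1norm g * norm x \<and>
      (\<forall>k. (\<lambda>(i, j). cmod (f i) * cmod (h (i + j - k)) * cmod (g j)) summable_on UNIV \<and>
        coord y k = of_real (\<Sum>\<^sub>\<infinity>(i, j). cmod (f i) * cmod (h (i + j - k)) * cmod (g j)))"
    by (rule conv3_young_aux[OF l(1,2) _ l(3) 2]) (auto simp: inj_def)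
  have 3: "((\<lambda>(i, j). cmod (f i) * cmod (g (i + j - k)) * cmod (h j)) has_sum S) UNIV \<longleftrightarrow>
      ((\<lambda>p. cmod (f (fst p)) * cmod (g (snd p)) * cmod (h (k + snd p - fst p))) has_sum S) UNIV" for k S
    by (rule has_sum_reindex_bij_witness[of _ "\<lambda>(i, l). (i, k + l - i)" "\<lambda>(i, j). (i, i + j - k)"]) auto
  show "\<exists>y :: int ell2. norm y \<le> l1norm f * l1norm g * norm x \<and>
      (\<forall>k. (\<lambda>(i, j). cmod (f i) * cmod (g (i + j - k)) * cmod (h j)) summable_on UNIV \<and>
        coord y k = of_real (\<Sum>\<^sub>\<infinity>(i, j). cmod (f i) * cmod (g (i + j - k)) * cmod (h j)))"
    by (rule conv3_young_aux[OF l(1,2) _ l(3) 3]) (auto simp: inj_def)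
qed

text \<open>\<open>wt_triangle\<close> moves the weight to one factor at a time, and the other two
  are measured in \<open>l1norm\<close>. The high norm therefore enters linearly in each
  term.\<close>

lemma conv3_hseq:
  assumes s: "0 \<le> s" and h: "a \<in> hseq s" "b \<in> hseq s" "c \<in> hseq s"
    and l: "l1seq a" "l1seq b"
      "l1seq c"
  shows "(\<lambda>k. complex_of_real (conv3 a b c k)) \<in> hseq s"
    "hnorm s (\<lambda>k. complex_of_real (conv3 a b c k)) \<le> 3 powr s *
      (hnorm s a * l1norm b * l1norm c + l1norm a * hnorm s b * l1norm c + l1norm a * l1norm b * hnorm s c)"
proof -
  define W where "W f k = of_real (wt s k) * f k" for f :: "int \<Rightarrow> complex" and k
  have W [simp]: "cmod (W f k) = wt s k * cmod (f k)" for f k by (simp add: W_def norm_mult)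
  define X where "X f = ell2_of (\<lambda>k. complex_of_real (cmod (W f k)))" for f
  have cX: "coord (X f) k = of_real (cmod (W f k))" if "f \<in> hseq s" for f k
    unfolding X_def by (subst coord_ell2_of) (use that in \<open>auto simp: hseq_iff norm_mult\<close>)
  have nX: "norm (X f) = hnorm s f" if "f \<in> hseq s" for f
    unfolding norm_emb[OF that, symmetric] norm_ell2_eq
    by (simp add: cX that coord_emb norm_mult)
  obtain y1 :: "int ell2" where y1: "norm y1 \<le> l1norm b * l1norm c * hnorm s a"
    "\<And>k. (\<lambda>(i, j). cmod (W a i) * cmod (b (i + j - k)) * cmod (c j)) summable_on UNIV"
    "\<And>k. coord y1 k = of_real (conv3 (W a) b c k)"
    using conv3_young(1)[OF l(2,3) cX, OF h(1)] nX[OF h(1)] by metis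
  obtain y2 :: "int ell2" where y2: "norm y2 \<le> l1norm a * l1norm c * hnorm s b"
    "\<And>k. (\<lambda>(i, j). cmod (a i) * cmod (W b (i + j - k)) * cmod (c j)) summable_on UNIV"
    "\<And>k. coord y2 k = of_real (conv3 a (W b) c k)"
    using conv3_young(2)[OF l(1,3) cX, OF h(2)] nX[OF h(2)] by metis
  obtain y3 :: "int ell2" where y3: "norm y3 \<le> l1norm a * l1norm b * hnorm s c"
    "\<And>k. (\<lambda>(i, j). cmod (a i) * cmod (b (i + j - k)) * cmod (W c j)) summable_on UNIV"
    "\<And>k. coord y3 k = of_real (conv3 a b (W c) k)"
    using conv3_young(3)[OF l(1,2) cX, OF h(3)] nX[OF h(3)] by metis
  have "wt s k * conv3 a b c k \<le> 3 powr s * (conv3 (W a) b c k + conv3 a (W b) c k + conv3 a b (W c) k)" for k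
  proof -
    let ?f = "\<lambda>(i, j). cmod (a i) * cmod (b (i + j - k)) * cmod (c j)"
    let ?g = "\<lambda>p. ((case p of (i, j) \<Rightarrow> cmod (W a i) * cmod (b (i + j - k)) * cmod (c j))
      + (case p of (i, j) \<Rightarrow> cmod (a i) * cmod (W b (i + j - k)) * cmod (c j)))
      + (case p of (i, j) \<Rightarrow> cmod (a i) * cmod (b (i + j - k)) * cmod (W c j))"
    note sg = summable_on_add[OF summable_on_add[OF y1(2) y2(2)] y3(2), of k]
    have "wt s k * conv3 a b c k = (\<Sum>\<^sub>\<infinity>p. wt s k * ?f p)"
      unfolding conv3_def by (rule infsum_cmult_right'[symmetric])
    also have "\<dots> \<le> (\<Sum>\<^sub>\<infinity>p. 3 powr s * ?g p)"
    proof (rule infsum_mono)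
      show "(\<lambda>p. wt s k * ?f p) summable_on UNIV"
        by (intro summable_on_cmult_right conv3_summable l)
      show "(\<lambda>p. 3 powr s * ?g p) summable_on UNIV"
        by (intro summable_on_cmult_right sg)
      show "wt s k * ?f p \<le> 3 powr s * ?g p" for p
      proof -
        obtain i j where p: "p = (i, j)" by force
        have "wt s k \<le> 3 powr s * (wt s i + wt s j + wt s (i + j - k))"
          using wt_triangle[OF s, of i j "i + j - k"] by simp
        from mult_right_mono[OF this, of "?f p"] show ?thesis
          by (simp add: p algebra_simps)
      qed
    qed
    also have "\<dots> = 3 powr s * (\<Sum>\<^sub>\<infinity>p. ?g p)"
      by (rule infsum_cmult_right')
    also have "(\<Sum>\<^sub>\<infinity>p. ?g p) = conv3 (W a) b c k + conv3 a (W b) c k + conv3 a b (W c) k"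
      unfolding conv3_def
      by (subst infsum_add[OF summable_on_add[OF y1(2) y2(2)] y3(2)], subst infsum_add[OF y1(2) y2(2)]) simp
    finally show ?thesis .
  qed
  moreover have nonneg: "0 \<le> conv3 f g h k" for f g h k
    unfolding conv3_def by (intro infsum_nonneg) auto
  ultimately have le: "wt s k * cmod (complex_of_real (conv3 a b c k))
      \<le> 3 powr s * cmod (coord (y1 + y2 + y3) k)" for k
    by (simp add: y1(3) y2(3) y3(3) flip: of_real_add)
  show "(\<lambda>k. complex_of_real (conv3 a b c k)) \<in> hseq s"
    using le by (rule hseqI_le) simp
  have "hnorm s (\<lambda>k. complex_of_real (conv3 a b c k)) \<le> 3 powr s * norm (y1 + y2 + y3)"
    using le by (rule hseqI_le) simp
  also have "norm (y1 + y2 + y3) \<le> hnorm s a * l1norm b * l1norm c + l1norm a * hnorm s b * l1norm c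
      + l1norm a * l1norm b * hnorm s c"
    using norm_triangle_ineq[of "y1 + y2" y3] norm_triangle_ineq[of y1 y2] y1(1) y2(1) y3(1)
    by (simp add: algebra_simps)
  finally show "hnorm s (\<lambda>k. complex_of_real (conv3 a b c k)) \<le> 3 powr s *
      (hnorm s a * l1norm b * l1norm c + l1norm a * hnorm s b * l1norm c + l1norm a * l1norm b * hnorm s c)"
    by simp
qed

lemma conv3_nonneg [simp]: "0 \<le> conv3 a b c k"
  unfolding conv3_def by (intro infsum_nonneg) auto

section \<open>Trilinear sums with a frequency multiplier\<close>

definition tri :: "(int \<Rightarrow> int \<Rightarrow> int \<Rightarrow> complex) \<Rightarrow> (int \<Rightarrow> complex) \<Rightarrow> (int \<Rightarrow> complex) \<Rightarrow>
    (int \<Rightarrow> complex) \<Rightarrow> int \<Rightarrow> complex"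
  where "tri m a b c k = (\<Sum>\<^sub>\<infinity>(i, j). m k i j * (a i * cnj (b (i + j - k)) * c j))"

text \<open>Kept as a predicate because \<open>infsum\<close> is 0 on families that are not
  summable: additivity of \<open>tri\<close> has to carry it along.\<close>

definition tri_summable :: "(int \<Rightarrow> int \<Rightarrow> int \<Rightarrow> complex) \<Rightarrow> (int \<Rightarrow> complex) \<Rightarrow> (int \<Rightarrow> complex) \<Rightarrow>
    (int \<Rightarrow> complex) \<Rightarrow> int \<Rightarrow> bool"
  where "tri_summable m a b c k \<longleftrightarrow> (\<lambda>(i, j). m k i j * (a i * cnj (b (i + j - k)) * c j)) summable_on UNIV"

text \<open>The majorant is required at one \<open>k\<close> only, so \<open>D\<close> may depend on
  \<open>k\<close>; in \<open>tri_mult\<close> it is \<open>M * wt (- 1) k\<close>.\<close>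

lemma tri_bound:
  assumes l: "l1seq A" "l1seq B"
      "l1seq C"
    and le: "\<And>i j. cmod (m k i j * (a i * cnj (b (i + j - k)) * c j))
       \<le> D * (cmod (A i) * cmod (B (i + j - k)) * cmod (C j))"
  shows "tri_summable m a b c k" "cmod (tri m a b c k) \<le> D * conv3 A B C k"
    "(\<lambda>p. cmod (case p of (i, j) \<Rightarrow> m k i j * (a i * cnj (b (i + j - k)) * c j))) summable_on UNIV"
proof -
  let ?g = "\<lambda>p. D * (case p of (i, j) \<Rightarrow> cmod (A i) * cmod (B (i + j - k)) * cmod (C j))"
  have sg: "?g summable_on UNIV" by (intro summable_on_cmult_right conv3_summable l)
  show a: "(\<lambda>p. cmod (case p of (i, j) \<Rightarrow> m k i j * (a i * cnj (b (i + j - k)) * c j))) summable_on UNIV"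
    by (rule summable_on_comparison_test[OF sg]) (use le in auto)
  then show s: "tri_summable m a b c k"
    unfolding tri_summable_def by (rule abs_summable_summable)
  have "cmod (tri m a b c k) \<le> (\<Sum>\<^sub>\<infinity>p. ?g p)"
    unfolding tri_def
    by (rule norm_infsum_le[OF has_sum_infsum[OF s[unfolded tri_summable_def]] has_sum_infsum[OF sg]])
      (use le in auto)
  also have "\<dots> = D * conv3 A B C k"
    unfolding conv3_def by (rule infsum_cmult_right')
  finally show "cmod (tri m a b c k) \<le> D * conv3 A B C k" .
qed

lemma tri_tame:
  assumes s: "0 \<le> s" and h: "a \<in> hseq s" "b \<in> hseq s" "c \<in> hseq s"
    and l: "l1seq a" "l1seq b"
      "l1seq c"
    and m: "\<And>k i j. cmod (m k i j) \<le> M"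
  shows "tri_summable m a b c k" "tri m a b c \<in> hseq s"
    "hnorm s (tri m a b c) \<le> M * (3 powr s *
      (hnorm s a * l1norm b * l1norm c + l1norm a * hnorm s b * l1norm c + l1norm a * l1norm b * hnorm s c))"
proof -
  have M: "0 \<le> M" using m[of 0 0 0] norm_ge_zero order_trans by blast
  have le: "cmod (m k i j * (a i * cnj (b (i + j - k)) * c j))
       \<le> M * (cmod (a i) * cmod (b (i + j - k)) * cmod (c j))" for k i j
    using m by (auto simp: norm_mult intro!: mult_right_mono)
  note B = tri_bound[OF l le]
  show "tri_summable m a b c k" by (rule B(1))
  have *: "wt s k * cmod (tri m a b c k) \<le> M * (wt s k * cmod (complex_of_real (conv3 a b c k)))" for k
  proof -
    have "cmod (tri m a b c k) \<le> M * conv3 a b c k" by (rule B(2))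
    from mult_left_mono[OF this, of "wt s k"] show ?thesis by (simp add: mult.left_commute)
  qed
  show "tri m a b c \<in> hseq s"
    by (rule hseq_mono(1)[OF conv3_hseq(1)[OF s h l] * M])
  show "hnorm s (tri m a b c) \<le> M * (3 powr s *
      (hnorm s a * l1norm b * l1norm c + l1norm a * hnorm s b * l1norm c + l1norm a * l1norm b * hnorm s c))"
    by (rule order_trans[OF hseq_mono(2)[OF conv3_hseq(1)[OF s h l] * M]])
      (intro mult_left_mono conv3_hseq M s h l)
qed

text \<open>The constant of \<open>conv3_hseq\<close> at regularity \<open>r - 1\<close>: three
  terms, in each of which two factors are measured in \<open>l1norm\<close> at the price of
  \<open>sob_const (r - 1)\<close>.\<close>

definition tri_const :: "real \<Rightarrow> real"
  where "tri_const r = 3 powr (r - 1) * (3 * (sob_const (r - 1))\<^sup>2)"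

text \<open>Distributing one weight \<open>wt 1\<close> to each factor reduces to the algebra property of \<open>hseq (r - 1)\<close>;
  this is where \<open>r > 3/2\<close> enters.\<close>

lemma tri_mult:
  assumes r: "r > 3 / 2" and h: "a \<in> hseq r" "b \<in> hseq r" "c \<in> hseq r"
    and M: "0 \<le> M"
    and m: "\<And>k i j. cmod (m k i j) * wt 1 k \<le> M * (wt 1 i * wt 1 (i + j - k) * wt 1 j)"
  shows "tri_summable m a b c k" "tri m a b c \<in> hseq r"
    "hnorm r (tri m a b c) \<le> M * (tri_const r * (hnorm r a * hnorm r b * hnorm r c))"
    "(\<lambda>p. cmod (case p of (i, j) \<Rightarrow> m k i j * (a i * cnj (b (i + j - k)) * c j))) summable_on UNIV"
proof -
  define W where "W f k = of_real (wt 1 k) * f k" for f :: "int \<Rightarrow> complex" and k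
  have W [simp]: "cmod (W f k) = wt 1 k * cmod (f k)" for f k by (simp add: W_def norm_mult)
  have hW: "W f \<in> hseq (r - 1)" "hnorm (r - 1) (W f) \<le> hnorm r f" if "f \<in> hseq r" for f
    using hseq_wt[of f "r - 1" 1] that by (simp_all add: W_def[abs_def])
  have r': "r - 1 > 1 / 2" "0 \<le> r - 1" using r by auto
  note lW = hseq_l1[OF r'(1) hW(1)]
  have le: "cmod (m k i j * (a i * cnj (b (i + j - k)) * c j))
       \<le> (M * wt (- 1) k) * (cmod (W a i) * cmod (W b (i + j - k)) * cmod (W c j))" for k i j
  proof -
    have "cmod (m k i j) \<le> M * wt (- 1) k * (wt 1 i * wt 1 (i + j - k) * wt 1 j)"
      using m[of k i j] by (simp add: wt_minus field_simps)
    from mult_right_mono[OF this, of "cmod (a i * cnj (b (i + j - k)) * c j)"]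
    show ?thesis by (simp add: norm_mult algebra_simps)
  qed
  note B = tri_bound[OF lW(1)[OF h(1)] lW(1)[OF h(2)] lW(1)[OF h(3)] le]
  show "tri_summable m a b c k" by (rule B(1))
  show "(\<lambda>p. cmod (case p of (i, j) \<Rightarrow> m k i j * (a i * cnj (b (i + j - k)) * c j))) summable_on UNIV"
    by (rule B(3))
  note cv = conv3_hseq[OF r'(2) hW(1)[OF h(1)] hW(1)[OF h(2)] hW(1)[OF h(3)] lW(1)[OF h(1)] lW(1)[OF h(2)] lW(1)[OF h(3)]]
  \<comment> \<open>One weight is gained on the output:
    \<open>wt r k * wt (- 1) k = wt (r - 1) k\<close>, so the convolution is only needed in
    \<open>hseq (r - 1)\<close>.\<close>
  have *: "wt r k * cmod (tri m a b c k)
      \<le> M * (wt (r - 1) k * cmod (complex_of_real (conv3 (W a) (W b) (W c) k)))" for k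
  proof -
    have "wt r k * wt (- 1) k = wt (r - 1) k" by (simp add: wt_add[symmetric])
    moreover have "cmod (tri m a b c k) \<le> (M * wt (- 1) k) * conv3 (W a) (W b) (W c) k" by (rule B(2))
    from mult_left_mono[OF this, of "wt r k"]
    have "wt r k * cmod (tri m a b c k) \<le> M * ((wt r k * wt (- 1) k) * conv3 (W a) (W b) (W c) k)"
      by (simp add: algebra_simps)
    ultimately show ?thesis by simp
  qed
  show "tri m a b c \<in> hseq r" by (rule hseq_mono(1)[OF cv(1) * M])
  have "hnorm r (tri m a b c) \<le> M * hnorm (r - 1) (\<lambda>k. complex_of_real (conv3 (W a) (W b) (W c) k))"
    by (rule hseq_mono(2)[OF cv(1) * M])
  also have "\<dots> \<le> M * (tri_const r * (hnorm r a * hnorm r b * hnorm r c))"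
  proof (intro mult_left_mono M order_trans[OF cv(2)])
    let ?s = "sob_const (r - 1)"
    have l: "l1norm (W f) \<le> ?s * hnorm r f" if "f \<in> hseq r" for f
      using lW(2)[OF that] mult_left_mono[OF hW(2)[OF that], of ?s] by simp
    have "hnorm (r - 1) (W a) * l1norm (W b) * l1norm (W c) \<le> hnorm r a * (?s * hnorm r b) * (?s * hnorm r c)"
      "l1norm (W a) * hnorm (r - 1) (W b) * l1norm (W c) \<le> (?s * hnorm r a) * hnorm r b * (?s * hnorm r c)"
      "l1norm (W a) * l1norm (W b) * hnorm (r - 1) (W c) \<le> (?s * hnorm r a) * (?s * hnorm r b) * hnorm r c"
      by (intro mult_mono hW l h mult_nonneg_nonneg; simp)+
    then have "hnorm (r - 1) (W a) * l1norm (W b) * l1norm (W c) +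
        l1norm (W a) * hnorm (r - 1) (W b) * l1norm (W c) +
        l1norm (W a) * l1norm (W b) * hnorm (r - 1) (W c)
      \<le> 3 * ?s\<^sup>2 * (hnorm r a * hnorm r b * hnorm r c)"
      by (simp add: power2_eq_square algebra_simps)
    from mult_left_mono[OF this, of "3 powr (r - 1)"]
    show "3 powr (r - 1) * (hnorm (r - 1) (W a) * l1norm (W b) * l1norm (W c) +
        l1norm (W a) * hnorm (r - 1) (W b) * l1norm (W c) +
        l1norm (W a) * l1norm (W b) * hnorm (r - 1) (W c))
      \<le> tri_const r * (hnorm r a * hnorm r b * hnorm r c)"
      by (simp add: tri_const_def mult.assoc)
  qed
  finally show "hnorm r (tri m a b c) \<le> M * (tri_const r * (hnorm r a * hnorm r b * hnorm r c))" .
qed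

lemma tri_diff:
  assumes "tri_summable m a b c k" "tri_summable m a' b c k"
  shows "tri m (\<lambda>i. a i - a' i) b c k = tri m a b c k - tri m a' b c k"
proof -
  have "tri m (\<lambda>i. a i - a' i) b c k = (\<Sum>\<^sub>\<infinity>p. (case p of (i, j) \<Rightarrow> m k i j * (a i * cnj (b (i + j - k)) * c j))
     + - (case p of (i, j) \<Rightarrow> m k i j * (a' i * cnj (b (i + j - k)) * c j)))"
    unfolding tri_def by (intro infsum_cong) (auto simp: algebra_simps)
  also have "\<dots> = tri m a b c k - tri m a' b c k"
    using assms unfolding tri_summable_def tri_def
    by (subst infsum_add) (auto simp: summable_on_uminus infsum_uminus)
  finally show ?thesis .
qed

lemma tri_diff2:
  assumes "tri_summable m a b c k" "tri_summable m a b' c k"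
  shows "tri m a (\<lambda>i. b i - b' i) c k = tri m a b c k - tri m a b' c k"
proof -
  have "tri m a (\<lambda>i. b i - b' i) c k = (\<Sum>\<^sub>\<infinity>p. (case p of (i, j) \<Rightarrow> m k i j * (a i * cnj (b (i + j - k)) * c j))
     + - (case p of (i, j) \<Rightarrow> m k i j * (a i * cnj (b' (i + j - k)) * c j)))"
    unfolding tri_def by (intro infsum_cong) (auto simp: algebra_simps)
  also have "\<dots> = tri m a b c k - tri m a b' c k"
    using assms unfolding tri_summable_def tri_def
    by (subst infsum_add) (auto simp: summable_on_uminus infsum_uminus)
  finally show ?thesis .
qed

lemma tri_diff3:
  assumes "tri_summable m a b c k" "tri_summable m a b c' k"
  shows "tri m a b (\<lambda>i. c i - c' i) k = tri m a b c k - tri m a b c' k"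
proof -
  have "tri m a b (\<lambda>i. c i - c' i) k = (\<Sum>\<^sub>\<infinity>p. (case p of (i, j) \<Rightarrow> m k i j * (a i * cnj (b (i + j - k)) * c j))
     + - (case p of (i, j) \<Rightarrow> m k i j * (a i * cnj (b (i + j - k)) * c' j)))"
    unfolding tri_def by (intro infsum_cong) (auto simp: algebra_simps)
  also have "\<dots> = tri m a b c k - tri m a b c' k"
    using assms unfolding tri_summable_def tri_def
    by (subst infsum_add) (auto simp: summable_on_uminus infsum_uminus)
  finally show ?thesis .
qed

section \<open>Sums depending on a parameter\<close>

lemma infsum_continuous_on:
  fixes f :: "'i \<Rightarrow> 'a::topological_space \<Rightarrow> 'b::banach"
  assumes "\<And>i. continuous_on A (f i)" "\<And>i t. t \<in> A \<Longrightarrow> norm (f i t) \<le> g i" "g summable_on UNIV"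
  shows "continuous_on A (\<lambda>t. \<Sum>\<^sub>\<infinity>i. f i t)"
proof (rule uniform_limit_theorem)
  show "uniform_limit A (\<lambda>X t. \<Sum>i\<in>X. f i t) (\<lambda>t. \<Sum>\<^sub>\<infinity>i. f i t) (finite_subsets_at_top UNIV)"
    by (rule Weierstrass_m_test_general) (use assms in auto)
  show "\<forall>\<^sub>F X in finite_subsets_at_top UNIV. continuous_on A (\<lambda>t. \<Sum>i\<in>X. f i t)"
    by (intro always_eventually allI continuous_on_sum assms)
qed simp

text \<open>By the Weierstrass test the partial sums converge uniformly along the net of finite
  sets, and uniform limits commute with the integral over a compact interval.\<close>

lemma infsum_integral:
  fixes f :: "'i \<Rightarrow> real \<Rightarrow> 'b::banach"
  assumes "\<And>i. continuous_on {a..b} (f i)" "\<And>i t. t \<in> {a..b} \<Longrightarrow> norm (f i t) \<le> g i" "g summable_on UNIV"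
  shows "((\<lambda>i. integral {a..b} (f i)) has_sum integral {a..b} (\<lambda>t. \<Sum>\<^sub>\<infinity>i. f i t)) UNIV"
proof -
  have "uniform_limit {a..b} (\<lambda>X t. \<Sum>i\<in>X. f i t) (\<lambda>t. \<Sum>\<^sub>\<infinity>i. f i t) (finite_subsets_at_top UNIV)"
    by (rule Weierstrass_m_test_general) (use assms in auto)
  moreover have "continuous_on {a..b} (\<lambda>t. \<Sum>i\<in>X. f i t)" for X
    by (intro continuous_on_sum assms)
  ultimately obtain I J where IJ: "\<And>X. ((\<lambda>t. \<Sum>i\<in>X. f i t) has_integral I X) {a..b}"
    "((\<lambda>t. \<Sum>\<^sub>\<infinity>i. f i t) has_integral J) {a..b}" "(I \<longlongrightarrow> J) (finite_subsets_at_top UNIV)"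
    by (rule uniform_limit_integral) auto
  have "I X = (\<Sum>i\<in>X. integral {a..b} (f i))" if "finite X" for X
    using integral_unique[OF IJ(1)[of X]] that
    by (subst (asm) integral_sum) (auto intro!: integrable_continuous_real assms)
  then have "((\<lambda>X. \<Sum>i\<in>X. integral {a..b} (f i)) \<longlongrightarrow> J) (finite_subsets_at_top UNIV)"
    by (intro Lim_transform_eventually[OF IJ(3)]) (auto simp: eventually_finite_subsets_at_top)
  then show ?thesis
    using integral_unique[OF IJ(2)] by (simp add: has_sum_def)
qed

section \<open>Ordinary differential equations in Banach spaces\<close>

lemma gronwall:
  fixes y :: "real \<Rightarrow> real"
  assumes y: "continuous_on {0..T} y" "\<And>t. t \<in> {0..T} \<Longrightarrow> y t \<le> A + L * integral {0..t} y"
    and L: "0 \<le> L" and t: "t \<in> {0..T}"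
  shows "y t \<le> A * exp (L * t)"
proof -
  define I where "I t = integral {0..t} y" for t
  \<comment> \<open>The integrating factor: the derivative of \<open>z\<close> is
    \<open>exp (- L * s) * (L * (y s - (A + L * I s)))\<close>, at most 0 by the integral
    inequality.\<close>
  define z where "z t = exp (- L * t) * (A + L * I t)" for t
  have dI: "(I has_real_derivative y s) (at s within {0..T})" if "s \<in> {0..T}" for s
    unfolding I_def using integral_has_real_derivative[OF y(1) that] .
  have dz: "(z has_real_derivative (exp (- L * s) * (L * (y s - (A + L * I s))))) (at s within {0..T})"
    if "s \<in> {0..T}" for s
    unfolding z_def by (rule derivative_eq_intros dI[OF that] refl)+ (simp add: algebra_simps)
  have "z t \<le> z 0"
  proof (rule DERIV_nonpos_imp_decreasing_open[where f = z])
    show "continuous_on {0..t} z"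
      using dz t by (intro continuous_on_subset[OF DERIV_continuous_on, of "{0..T}"]) auto
    fix s assume s: "0 < s" "s < t"
    then have s': "s \<in> {0..T}" "at s within {0..T} = at s"
      using t by (auto intro!: at_within_interior simp: interior_atLeastAtMost_real)
    show "\<exists>d. (z has_real_derivative d) (at s) \<and> d \<le> 0"
      using dz[OF s'(1)] y(2)[OF s'(1)] L
      by (auto simp: s'(2) I_def intro!: exI mult_nonneg_nonpos)
  qed (use t in auto)
  then have "exp (- L * t) * (A + L * I t) \<le> A" by (simp add: z_def I_def)
  then have "A + L * I t \<le> A * exp (L * t)"
    by (simp add: exp_minus field_simps)
  with y(2)[OF t] show ?thesis by (simp add: I_def)
qed

lemma integral_exp_scaled:
  fixes L t :: real
  assumes "0 < L" "0 \<le> t"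
  shows "integral {0..t} (\<lambda>s. L * exp (2 * L * s)) = (exp (2 * L * t) - 1) / 2"
proof -
  have "((\<lambda>s. L * exp (2 * L * s)) has_integral (exp (2 * L * t) / 2 - exp (2 * L * 0) / 2)) {0..t}"
    by (rule fundamental_theorem_of_calculus)
      (use assms in \<open>auto intro!: derivative_eq_intros simp flip: has_real_derivative_iff_has_vector_derivative\<close>)
  then show ?thesis by (auto dest!: integral_unique simp: diff_divide_distrib)
qed

text \<open>The weight \<open>exp (- 2 L t)\<close> makes the Picard map a contraction on the whole interval.\<close>

lemma lipschitz_ode_exists:
  fixes f :: "real \<Rightarrow> 'a::banach \<Rightarrow> 'a"
  assumes T: "0 \<le> T" and L: "0 < L"
    and cont: "\<And>x. continuous_on {0..T} x \<Longrightarrow> continuous_on {0..T} (\<lambda>t. f t (x t))"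
    and lip: "\<And>t x y. t \<in> {0..T} \<Longrightarrow> norm (f t x - f t y) \<le> L * norm (x - y)"
  obtains x where "continuous_on {0..T} x"
    "\<And>t. t \<in> {0..T} \<Longrightarrow> x t = x0 + integral {0..t} (\<lambda>s. f s (x s))"
proof -
  \<comment> \<open>Clamping time to \<open>{0..T}\<close> extends the iterates to bounded
    continuous functions on the line, the complete space in which the fixed point is found.\<close>
  define cl where "cl t = max 0 (min T t)" for t
  have cl: "cl t \<in> {0..T}" "t \<in> {0..T} \<Longrightarrow> cl t = t" for t using T by (auto simp: cl_def)
  \<comment> \<open>The unknown \<open>b\<close> is \<open>exp (- 2 * L * t)\<close> times the
    solution, so the sup norm of \<open>b\<close> is the weighted norm.\<close>
  define F where "F b s = f s (exp (2 * L * s) *\<^sub>R apply_bcontfun b s)" for b s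
  have Fc: "continuous_on {0..T} (F b)" for b
    unfolding F_def by (intro cont continuous_intros) auto
  define h where "h b t = exp (- 2 * L * t) *\<^sub>R (x0 + integral {0..t} (F b))" for b t
  have hc: "continuous_on {0..T} (h b)" for b
    unfolding h_def
    by (intro continuous_intros indefinite_integral_continuous_1 integrable_continuous_real Fc)
  define \<Gamma> where "\<Gamma> b = Bcontfun (\<lambda>t. h b (cl t))" for b
  have \<Gamma>: "apply_bcontfun (\<Gamma> b) t = h b (cl t)" for b t
  proof -
    have "(\<lambda>t. h b (cl t)) \<in> bcontfun"
      unfolding bcontfun_def
    proof (intro CollectI conjI)
      show "continuous_on UNIV (\<lambda>t. h b (cl t))"
        by (rule continuous_on_compose2[OF hc]) (use cl in \<open>auto simp: cl_def intro!: continuous_intros\<close>)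
      have "bounded (h b ` {0..T})"
        by (intro compact_imp_bounded compact_continuous_image hc compact_Icc)
      then show "bounded (range (\<lambda>t. h b (cl t)))"
        by (rule bounded_subset) (use cl in auto)
    qed
    then show ?thesis unfolding \<Gamma>_def by (simp add: Bcontfun_inverse)
  qed
  \<comment> \<open>The factor \<open>1/2\<close>: the integral of
    \<open>L * exp (2 * L * u)\<close> over \<open>{0..s}\<close> is at most
    \<open>exp (2 * L * s) / 2\<close>, and the weight cancels the exponential.\<close>
  have "dist (\<Gamma> b) (\<Gamma> c) \<le> (1 / 2) * dist b c" for b c
  proof (rule dist_bound)
    fix t
    define s where "s = cl t"
    have s: "s \<in> {0..T}" using cl by (simp add: s_def)
    have sub: "continuous_on {0..s} (F b)" for b using s by (intro continuous_on_subset[OF Fc]) auto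
    have "norm (integral {0..s} (F b) - integral {0..s} (F c)) = norm (integral {0..s} (\<lambda>u. F b u - F c u))"
      by (subst integral_diff) (auto intro!: integrable_continuous_real sub)
    also have "\<dots> \<le> integral {0..s} (\<lambda>u. dist b c * (L * exp (2 * L * u)))"
    proof (rule integral_norm_bound_integral)
      show "(\<lambda>u. F b u - F c u) integrable_on {0..s}"
        by (intro integrable_continuous_real continuous_intros sub)
      show "(\<lambda>u. dist b c * (L * exp (2 * L * u))) integrable_on {0..s}"
        by (intro integrable_continuous_real continuous_intros)
      fix u assume "u \<in> {0..s}"
      then have "norm (F b u - F c u) \<le> L * norm (exp (2 * L * u) *\<^sub>R (apply_bcontfun b u - apply_bcontfun c u))"
        using lip[of u] s unfolding F_def by (auto simp: scaleR_diff_right)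
      also have "\<dots> \<le> L * (exp (2 * L * u) * dist b c)"
        using dist_bounded[of b u c] L by (auto simp: dist_norm intro!: mult_left_mono)
      finally show "norm (F b u - F c u) \<le> dist b c * (L * exp (2 * L * u))" by (simp add: mult_ac)
    qed
    also have "\<dots> = dist b c * ((exp (2 * L * s) - 1) / 2)"
      using integral_exp_scaled[OF L, of s] s by simp
    also have "\<dots> \<le> dist b c * (exp (2 * L * s) / 2)"
      by (intro mult_left_mono) auto
    finally have *: "norm (integral {0..s} (F b) - integral {0..s} (F c)) \<le> dist b c * (exp (2 * L * s) / 2)" .
    have "dist (\<Gamma> b t) (\<Gamma> c t) = exp (- 2 * L * s) * norm (integral {0..s} (F b) - integral {0..s} (F c))"
      by (simp add: \<Gamma> h_def dist_norm flip: s_def scaleR_diff_right)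
    also have "\<dots> \<le> exp (- 2 * L * s) * (dist b c * (exp (2 * L * s) / 2))"
      by (intro mult_left_mono *) auto
    also have "\<dots> = (1 / 2) * dist b c" by (simp add: exp_minus field_simps)
    finally show "dist (\<Gamma> b t) (\<Gamma> c t) \<le> (1 / 2) * dist b c" .
  qed
  then obtain b where b: "\<Gamma> b = b"
    using banach_fix_type[of "1/2" \<Gamma>] by auto
  define x where "x t = exp (2 * L * t) *\<^sub>R apply_bcontfun b t" for t
  show thesis
  proof
    show "continuous_on {0..T} x" unfolding x_def by (intro continuous_intros continuous_on_apply_bcontfun)
    fix t assume t: "t \<in> {0..T}"
    have "apply_bcontfun b t = h b t" using \<Gamma>[of b t] cl t by (simp add: b)
    then show "x t = x0 + integral {0..t} (\<lambda>s. f s (x s))"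
      by (simp add: x_def h_def F_def[abs_def] exp_minus)
  qed
qed

section \<open>The free group and the trilinear operators\<close>

abbreviation phase :: "real \<Rightarrow> int \<Rightarrow> complex"
  where "phase t k \<equiv> exp (- (\<i> * of_real t * (of_int k)\<^sup>2))"

definition free_group :: "real \<Rightarrow> int ell2 \<Rightarrow> int ell2"
  where "free_group t x = ell2_of (\<lambda>k. phase t k * coord x k)"

lemma coord_free_group [simp]:
  "coord (free_group t x) k = phase t k * coord x k"
  unfolding free_group_def
  by (subst coord_ell2_of) (auto simp: norm_mult coord_sq_summable)

lemma norm_free_group [simp]: "norm (free_group t x) = norm x"
  by (simp add: norm_ell2_eq norm_mult)

lemma free_group_diff: "free_group t (x - y) = free_group t x - free_group t y"
  by (rule ell2_eqI) (simp add: algebra_simps)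

lemma free_group_add: "free_group t (x + y) = free_group t x + free_group t y"
  by (rule ell2_eqI) (simp add: algebra_simps)

lemma free_group_comp: "free_group s (free_group t x) = free_group (s + t) x"
  by (rule ell2_eqI) (simp add: algebra_simps flip: exp_add)

lemma free_group_0 [simp]: "free_group 0 x = x"
  by (rule ell2_eqI) simp

lemma bounded_linear_free_group: "bounded_linear (free_group t)"
  by (rule bounded_linear_intro[where K = 1])
    (auto simp: free_group_add intro!: ell2_eqI)

text \<open>The phases are not equicontinuous in \<open>k\<close>, so continuity is claimed for a
  fixed \<open>x\<close> only; the series of squared differences is dominated by
  \<open>4 |x_k|^2\<close>.\<close>

lemma free_group_strongly_continuous: "continuous_on UNIV (\<lambda>t. free_group t x)"
  unfolding continuous_on_def
proof (intro ballI)
  fix s :: real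
  define g where "g t = (\<Sum>\<^sub>\<infinity>k. (cmod (coord (free_group t x - free_group s x) k))\<^sup>2)" for t
  have "continuous_on UNIV g"
    unfolding g_def
  proof (rule infsum_continuous_on)
    show "continuous_on UNIV (\<lambda>t. (cmod (coord (free_group t x - free_group s x) k))\<^sup>2)" for k
      by (auto intro!: continuous_intros)
    show "(\<lambda>k. 4 * (cmod (coord x k))\<^sup>2) summable_on UNIV"
      by (intro summable_on_cmult_right coord_sq_summable)
    show "norm ((cmod (coord (free_group t x - free_group s x) k))\<^sup>2) \<le> 4 * (cmod (coord x k))\<^sup>2" for k t
    proof -
      have "cmod (coord (free_group t x - free_group s x) k) \<le> 2 * cmod (coord x k)"
        using norm_triangle_ineq4[of "coord (free_group t x) k" "coord (free_group s x) k"]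
        by (simp add: norm_mult)
      from power_mono[OF this, of 2] show ?thesis by (simp add: power_mult_distrib)
    qed
  qed
  then have "(g \<longlongrightarrow> g s) (at s)"
    by (simp add: continuous_on_eq_continuous_at isCont_def)
  moreover have "g s = 0" by (simp add: g_def)
  moreover have "norm (free_group t x - free_group s x) = sqrt (g t)" for t
    by (simp add: norm_ell2_eq g_def)
  ultimately have "((\<lambda>t. norm (free_group t x - free_group s x)) \<longlongrightarrow> 0) (at s)"
    using tendsto_real_sqrt[of g 0 "at s"] by simp
  then show "((\<lambda>t. free_group t x) \<longlongrightarrow> free_group s x) (at s)"
    by (simp add: LIM_zero_iff tendsto_norm_zero_iff)
qed

text \<open>Strong continuity extends to a moving vector because the group is isometric.\<close>

lemma continuous_on_free_group:
  fixes x :: "'a::t2_space \<Rightarrow> int ell2" and g :: "'a \<Rightarrow> real"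
  assumes "continuous_on A g" "continuous_on A x"
  shows "continuous_on A (\<lambda>t. free_group (g t) (x t))"
  unfolding continuous_on_def
proof (intro ballI)
  fix s assume s: "s \<in> A"
  have 1: "((\<lambda>t. norm (x t - x s) + norm (free_group (g t) (x s) - free_group (g s) (x s))) \<longlongrightarrow> 0) (at s within A)"
  proof -
    have "((\<lambda>t. x t) \<longlongrightarrow> x s) (at s within A)" using assms(2) s by (auto simp: continuous_on_def)
    moreover have "((\<lambda>t. free_group (g t) (x s)) \<longlongrightarrow> free_group (g s) (x s)) (at s within A)"
      using continuous_on_compose2[OF free_group_strongly_continuous assms(1)] s
      by (auto simp: continuous_on_def)
    ultimately show ?thesis
      by (intro tendsto_add_zero) (simp_all add: tendsto_norm_zero_iff LIM_zero_iff)
  qed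
  have 2: "norm (free_group (g t) (x t) - free_group (g s) (x s))
      \<le> norm (x t - x s) + norm (free_group (g t) (x s) - free_group (g s) (x s))" for t
  proof -
    have "free_group (g t) (x t) - free_group (g s) (x s)
        = free_group (g t) (x t - x s) + (free_group (g t) (x s) - free_group (g s) (x s))"
      by (simp add: free_group_diff)
    then show ?thesis by (metis norm_free_group norm_triangle_ineq)
  qed
  have "((\<lambda>t. free_group (g t) (x t) - free_group (g s) (x s)) \<longlongrightarrow> 0) (at s within A)"
    by (rule Lim_null_comparison[OF _ 1]) (use 2 in auto)
  then show "((\<lambda>t. free_group (g t) (x t)) \<longlongrightarrow> free_group (g s) (x s)) (at s within A)"
    by (simp add: LIM_zero_iff)
qed

section \<open>Trilinear operators in the coordinates of \<open>ell2\<close>\<close>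

definition unemb :: "real \<Rightarrow> int ell2 \<Rightarrow> int \<Rightarrow> complex"
  where "unemb r x k = coord x k / of_real (wt r k)"

lemma unemb_hseq [simp]: "unemb r x \<in> hseq r"
  using hseq_coord(1)[of x r] by (simp add: unemb_def[abs_def])

lemma emb_unemb [simp]: "emb r (unemb r x) = x"
  using hseq_coord(2)[of r x] by (simp add: unemb_def[abs_def])

lemma unemb_emb [simp]: "a \<in> hseq r \<Longrightarrow> unemb r (emb r a) = a"
  by (rule ext) (simp add: unemb_def coord_emb)

lemma hnorm_unemb [simp]: "hnorm r (unemb r x) = norm x"
  using norm_emb[OF unemb_hseq, of r x] by simp

lemma unemb_diff: "unemb r (x - y) = (\<lambda>k. unemb r x k - unemb r y k)"
  by (rule ext) (simp add: unemb_def diff_divide_distrib)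

definition admissible :: "real \<Rightarrow> (int \<Rightarrow> int \<Rightarrow> int \<Rightarrow> complex) \<Rightarrow> bool"
  where "admissible M m \<longleftrightarrow> 0 \<le> M \<and> (\<forall>k i j. cmod (m k i j) * wt 1 k \<le> M * (wt 1 i * wt 1 (i + j - k) * wt 1 j))"

text \<open>A bounded multiplier has to pay only for \<open><k>\<close>, which is at most
  \<open>3 <i> <l> <j>\<close>: the source of the factor 3 in the bounds for
  \<open>phase_mult\<close>.\<close>

lemma admissible_bounded:
  assumes "\<And>k i j. cmod (m k i j) \<le> M"
  shows "admissible (3 * M) m"
  unfolding admissible_def
proof (intro conjI allI)
  show "0 \<le> 3 * M" using assms[of 0 0 0] norm_ge_zero[of "m 0 0 0"] by linarith
  fix k i j
  have "cmod (m k i j) * wt 1 k \<le> M * (3 * (wt 1 i * wt 1 (i + j - k) * wt 1 j))"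
    using wt_1_product[of i j "i + j - k"] assms[of k i j] order_trans[OF norm_ge_zero assms]
    by (intro mult_mono) auto
  then show "cmod (m k i j) * wt 1 k \<le> 3 * M * (wt 1 i * wt 1 (i + j - k) * wt 1 j)" by simp
qed

definition tri_op :: "real \<Rightarrow> (int \<Rightarrow> int \<Rightarrow> int \<Rightarrow> complex) \<Rightarrow> int ell2 \<Rightarrow> int ell2 \<Rightarrow> int ell2 \<Rightarrow> int ell2"
  where "tri_op r m x y z = emb r (tri m (unemb r x) (unemb r y) (unemb r z))"

abbreviation cubic_op :: "real \<Rightarrow> (int \<Rightarrow> int \<Rightarrow> int \<Rightarrow> complex) \<Rightarrow> int ell2 \<Rightarrow> int ell2"
  where "cubic_op r m x \<equiv> tri_op r m x x x"

lemma tri_const_nonneg [simp]: "0 \<le> tri_const r"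
  by (simp add: tri_const_def)

context
  fixes r :: real
  assumes r: "r > 3 / 2"
begin

lemma tri_unemb:
  assumes "admissible M m"
  shows "tri_summable m (unemb r x) (unemb r y) (unemb r z) k"
    "tri m (unemb r x) (unemb r y) (unemb r z) \<in> hseq r"
  using tri_mult(1,2)[OF r unemb_hseq unemb_hseq unemb_hseq, of M m] assms by (auto simp: admissible_def)

lemma norm_tri_op:
  assumes "admissible M m"
  shows "norm (tri_op r m x y z) \<le> M * tri_const r * (norm x * norm y * norm z)"
  using tri_mult(3)[OF r unemb_hseq unemb_hseq unemb_hseq, of M m x y z] assms
  by (simp add: admissible_def tri_op_def norm_emb tri_unemb[OF assms])

lemma coord_tri_op:
  "admissible M m \<Longrightarrow> coord (tri_op r m x y z) k = of_real (wt r k) * tri m (unemb r x) (unemb r y) (unemb r z) k"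
  by (simp add: tri_op_def coord_emb tri_unemb)

lemma tri_op_diff:
  assumes "admissible M m"
  shows "tri_op r m (x - x') y z = tri_op r m x y z - tri_op r m x' y z"
    "tri_op r m x (y - y') z = tri_op r m x y z - tri_op r m x y' z"
    "tri_op r m x y (z - z') = tri_op r m x y z - tri_op r m x y z'"
  by (rule ell2_eqI; simp add: coord_tri_op[OF assms] unemb_diff tri_diff tri_diff2 tri_diff3
      tri_unemb(1)[OF assms] algebra_simps)+

lemma cubic_op_diff:
  assumes "admissible M m"
  shows "cubic_op r m x - cubic_op r m y = tri_op r m (x - y) x x + tri_op r m y (x - y) x + tri_op r m y y (x - y)"
  by (simp add: tri_op_diff[OF assms])

lemma cubic_op_lipschitz:
  assumes "admissible M m" "norm x \<le> \<rho>" "norm y \<le> \<rho>"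
  shows "norm (cubic_op r m x - cubic_op r m y) \<le> 3 * (M * tri_const r * \<rho>\<^sup>2) * norm (x - y)"
proof -
  have \<rho>: "0 \<le> \<rho>" using assms(2) norm_ge_zero order_trans by blast
  have M: "0 \<le> M * tri_const r" using assms(1) by (simp add: admissible_def)
  have "norm (tri_op r m (x - y) x x) \<le> M * tri_const r * (norm (x - y) * \<rho> * \<rho>)"
    "norm (tri_op r m y (x - y) x) \<le> M * tri_const r * (\<rho> * norm (x - y) * \<rho>)"
    "norm (tri_op r m y y (x - y)) \<le> M * tri_const r * (\<rho> * \<rho> * norm (x - y))"
    using assms(2,3) \<rho> by (intro order_trans[OF norm_tri_op[OF assms(1)]] mult_left_mono mult_mono M; simp)+
  then show ?thesis
    unfolding cubic_op_diff[OF assms(1)]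
    using norm_triangle_ineq[of "tri_op r m (x - y) x x + tri_op r m y (x - y) x" "tri_op r m y y (x - y)"]
      norm_triangle_ineq[of "tri_op r m (x - y) x x" "tri_op r m y (x - y) x"]
    by (simp add: power2_eq_square algebra_simps)
qed

lemma tri_op_diff3:
  assumes "admissible M m"
  shows "norm (tri_op r m x y z - tri_op r m x' y' z') \<le> M * tri_const r *
    (norm (x - x') * norm y * norm z + norm x' * norm (y - y') * norm z + norm x' * norm y' * norm (z - z'))"
proof -
  have "tri_op r m x y z - tri_op r m x' y' z' = tri_op r m (x - x') y z + tri_op r m x' (y - y') z + tri_op r m x' y' (z - z')"
    by (simp add: tri_op_diff[OF assms])
  then have "norm (tri_op r m x y z - tri_op r m x' y' z')
    \<le> norm (tri_op r m (x - x') y z) + norm (tri_op r m x' (y - y') z) + norm (tri_op r m x' y' (z - z'))"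
    by (metis (no_types, lifting) add_mono norm_triangle_ineq norm_triangle_mono order_refl)
  also have "\<dots> \<le> M * tri_const r * (norm (x - x') * norm y * norm z) +
      M * tri_const r * (norm x' * norm (y - y') * norm z) + M * tri_const r * (norm x' * norm y' * norm (z - z'))"
    by (intro add_mono norm_tri_op assms)
  finally show ?thesis by (simp add: algebra_simps)
qed

text \<open>A mixed second difference, through which a remainder becomes Lipschitz in the data.
  Telescoping each pair gives three terms; comparing these for \<open>x\<close> and \<open>y\<close>
  leaves in each of them one mixed difference \<open>f\<close> and two products
  \<open>d * e\<close>, hence 3 and 6. In \<open>picard_remainder\<close>, \<open>d\<close> bounds
  increments in time and \<open>e\<close> differences of data.\<close>

lemma cubic_op_diff_diff:
  assumes "admissible M m" "norm x1 \<le> \<rho>" "norm x2 \<le> \<rho>" "norm y1 \<le> \<rho>" "norm y2 \<le> \<rho>"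
    and d: "norm (x1 - x2) \<le> d" "norm (y1 - y2) \<le> d" and e: "norm (x1 - y1) \<le> e" "norm (x2 - y2) \<le> e"
    and f: "norm ((x1 - x2) - (y1 - y2)) \<le> f"
  shows "norm ((cubic_op r m x1 - cubic_op r m x2) - (cubic_op r m y1 - cubic_op r m y2))
    \<le> M * tri_const r * (3 * (f * \<rho>\<^sup>2) + 6 * (d * e * \<rho>))"
proof -
  have \<rho>: "0 \<le> \<rho>" using assms(2) norm_ge_zero order_trans by blast
  have nn: "0 \<le> d" "0 \<le> e" "0 \<le> f" using d e f norm_ge_zero order_trans by blast+
  have M: "0 \<le> M * tri_const r" using assms(1) by (simp add: admissible_def)
  let ?p = "x1 - x2" and ?q = "y1 - y2"
  have 1: "norm (tri_op r m ?p x1 x1 - tri_op r m ?q y1 y1) \<le> M * tri_const r * (f * \<rho> * \<rho> + d * e * \<rho> + d * \<rho> * e)"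
    by (rule order_trans[OF tri_op_diff3[OF assms(1)]])
      (intro mult_left_mono add_mono mult_mono M f d e assms nn \<rho> norm_ge_zero mult_nonneg_nonneg)
  have 2: "norm (tri_op r m x2 ?p x1 - tri_op r m y2 ?q y1) \<le> M * tri_const r * (e * d * \<rho> + \<rho> * f * \<rho> + \<rho> * d * e)"
    by (rule order_trans[OF tri_op_diff3[OF assms(1)]])
      (intro mult_left_mono add_mono mult_mono M f d e assms nn \<rho> norm_ge_zero mult_nonneg_nonneg)
  have 3: "norm (tri_op r m x2 x2 ?p - tri_op r m y2 y2 ?q) \<le> M * tri_const r * (e * \<rho> * d + \<rho> * e * d + \<rho> * \<rho> * f)"
    by (rule order_trans[OF tri_op_diff3[OF assms(1)]])
      (intro mult_left_mono add_mono mult_mono M f d e assms nn \<rho> norm_ge_zero mult_nonneg_nonneg)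
  have "(cubic_op r m x1 - cubic_op r m x2) - (cubic_op r m y1 - cubic_op r m y2)
    = (tri_op r m ?p x1 x1 - tri_op r m ?q y1 y1) + (tri_op r m x2 ?p x1 - tri_op r m y2 ?q y1) + (tri_op r m x2 x2 ?p - tri_op r m y2 y2 ?q)"
    unfolding cubic_op_diff[OF assms(1)] by simp
  also have "norm \<dots> \<le> norm (tri_op r m ?p x1 x1 - tri_op r m ?q y1 y1) + norm (tri_op r m x2 ?p x1 - tri_op r m y2 ?q y1)
     + norm (tri_op r m x2 x2 ?p - tri_op r m y2 y2 ?q)"
    by (intro order_trans[OF norm_triangle_ineq] add_mono order_refl norm_triangle_ineq)
  finally show ?thesis using 1 2 3 by (simp add: power2_eq_square algebra_simps)
qed

end

section \<open>The interaction picture\<close>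

definition phase_mult :: "real \<Rightarrow> real \<Rightarrow> int \<Rightarrow> int \<Rightarrow> int \<Rightarrow> complex"
  where "phase_mult \<mu> t k i j = - \<i> * of_real \<mu> * exp (\<i> * of_real (t * of_int (2 * (k - i) * (k - j))))"

lemma norm_phase_mult: "cmod (phase_mult \<mu> t k i j) = \<bar>\<mu>\<bar>"
  by (simp add: phase_mult_def norm_mult)

lemma admissible_phase_mult: "admissible (3 * \<bar>\<mu>\<bar>) (phase_mult \<mu> t)"
  by (rule admissible_bounded) (simp add: norm_phase_mult)

lemma admissible_const: "admissible (3 * cmod z) (\<lambda>_ _ _. z)"
  by (rule admissible_bounded) simp

lemma unemb_free_group:
  "unemb r (free_group t x) k = phase t k * unemb r x k"
  by (simp add: unemb_def)

text \<open>With \<open>l = i + j - k\<close> one has \<open>k\<^sup>2 - i\<^sup>2 + l\<^sup>2 - j\<^sup>2 = 2 (k - i) (k - j)\<close>.\<close>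

lemma phase_factor:
  "phase t i * cnj (phase t (i + j - k))
      * phase t j
    = phase t k * exp (\<i> * of_real (t * of_int (2 * (k - i) * (k - j))))"
proof -
  have "- (\<i> * of_real t * (of_int i)\<^sup>2) + cnj (- (\<i> * of_real t * (of_int (i + j - k))\<^sup>2))
      + - (\<i> * of_real t * (of_int j)\<^sup>2)
    = - (\<i> * of_real t * (of_int k)\<^sup>2) + \<i> * of_real (t * of_int (2 * (k - i) * (k - j)))"
    by (simp add: power2_eq_square algebra_simps)
  then show ?thesis by (simp only: exp_add[symmetric] exp_cnj)
qed

lemma tri_phase:
  fixes a b c :: "int \<Rightarrow> complex"
  assumes e: "\<And>k. e k = phase t k"
  shows "tri (phase_mult \<mu> t) a b c k
    = exp (\<i> * of_real t * (of_int k)\<^sup>2) * tri (\<lambda>_ _ _. - \<i> * of_real \<mu>) (\<lambda>k. e k * a k) (\<lambda>k. e k * b k) (\<lambda>k. e k * c k) k"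
proof -
  have "exp (\<i> * of_real t * (of_int k)\<^sup>2) * (e i * cnj (e (i + j - k)) * e j)
      = exp (\<i> * of_real (t * of_int (2 * (k - i) * (k - j))))" for i j
    unfolding e phase_factor by (simp flip: exp_add mult.assoc)
  note E = this
  have *: "phase_mult \<mu> t k i j * (a i * cnj (b (i + j - k)) * c j)
      = exp (\<i> * of_real t * (of_int k)\<^sup>2) * (- \<i> * of_real \<mu> *
         ((e i * a i) * cnj (e (i + j - k) * b (i + j - k)) * (e j * c j)))" for i j
  proof -
    have "phase_mult \<mu> t k i j = - \<i> * of_real \<mu> * (exp (\<i> * of_real t * (of_int k)\<^sup>2) * (e i * cnj (e (i + j - k)) * e j))"
      unfolding E phase_mult_def ..
    then show ?thesis by (simp only: complex_cnj_mult mult_ac)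
  qed
  show ?thesis
    unfolding tri_def infsum_cmult_right'[symmetric]
    by (rule infsum_cong) (auto simp: *)
qed

context
  fixes r :: real
  assumes r: "r > 3 / 2"
begin

text \<open>All time dependence sits in the conjugation by the free group. The multiplier is not
  continuous in \<open>t\<close> uniformly in the frequencies, but in this form continuity of the
  vector field along a path reduces to strong continuity of the group.\<close>

lemma cubic_op_phase_mult: "cubic_op r (phase_mult \<mu> t) x = free_group (- t) (cubic_op r (\<lambda>_ _ _. - \<i> * of_real \<mu>) (free_group t x))"
proof (rule ell2_eqI)
  fix k
  show "coord (cubic_op r (phase_mult \<mu> t) x) k = coord (free_group (- t) (cubic_op r (\<lambda>_ _ _. - \<i> * of_real \<mu>) (free_group t x))) k"
    unfolding coord_free_group coord_tri_op[OF r admissible_phase_mult] coord_tri_op[OF r admissible_const]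
    by (simp add: tri_phase[OF refl] unemb_free_group[abs_def])
qed

lemma continuous_on_cubic_op:
  fixes y :: "'b::t2_space \<Rightarrow> int ell2"
  assumes "admissible M m" "continuous_on A y"
  shows "continuous_on A (\<lambda>t. cubic_op r m (y t))"
  unfolding continuous_on_def
proof (intro ballI)
  fix s assume "s \<in> A"
  then have y: "(y \<longlongrightarrow> y s) (at s within A)" using assms(2) by (auto simp: continuous_on_def)
  have "((\<lambda>t. cubic_op r m (y t) - cubic_op r m (y s)) \<longlongrightarrow> 0) (at s within A)"
  proof (rule Lim_null_comparison)
    show "\<forall>\<^sub>F t in at s within A. norm (cubic_op r m (y t) - cubic_op r m (y s)) \<le> M * tri_const r *
      (norm (y t - y s) * norm (y t) * norm (y t) + norm (y s) * norm (y t - y s) * norm (y t)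
       + norm (y s) * norm (y s) * norm (y t - y s))"
      by (intro always_eventually allI tri_op_diff3[OF r assms(1)])
    show "((\<lambda>t. M * tri_const r *
      (norm (y t - y s) * norm (y t) * norm (y t) + norm (y s) * norm (y t - y s) * norm (y t)
       + norm (y s) * norm (y s) * norm (y t - y s))) \<longlongrightarrow> 0) (at s within A)"
      by (rule tendsto_eq_intros y refl)+ simp
  qed
  then show "((\<lambda>t. cubic_op r m (y t)) \<longlongrightarrow> cubic_op r m (y s)) (at s within A)"
    by (simp add: LIM_zero_iff)
qed

lemma continuous_on_cubic_op_phase_mult:
  assumes "continuous_on A x"
  shows "continuous_on A (\<lambda>t. cubic_op r (phase_mult \<mu> t) (x t))"
  unfolding cubic_op_phase_mult
  by (intro continuous_on_free_group continuous_on_cubic_op[OF admissible_const] continuous_intros assms)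

end

section \<open>The energy of a truncated sequence\<close>

abbreviation cubic_seq :: "(int \<Rightarrow> complex) \<Rightarrow> int \<Rightarrow> complex"
  where "cubic_seq c \<equiv> tri (\<lambda>_ _ _. 1) c c c"

definition trunc_square :: "int \<Rightarrow> (int \<Rightarrow> complex) \<Rightarrow> (int \<Rightarrow> complex) \<Rightarrow> int \<Rightarrow> complex"
  where "trunc_square n a b m = (\<Sum>i\<in>{-n..n}. a i * b (m - i))"

definition supported :: "int \<Rightarrow> (int \<Rightarrow> complex) \<Rightarrow> bool"
  where "supported n v \<longleftrightarrow> (\<forall>k. k \<notin> {-n..n} \<longrightarrow> v k = 0)"

lemma supportedD: "supported n v \<Longrightarrow> k \<notin> {-n..n} \<Longrightarrow> v k = 0"
  by (auto simp: supported_def)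

text \<open>\<open>|v|^2 v\<close> is read as \<open>v^2 cnj v\<close> and grouped by the frequency
  \<open>m = i + j\<close> of \<open>v^2\<close>.\<close>

lemma cubic_seq_finite:
  assumes v: "supported n v"
  shows "cubic_seq v k = (\<Sum>m\<in>{-2*n..2*n}. trunc_square n v v m * cnj (v (m - k)))"
proof -
  let ?I = "{-n..n}" and ?J = "{-2*n..2*n}"
  have "cubic_seq v k = (\<Sum>\<^sub>\<infinity>p\<in>?I \<times> ?I. case p of (i, j) \<Rightarrow> v i * cnj (v (i + j - k)) * v j)"
    unfolding tri_def
  proof (rule infsum_cong_neutral)
    show "(case p of (i, j) \<Rightarrow> 1 * (v i * cnj (v (i + j - k)) * v j)) = 0" if "p \<in> UNIV - ?I \<times> ?I" for p
      using supportedD[OF v, of "fst p"] supportedD[OF v, of "snd p"] that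
      by (cases p) (auto simp del: atLeastAtMost_iff)
  qed auto
  also have "\<dots> = (\<Sum>i\<in>?I. \<Sum>j\<in>?I. v i * cnj (v (i + j - k)) * v j)"
    by (simp add: sum.cartesian_product)
  also have "\<dots> = (\<Sum>i\<in>?I. \<Sum>m\<in>?J. v i * cnj (v (m - k)) * v (m - i))"
  proof (rule sum.cong[OF refl])
    fix i assume i: "i \<in> ?I"
    have "(\<Sum>m\<in>?J. v i * cnj (v (m - k)) * v (m - i)) = (\<Sum>m\<in>(\<lambda>j. i + j) ` ?I. v i * cnj (v (m - k)) * v (m - i))"
    proof (rule sum.mono_neutral_right)
      show "(\<lambda>j. i + j) ` ?I \<subseteq> ?J" using i by auto
      show "\<forall>m\<in>?J - (\<lambda>j. i + j) ` ?I. v i * cnj (v (m - k)) * v (m - i) = 0"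
      proof
        fix m assume "m \<in> ?J - (\<lambda>j. i + j) ` ?I"
        then have "m - i \<notin> ?I" by (auto simp: image_iff)
        then show "v i * cnj (v (m - k)) * v (m - i) = 0" using supportedD[OF v] by simp
      qed
    qed simp
    also have "\<dots> = (\<Sum>j\<in>?I. v i * cnj (v (i + j - k)) * v j)"
      by (subst sum.reindex) (auto simp: inj_on_def)
    finally show "(\<Sum>j\<in>?I. v i * cnj (v (i + j - k)) * v j) = (\<Sum>m\<in>?J. v i * cnj (v (m - k)) * v (m - i))" ..
  qed
  also have "\<dots> = (\<Sum>m\<in>?J. trunc_square n v v m * cnj (v (m - k)))"
    unfolding trunc_square_def by (subst sum.swap) (simp add: sum_distrib_right sum_distrib_left mult_ac)
  finally show ?thesis .
qed

lemma trunc_square_commute: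
  assumes "supported n a" "supported n b"
  shows "trunc_square n a b m = trunc_square n b a m"
proof -
  let ?J = "{i \<in> {-n..n}. m - i \<in> {-n..n}}"
  have "trunc_square n a b m = (\<Sum>i\<in>?J. a i * b (m - i))"
    unfolding trunc_square_def by (rule sum.mono_neutral_right) (use supportedD[OF assms(2)] in auto)
  also have "\<dots> = (\<Sum>i\<in>?J. b i * a (m - i))"
    by (rule sum.reindex_bij_witness[of _ "\<lambda>i. m - i" "\<lambda>i. m - i"]) auto
  also have "\<dots> = trunc_square n b a m"
    unfolding trunc_square_def by (rule sum.mono_neutral_left) (use supportedD[OF assms(1)] in auto)
  finally show ?thesis .
qed

text \<open>Parseval's identity for the mean of \<open>p v cnj (v^2)\<close>.\<close>

lemma pairing_cubic_seq:
  assumes v: "supported n v"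
  shows "(\<Sum>k\<in>{-n..n}. p k * cnj (cubic_seq v k)) = (\<Sum>m\<in>{-2*n..2*n}. cnj (trunc_square n v v m) * trunc_square n p v m)"
  unfolding cubic_seq_finite[OF v] trunc_square_def[of n p] cnj_sum sum_distrib_left
  by (subst sum.swap) (simp add: mult_ac)

text \<open>By Parseval, the mean of \<open>|v|^4\<close> when \<open>v\<close> is a trigonometric
  polynomial of degree at most \<open>n\<close>.\<close>

definition quartic :: "int \<Rightarrow> (int \<Rightarrow> complex) \<Rightarrow> real"
  where "quartic n v = (\<Sum>m\<in>{-2*n..2*n}. (cmod (trunc_square n v v m))\<^sup>2)"

lemma pairing_cubic_seq_self:
  assumes v: "supported n v"
  shows "(\<Sum>k\<in>{-n..n}. v k * cnj (cubic_seq v k)) = of_real (quartic n v)"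
  unfolding pairing_cubic_seq[OF v] quartic_def of_real_sum
  by (rule sum.cong[OF refl]) (simp only: complex_norm_square mult.commute[of "trunc_square n v v _"])

lemma has_real_derivative_cmod_sq:
  fixes f :: "real \<Rightarrow> complex"
  assumes "(f has_vector_derivative f') (at t within S)"
  shows "((\<lambda>t. (cmod (f t))\<^sup>2) has_real_derivative 2 * Re (cnj (f t) * f')) (at t within S)"
proof -
  have R: "((\<lambda>t. Re (f t)) has_real_derivative Re f') (at t within S)"
    and I: "((\<lambda>t. Im (f t)) has_real_derivative Im f') (at t within S)"
    using assms by (simp_all add: has_vector_derivative_complex_iff)
  have "((\<lambda>t. (Re (f t))\<^sup>2 + (Im (f t))\<^sup>2) has_real_derivative 2 * Re (cnj (f t) * f')) (at t within S)"
    by (rule derivative_eq_intros R I refl)+ (simp add: algebra_simps)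
  then show ?thesis by (simp add: cmod_power2)
qed

text \<open>The factor 4 is 2 from the squared modulus times 2 from differentiating
  \<open>v^2\<close>, whose two terms agree by \<open>trunc_square_commute\<close>.\<close>

lemma quartic_derivative:
  fixes v :: "real \<Rightarrow> int \<Rightarrow> complex"
  assumes v: "\<And>t. supported n (v t)" "supported n p"
    and d: "\<And>k. ((\<lambda>t. v t k) has_vector_derivative p k) (at t within S)"
  shows "((\<lambda>t. quartic n (v t)) has_real_derivative 4 * Re (\<Sum>k\<in>{-n..n}. p k * cnj (cubic_seq (v t) k))) (at t within S)"
proof -
  have s: "((\<lambda>t. trunc_square n (v t) (v t) m) has_vector_derivative 2 * trunc_square n p (v t) m) (at t within S)" for m
  proof -
    have "((\<lambda>t. trunc_square n (v t) (v t) m) has_vector_derivative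
        (\<Sum>i\<in>{-n..n}. v t i * p (m - i) + p i * v t (m - i))) (at t within S)"
      unfolding trunc_square_def by (intro has_vector_derivative_sum has_vector_derivative_mult d)
    also have "(\<Sum>i\<in>{-n..n}. v t i * p (m - i) + p i * v t (m - i)) = trunc_square n (v t) p m + trunc_square n p (v t) m"
      by (simp add: trunc_square_def sum.distrib)
    also have "trunc_square n (v t) p m = trunc_square n p (v t) m"
      by (rule trunc_square_commute) (use v in auto)
    finally show ?thesis by simp
  qed
  have "((\<lambda>t. quartic n (v t)) has_real_derivative
      (\<Sum>m\<in>{-2*n..2*n}. 2 * Re (cnj (trunc_square n (v t) (v t) m) * (2 * trunc_square n p (v t) m)))) (at t within S)"
    unfolding quartic_def by (intro DERIV_sum has_real_derivative_cmod_sq s)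
  also have "(\<Sum>m\<in>{-2*n..2*n}. 2 * Re (cnj (trunc_square n (v t) (v t) m) * (2 * trunc_square n p (v t) m)))
     = 4 * Re (\<Sum>k\<in>{-n..n}. p k * cnj (cubic_seq (v t) k))"
    unfolding pairing_cubic_seq[OF v(1)] Re_sum sum_distrib_left
    by (rule sum.cong) (simp_all add: algebra_simps)
  finally show ?thesis .
qed

lemma sum_mult_hnorm:
  assumes "a \<in> hseq s" "b \<in> hseq s" "finite F"
  shows "(\<Sum>k\<in>F. (wt s k * cmod (a k)) * (wt s k * cmod (b k))) \<le> hnorm s a * hnorm s b"
proof -
  have L: "L2_set (\<lambda>k. wt s k * cmod (a k)) F \<le> hnorm s a" if "a \<in> hseq s" for a
    unfolding L2_set_def hnorm_def power_mult_distrib wt_sq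
    by (intro real_sqrt_le_mono finite_sum_le_infsum) (use that assms(3) in \<open>auto simp: hseq_def\<close>)
  have "(\<Sum>k\<in>F. (wt s k * cmod (a k)) * (wt s k * cmod (b k)))
      \<le> L2_set (\<lambda>k. wt s k * cmod (a k)) F * L2_set (\<lambda>k. wt s k * cmod (b k)) F"
    using L2_set_mult_ineq[of "\<lambda>k. wt s k * cmod (a k)" "\<lambda>k. wt s k * cmod (b k)" F]
    by (simp add: abs_mult)
  also have "\<dots> \<le> hnorm s a * hnorm s b"
    by (intro mult_mono L assms) (auto simp: L2_set_nonneg)
  finally show ?thesis .
qed

lemma finite_support_hseq:
  fixes n :: int
  assumes v: "supported n v"
  shows "v \<in> hseq s" "(hnorm s v)\<^sup>2 = (\<Sum>k\<in>{-n..n}. (1 + (of_int k)\<^sup>2) powr s * (cmod (v k))\<^sup>2)"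
    "l1seq v"
proof -
  have "(\<lambda>k. (1 + (of_int k)\<^sup>2) powr s * (cmod (v k))\<^sup>2) summable_on {-n..n}" by simp
  also have "?this \<longleftrightarrow> v \<in> hseq s"
    unfolding hseq_def mem_Collect_eq by (rule summable_on_cong_neutral) (use supportedD[OF v] in auto)
  finally show "v \<in> hseq s" .
  have "(\<lambda>k. cmod (v k)) summable_on {-n..n}" by simp
  also have "?this \<longleftrightarrow> l1seq v"
    by (rule summable_on_cong_neutral) (use supportedD[OF v] in auto)
  finally show "l1seq v" .
  have "(hnorm s v)\<^sup>2 = (\<Sum>\<^sub>\<infinity>k. (1 + (of_int k)\<^sup>2) powr s * (cmod (v k))\<^sup>2)"
    unfolding hnorm_def by (simp add: infsum_nonneg)
  also have "\<dots> = (\<Sum>\<^sub>\<infinity>k\<in>{-n..n}. (1 + (of_int k)\<^sup>2) powr s * (cmod (v k))\<^sup>2)"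
    by (rule infsum_cong_neutral) (use supportedD[OF v] in auto)
  finally show "(hnorm s v)\<^sup>2 = (\<Sum>k\<in>{-n..n}. (1 + (of_int k)\<^sup>2) powr s * (cmod (v k))\<^sup>2)" by simp
qed

text \<open>Instead of a Gagliardo-Nirenberg inequality: the sup norm is at most the \<open>l1norm\<close>, which is
  controlled at regularity 3/4, and \<open>y powr (3/4) \<le> e * y + e\<^sup>-\<^sup>3\<close> separates the kinetic energy.\<close>

lemma quartic_bound:
  assumes v: "supported n v" and e: "0 < e"
  shows "quartic n v \<le> 3 * (\<Sum>k\<in>{-n..n}. (cmod (v k))\<^sup>2) * ((sob_const (3/4))\<^sup>2 *
     (e * (\<Sum>k\<in>{-n..n}. (1 + (of_int k)\<^sup>2) * (cmod (v k))\<^sup>2) + (1 / e) ^ 3 * (\<Sum>k\<in>{-n..n}. (cmod (v k))\<^sup>2)))"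
proof -
  note h = finite_support_hseq[OF v]
  let ?\<sigma> = "sob_const (3/4)"
  have h0: "(hnorm 0 v)\<^sup>2 = (\<Sum>k\<in>{-n..n}. (cmod (v k))\<^sup>2)"
    unfolding h(2) wt_sq[symmetric] wt_0 by simp
  have "of_real (quartic n v) = (\<Sum>k\<in>{-n..n}. v k * cnj (cubic_seq v k))"
    by (rule pairing_cubic_seq_self[OF v, symmetric])
  then have "quartic n v \<le> cmod (\<Sum>k\<in>{-n..n}. v k * cnj (cubic_seq v k))"
    by (metis abs_ge_self norm_of_real)
  also have "\<dots> \<le> (\<Sum>k\<in>{-n..n}. (wt 0 k * cmod (v k)) * (wt 0 k * cmod (cubic_seq v k)))"
    by (rule sum_norm_le) (simp add: norm_mult)
  also have "\<dots> \<le> hnorm 0 v * hnorm 0 (cubic_seq v)"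
    by (rule sum_mult_hnorm[OF h(1) tri_tame(2)[OF _ h(1) h(1) h(1) h(3) h(3) h(3), of 0 _ 1]]) auto
  also have "\<dots> \<le> hnorm 0 v * (3 * hnorm 0 v * (l1norm v)\<^sup>2)"
    using tri_tame(3)[OF _ h(1) h(1) h(1) h(3) h(3) h(3), of 0 "\<lambda>_ _ _. 1" 1]
    by (intro mult_left_mono) (auto simp: power2_eq_square algebra_simps)
  also have "\<dots> = 3 * (hnorm 0 v)\<^sup>2 * (l1norm v)\<^sup>2" by (simp add: power2_eq_square)
  also have "\<dots> \<le> 3 * (hnorm 0 v)\<^sup>2 * (?\<sigma>\<^sup>2 * (hnorm (3/4) v)\<^sup>2)"
    using hseq_l1(2)[OF _ h(1), of "3/4"]
    by (intro mult_left_mono) (auto simp flip: power_mult_distrib intro!: power_mono)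
  finally have 1: "quartic n v \<le> 3 * (hnorm 0 v)\<^sup>2 * (?\<sigma>\<^sup>2 * (hnorm (3/4) v)\<^sup>2)" .
  have 2: "(hnorm (3/4) v)\<^sup>2 \<le> e * (\<Sum>k\<in>{-n..n}. (1 + (of_int k)\<^sup>2) * (cmod (v k))\<^sup>2)
      + (1 / e) ^ 3 * (\<Sum>k\<in>{-n..n}. (cmod (v k))\<^sup>2)"
  proof -
    \<comment> \<open>Where \<open>y powr (1/4)\<close> is at least \<open>1 / e\<close>, the factor
      \<open>e * y powr (1/4)\<close>, at least 1, can be inserted; elsewhere the power is below
      \<open>(1 / e) ^ 3\<close>.\<close>
    have *: "y powr (3/4) \<le> e * y + (1 / e) ^ 3" if y: "1 \<le> y" for y :: real
    proof (cases "1 / e \<le> y powr (1/4)")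
      case True
      then have "y powr (3/4) * 1 \<le> y powr (3/4) * (e * y powr (1/4))"
        using e by (intro mult_left_mono) (auto simp: field_simps)
      also have "\<dots> = e * y"
        using y by (simp add: mult.left_commute flip: powr_add)
      finally show ?thesis using e by simp (smt (verit) zero_le_power zero_le_divide_iff)
    next
      case False
      have "y powr (3/4) = (y powr (1/4)) ^ 3"
        using y by (simp add: powr_power)
      also have "\<dots> \<le> (1 / e) ^ 3" using False by (intro power_mono) auto
      finally show ?thesis using e y by (smt (verit) mult_nonneg_nonneg)
    qed
    have "(hnorm (3/4) v)\<^sup>2 \<le> (\<Sum>k\<in>{-n..n}. (e * (1 + (of_int k)\<^sup>2) + (1 / e) ^ 3) * (cmod (v k))\<^sup>2)"
      unfolding h(2) by (intro sum_mono mult_right_mono *) auto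
    then show ?thesis by (simp add: algebra_simps sum.distrib sum_distrib_left)
  qed
  show ?thesis
    unfolding h0[symmetric] by (rule order_trans[OF 1]) (intro mult_left_mono 2[unfolded h0[symmetric]]; simp)
qed

section \<open>A priori bounds from conservation of mass and energy\<close>

definition trajectory :: "real \<Rightarrow> real \<Rightarrow> real \<Rightarrow> int ell2 \<Rightarrow> (real \<Rightarrow> int ell2) \<Rightarrow> bool"
  where "trajectory r \<mu> T x0 x \<longleftrightarrow> continuous_on {0..T} x \<and>
    (\<forall>t\<in>{0..T}. x t = x0 + integral {0..t} (\<lambda>s. cubic_op r (phase_mult \<mu> s) (x s)))"

text \<open>Back from the interaction picture: the unweighted Fourier coefficients of the solution
  at time \<open>t\<close>, on which mass and energy are evaluated.\<close>

definition modes :: "real \<Rightarrow> (real \<Rightarrow> int ell2) \<Rightarrow> real \<Rightarrow> int \<Rightarrow> complex"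
  where "modes r x t = unemb r (free_group t (x t))"

lemma modes_hseq [simp]: "modes r x t \<in> hseq r" "hnorm r (modes r x t) = norm (x t)"
  by (simp_all add: modes_def)

lemma tri_const_mult: "tri (\<lambda>_ _ _. z) a b c k = z * tri (\<lambda>_ _ _. 1) a b c k"
  unfolding tri_def infsum_cmult_right'[symmetric] by (rule infsum_cong) auto

text \<open>The energy argument takes place in \<open>H^1\<close>, which is an algebra too; 9 is
  \<open>3 powr 1\<close> times three terms.\<close>

lemma tri_hseq_1:
  assumes "a \<in> hseq 1" "b \<in> hseq 1" "c \<in> hseq 1"
  shows "tri_summable (\<lambda>_ _ _. 1) a b c k" "tri (\<lambda>_ _ _. 1) a b c \<in> hseq 1"
    "hnorm 1 (tri (\<lambda>_ _ _. 1) a b c) \<le> 9 * (sob_const 1)\<^sup>2 * (hnorm 1 a * hnorm 1 b * hnorm 1 c)"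
proof -
  let ?s = "sob_const 1"
  have "(1::real) > 1 / 2" by simp
  note l = hseq_l1[OF this]
  note T = tri_tame[OF zero_le_one assms l(1)[OF assms(1)] l(1)[OF assms(2)] l(1)[OF assms(3)],
      of "\<lambda>_ _ _. 1" 1]
  show "tri_summable (\<lambda>_ _ _. 1) a b c k" "tri (\<lambda>_ _ _. 1) a b c \<in> hseq 1"
    using T(1,2) by auto
  have "hnorm 1 a * l1norm b * l1norm c \<le> hnorm 1 a * (?s * hnorm 1 b) * (?s * hnorm 1 c)"
    "l1norm a * hnorm 1 b * l1norm c \<le> (?s * hnorm 1 a) * hnorm 1 b * (?s * hnorm 1 c)"
    "l1norm a * l1norm b * hnorm 1 c \<le> (?s * hnorm 1 a) * (?s * hnorm 1 b) * hnorm 1 c"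
    by (intro mult_mono l assms mult_nonneg_nonneg; simp)+
  then show "hnorm 1 (tri (\<lambda>_ _ _. 1) a b c) \<le> 9 * ?s\<^sup>2 * (hnorm 1 a * hnorm 1 b * hnorm 1 c)"
    using T(3) by (simp add: power2_eq_square algebra_simps)
qed

lemma cubic_seq_diff_bound:
  assumes a: "a \<in> hseq 1" "hnorm 1 a \<le> H" and b: "b \<in> hseq 1" "hnorm 1 b \<le> H"
  shows "(\<lambda>k. cubic_seq a k - cubic_seq b k) \<in> hseq 1"
    "hnorm 1 (\<lambda>k. cubic_seq a k - cubic_seq b k) \<le> 27 * (sob_const 1)\<^sup>2 * H\<^sup>2 * hnorm 1 (\<lambda>k. a k - b k)"
proof -
  let ?d = "\<lambda>k. a k - b k" and ?T = "tri (\<lambda>_ _ _. 1)" and ?s = "9 * (sob_const 1)\<^sup>2"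
  have d: "?d \<in> hseq 1" by (intro hseq_diff a b)
  have H: "0 \<le> H" using a(2) hnorm_nonneg order_trans by blast
  note T = tri_hseq_1
  have eq: "cubic_seq a k - cubic_seq b k = (?T ?d a a k + ?T b ?d a k) + ?T b b ?d k" for k
    by (simp add: tri_diff tri_diff2 tri_diff3 T(1) a b)
  show "(\<lambda>k. cubic_seq a k - cubic_seq b k) \<in> hseq 1"
    unfolding eq by (intro hseq_add T(2) a b d)
  have "hnorm 1 (\<lambda>k. cubic_seq a k - cubic_seq b k) \<le> hnorm 1 (?T ?d a a) + hnorm 1 (?T b ?d a) + hnorm 1 (?T b b ?d)"
    unfolding eq
    by (intro order_trans[OF hnorm_triangle] add_mono order_refl hseq_add(1) T(2) a b d)
  also have "\<dots> \<le> ?s * (hnorm 1 ?d * H * H) + ?s * (H * hnorm 1 ?d * H) + ?s * (H * H * hnorm 1 ?d)"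
    by (intro add_mono order_trans[OF T(3)] a b d mult_left_mono mult_mono H mult_nonneg_nonneg order_refl hnorm_nonneg)
      auto
  finally show "hnorm 1 (\<lambda>k. cubic_seq a k - cubic_seq b k) \<le> 27 * (sob_const 1)\<^sup>2 * H\<^sup>2 * hnorm 1 ?d"
    by (simp add: power2_eq_square algebra_simps)
qed

section \<open>The cut-off in frequency\<close>

definition trunc :: "int \<Rightarrow> (int \<Rightarrow> complex) \<Rightarrow> int \<Rightarrow> complex"
  where "trunc n c k = (if k \<in> {-n..n} then c k else 0)"

lemma supported_trunc [simp]: "supported n (trunc n c)"
  by (simp add: supported_def trunc_def)

lemma hnorm_trunc:
  assumes "c \<in> hseq s"
  shows "trunc n c \<in> hseq s" "hnorm s (trunc n c) \<le> hnorm s c"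
  using hseq_mono[OF assms, of s "trunc n c" 1] by (auto simp: trunc_def)

lemma wt_neg_antimono:
  assumes "0 \<le> s" "\<bar>n\<bar> \<le> \<bar>k\<bar>"
  shows "wt (- s) k \<le> wt (- s) n"
proof -
  have "(real_of_int n)\<^sup>2 \<le> (real_of_int k)\<^sup>2"
    using assms(2) by (simp add: abs_le_square_iff flip: of_int_power)
  moreover have "0 < 1 + (real_of_int n)\<^sup>2" by (smt (verit) zero_le_power2)
  ultimately show ?thesis
    unfolding wt_def using assms(1) by (intro powr_mono2') auto
qed

text \<open>Outside the band, \<open>wt 1 k = wt (- (r - 1)) k * wt r k\<close>: the
  \<open>r - 1\<close> spare derivatives pay for decay in \<open>n\<close>.\<close>

lemma hnorm_tail:
  assumes "c \<in> hseq r" "1 \<le> r" "0 \<le> n"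
  shows "hnorm 1 (\<lambda>k. trunc n c k - c k) \<le> wt (- (r - 1)) n * hnorm r c"
proof (rule hseq_mono(2)[OF assms(1)])
  fix k
  show "wt 1 k * cmod (trunc n c k - c k) \<le> wt (- (r - 1)) n * (wt r k * cmod (c k))"
  proof (cases "k \<in> {-n..n}")
    case False
    then have "wt (- (r - 1)) k \<le> wt (- (r - 1)) n"
      using assms by (intro wt_neg_antimono) auto
    then have "wt (- (r - 1)) k * wt r k \<le> wt (- (r - 1)) n * wt r k"
      by (rule mult_right_mono) simp
    moreover have "wt (- (r - 1)) k * wt r k = wt 1 k" by (simp flip: wt_add)
    ultimately have "wt 1 k \<le> wt (- (r - 1)) n * wt r k" by linarith
    then have "wt 1 k * cmod (c k) \<le> wt (- (r - 1)) n * wt r k * cmod (c k)"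
      by (intro mult_right_mono) auto
    then show ?thesis using False by (simp add: trunc_def mult.assoc)
  qed (simp add: trunc_def)
qed simp

lemma wt_neg_tendsto_0:
  assumes "0 < s"
  shows "(\<lambda>n. wt (- s) (int n)) \<longlonglongrightarrow> 0"
proof (rule tendsto_sandwich[of "\<lambda>_. 0"])
  have "(\<lambda>n. real n powr (- s)) \<longlonglongrightarrow> 0"
    using assms by (intro tendsto_neg_powr filterlim_real_sequentially) auto
  then show "(\<lambda>n. real n powr (- s)) \<longlonglongrightarrow> 0" .
  show "\<forall>\<^sub>F n in sequentially. wt (- s) (int n) \<le> real n powr (- s)"
    using eventually_gt_at_top[of 0]
  proof eventually_elim
    case (elim n)
    then show ?case
      unfolding wt_eq_powr[of "- s"] using abs_le_wt_1[of "int n"] assms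
      by (intro powr_mono2') auto
  qed
qed auto

definition trunc_mass :: "int \<Rightarrow> (int \<Rightarrow> complex) \<Rightarrow> real"
  where "trunc_mass n v = (\<Sum>k\<in>{-n..n}. (cmod (v k))\<^sup>2)"

definition trunc_kinetic :: "int \<Rightarrow> (int \<Rightarrow> complex) \<Rightarrow> real"
  where "trunc_kinetic n v = (\<Sum>k\<in>{-n..n}. (of_int k)\<^sup>2 * (cmod (v k))\<^sup>2)"

lemma trunc_mass_trunc_kinetic_le:
  assumes "c \<in> hseq r" "1 \<le> r"
  shows "trunc_mass n c \<le> (hnorm r c)\<^sup>2" "trunc_kinetic n c \<le> (hnorm r c)\<^sup>2"
proof -
  have "(\<Sum>k\<in>{-n..n}. (1 + (of_int k)\<^sup>2) powr r * (cmod (c k))\<^sup>2) \<le> (hnorm r c)\<^sup>2" (is "?S \<le> _")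
    unfolding hnorm_def using assms(1)
    by (subst real_sqrt_pow2) (auto intro!: infsum_nonneg finite_sum_le_infsum simp: hseq_def)
  moreover have "1 + (of_int k)\<^sup>2 \<le> (1 + (of_int k :: real)\<^sup>2) powr r" for k
    using assms(2) powr_mono[of 1 r "1 + (of_int k :: real)\<^sup>2"] by simp
  then have "(\<Sum>k\<in>{-n..n}. (1 + (of_int k)\<^sup>2) * (cmod (c k))\<^sup>2) \<le> ?S"
    by (intro sum_mono mult_right_mono) auto
  ultimately have "trunc_mass n c + trunc_kinetic n c \<le> (hnorm r c)\<^sup>2"
    by (simp add: trunc_mass_def trunc_kinetic_def algebra_simps sum.distrib)
  moreover have "0 \<le> trunc_mass n c" "0 \<le> trunc_kinetic n c"
    by (auto simp: trunc_mass_def trunc_kinetic_def intro!: sum_nonneg)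
  ultimately show "trunc_mass n c \<le> (hnorm r c)\<^sup>2" "trunc_kinetic n c \<le> (hnorm r c)\<^sup>2" by auto
qed

context
  fixes r :: real
  assumes r: "r > 3 / 2"
begin

text \<open>The Schroedinger equation mode by mode. Each single coefficient is differentiable
  although the solution need not lie in \<open>H^2\<close>.\<close>

lemma modes_derivative:
  assumes x: "trajectory r \<mu> T x0 x" and t: "t \<in> {0..T}"
  shows "((\<lambda>t. modes r x t k) has_vector_derivative
    - \<i> * ((of_int k)\<^sup>2 * modes r x t k + of_real \<mu> * cubic_seq (modes r x t) k)) (at t within {0..T})"
proof -
  let ?N = "\<lambda>s. cubic_op r (phase_mult \<mu> s) (x s)"
  have xc: "continuous_on {0..T} x" using x by (simp add: trajectory_def)
  have "((\<lambda>t. x0 + integral {0..t} ?N) has_vector_derivative 0 + ?N t) (at t within {0..T})"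
    by (intro has_vector_derivative_add integral_has_vector_derivative continuous_on_cubic_op_phase_mult[OF r] xc t) auto
  then have "(x has_vector_derivative ?N t) (at t within {0..T})"
    using x by (intro has_vector_derivative_transform[OF t, of x "\<lambda>t. x0 + integral {0..t} ?N"])
      (auto simp: trajectory_def)
  from bounded_linear.has_vector_derivative[OF bounded_linear_coord this, of k]
  have "((\<lambda>t. coord (x t) k / of_real (wt r k)) has_vector_derivative coord (?N t) k / of_real (wt r k)) (at t within {0..T})"
    by (rule has_vector_derivative_divide)
  then have u: "((\<lambda>t. unemb r (x t) k) has_vector_derivative coord (?N t) k / of_real (wt r k)) (at t within {0..T})"
    by (simp add: unemb_def)
  let ?e = "\<lambda>t. phase t k"
  have m: "modes r x t k = ?e t * unemb r (x t) k" for t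
    by (simp add: modes_def unemb_free_group)
  have mf: "modes r x t = (\<lambda>k. phase t k * unemb r (x t) k)"
    by (rule ext) (simp add: modes_def unemb_free_group)
  have e: "(?e has_vector_derivative - (\<i> * (of_int k)\<^sup>2) * ?e t) (at t within {0..T})"
    by (rule has_vector_derivative_real_field) (auto intro!: derivative_eq_intros)
  have d: "((\<lambda>t. ?e t * unemb r (x t) k) has_vector_derivative
      ?e t * (coord (?N t) k / of_real (wt r k)) + (- (\<i> * (of_int k)\<^sup>2) * ?e t) * unemb r (x t) k) (at t within {0..T})"
    by (rule has_vector_derivative_mult[OF e u])
  have N: "coord (?N t) k / of_real (wt r k) = exp (\<i> * of_real t * (of_int k)\<^sup>2) * (- \<i> * of_real \<mu> * cubic_seq (modes r x t) k)"
    unfolding coord_tri_op[OF r admissible_phase_mult] tri_phase[OF refl] tri_const_mult[of "- \<i> * of_real \<mu>"]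
    by (simp add: mf)
  have "?e t * exp (\<i> * of_real t * (of_int k)\<^sup>2) = 1" by (simp flip: exp_add)
  then have "?e t * (coord (?N t) k / of_real (wt r k)) = - \<i> * of_real \<mu> * cubic_seq (modes r x t) k"
    unfolding N by (simp flip: mult.assoc)
  with d show ?thesis unfolding m by (simp add: algebra_simps)
qed

text \<open>A trajectory is not regular enough to differentiate its energy, so the Fourier modes beyond \<open>n\<close>
  are cut off.  Since \<open>k\<^sup>2 c\<^sub>k + \<mu> N(c)\<^sub>k = i c'\<^sub>k\<close>, only the commutator of the nonlinearity and the
  cut-off survives in the derivative, and it tends to 0 as \<open>r > 1\<close>.\<close>

lemma energy_almost_conserved:
  assumes x: "trajectory r \<mu> T x0 x" and \<rho>: "\<And>t. t \<in> {0..T} \<Longrightarrow> norm (x t) \<le> \<rho>" and T: "0 \<le> T" and n: "0 \<le> n"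
    and t: "t \<in> {0..T}"
  defines "B \<equiv> 2 * \<bar>\<mu>\<bar> * (\<rho> + \<bar>\<mu>\<bar> * (9 * (sob_const 1)\<^sup>2 * \<rho> ^ 3)) * (27 * (sob_const 1)\<^sup>2 * \<rho> ^ 3 * wt (- (r - 1)) n)"
  shows "\<bar>trunc_mass n (modes r x t) - trunc_mass n (modes r x 0)\<bar> \<le> B * t"
    "\<bar>(trunc_kinetic n (modes r x t) + \<mu> / 2 * quartic n (trunc n (modes r x t)))
      - (trunc_kinetic n (modes r x 0) + \<mu> / 2 * quartic n (trunc n (modes r x 0)))\<bar> \<le> B * t"
proof -
  let ?c = "modes r x" and ?I = "{-n..n}"
  let ?v = "\<lambda>t. trunc n (?c t)"
  have c1: "?c t \<in> hseq 1" "hnorm 1 (?c t) \<le> \<rho>" if "t \<in> {0..T}" for t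
    using hseq_weaken[OF modes_hseq(1), of 1 r x t] \<rho>[OF that] r by auto
  have v1: "?v t \<in> hseq 1" "hnorm 1 (?v t) \<le> \<rho>" if "t \<in> {0..T}" for t
    using hnorm_trunc[OF c1(1)[OF that], of n] c1(2)[OF that] by auto
  have \<rho>0: "0 \<le> \<rho>" using order_trans[OF norm_ge_zero \<rho>[of 0]] T by simp
  define \<delta> where "\<delta> t k = cubic_seq (?v t) k - cubic_seq (?c t) k" for t k
  define D where "D = 27 * (sob_const 1)\<^sup>2 * \<rho> ^ 3 * wt (- (r - 1)) n"
  have Beq: "B = 2 * \<bar>\<mu>\<bar> * ((\<rho> + \<bar>\<mu>\<bar> * (9 * (sob_const 1)\<^sup>2 * \<rho> ^ 3)) * D)"
    by (simp add: B_def D_def)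
  have \<delta>: "\<delta> t \<in> hseq 1" "hnorm 1 (\<delta> t) \<le> D" if "t \<in> {0..T}" for t
  proof -
    note cd = cubic_seq_diff_bound[OF v1[OF that] c1[OF that]]
    show "\<delta> t \<in> hseq 1" using cd(1) by (simp add: \<delta>_def[abs_def])
    have "hnorm 1 (\<delta> t) \<le> 27 * (sob_const 1)\<^sup>2 * \<rho>\<^sup>2 * hnorm 1 (\<lambda>k. ?v t k - ?c t k)"
      using cd(2) by (simp add: \<delta>_def[abs_def])
    also have "\<dots> \<le> 27 * (sob_const 1)\<^sup>2 * \<rho>\<^sup>2 * (wt (- (r - 1)) n * \<rho>)"
    proof (rule mult_left_mono)
      show "hnorm 1 (\<lambda>k. ?v t k - ?c t k) \<le> wt (- (r - 1)) n * \<rho>"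
        by (rule order_trans[OF hnorm_tail[OF modes_hseq(1)]])
          (use r n in \<open>auto intro!: mult_left_mono \<rho>[OF that]\<close>)
    qed simp
    finally show "hnorm 1 (\<delta> t) \<le> D" by (simp add: D_def power3_eq_cube power2_eq_square algebra_simps)
  qed
  define p where "p t k = - \<i> * ((of_int k)\<^sup>2 * ?c t k + of_real \<mu> * cubic_seq (?c t) k)" for t k
  have dc: "((\<lambda>t. ?c t k) has_vector_derivative p t k) (at t within {0..T})" if "t \<in> {0..T}" for t k
    unfolding p_def by (rule modes_derivative[OF x that])
  have sum_eq: "(\<Sum>k\<in>?I. f k) = (\<Sum>k\<in>?I. g k)" if "\<And>k. k \<in> ?I \<Longrightarrow> f k = g k" for f g :: "int \<Rightarrow> complex"
    using that by (rule sum.cong[OF refl])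
  have dM: "((\<lambda>t. trunc_mass n (?c t)) has_real_derivative - 2 * \<mu> * Im (\<Sum>k\<in>?I. \<delta> t k * cnj (?v t k))) (at t within {0..T})"
    if t: "t \<in> {0..T}" for t
  proof -
    have "((\<lambda>t. trunc_mass n (?c t)) has_real_derivative (\<Sum>k\<in>?I. 2 * Re (cnj (?c t k) * p t k))) (at t within {0..T})"
      unfolding trunc_mass_def by (intro DERIV_sum has_real_derivative_cmod_sq dc t)
    moreover have "(\<Sum>k\<in>?I. 2 * Re (cnj (?c t k) * p t k)) = 2 * \<mu> * Im (\<Sum>k\<in>?I. cubic_seq (?c t) k * cnj (?v t k))"
      unfolding Im_sum sum_distrib_left
      by (rule sum.cong) (auto simp: p_def trunc_def algebra_simps)
    \<comment> \<open>The truncated sequence paired with its own cubic term gives the real number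
      \<open>quartic\<close>, so only the commutator \<open>\<delta>\<close> is left.\<close>
    moreover have "Im (\<Sum>k\<in>?I. cubic_seq (?c t) k * cnj (?v t k)) = - Im (\<Sum>k\<in>?I. \<delta> t k * cnj (?v t k))"
    proof -
      have "cnj (\<Sum>k\<in>?I. ?v t k * cnj (cubic_seq (?v t) k)) = cnj (of_real (quartic n (?v t)))"
        by (subst pairing_cubic_seq_self) auto
      then have "(\<Sum>k\<in>?I. cubic_seq (?v t) k * cnj (?v t k)) = of_real (quartic n (?v t))"
        by (simp add: mult.commute)
      then have "Im (\<Sum>k\<in>?I. cubic_seq (?v t) k * cnj (?v t k)) = 0" by simp
      then show ?thesis by (simp add: \<delta>_def algebra_simps sum_subtractf del: Im_sum)
    qed
    ultimately show ?thesis by simp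
  qed
  have bM: "\<bar>- 2 * \<mu> * Im (\<Sum>k\<in>?I. \<delta> t k * cnj (?v t k))\<bar> \<le> B" if t: "t \<in> {0..T}" for t
  proof -
    have "\<bar>Im (\<Sum>k\<in>?I. \<delta> t k * cnj (?v t k))\<bar> \<le> (\<Sum>k\<in>?I. (wt 1 k * cmod (?v t k)) * (wt 1 k * cmod (\<delta> t k)))"
    proof (rule order_trans[OF abs_Im_le_cmod sum_norm_le])
      fix k
      have "1 * 1 \<le> wt 1 k * wt 1 k" by (intro mult_mono wt_ge1) auto
      from mult_right_mono[OF this, of "cmod (?v t k) * cmod (\<delta> t k)"]
      show "cmod (\<delta> t k * cnj (?v t k)) \<le> (wt 1 k * cmod (?v t k)) * (wt 1 k * cmod (\<delta> t k))"
        by (simp add: norm_mult algebra_simps)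
    qed
    also have "\<dots> \<le> hnorm 1 (?v t) * hnorm 1 (\<delta> t)"
      by (intro sum_mult_hnorm v1 \<delta> t) auto
    also have "\<dots> \<le> \<rho> * D" by (intro mult_mono v1 \<delta> t \<rho>0 hnorm_nonneg)
    also have "\<dots> \<le> (\<rho> + \<bar>\<mu>\<bar> * (9 * (sob_const 1)\<^sup>2 * \<rho> ^ 3)) * D"
      by (intro mult_right_mono) (auto simp: D_def \<rho>0)
    finally have "2 * \<bar>\<mu>\<bar> * \<bar>Im (\<Sum>k\<in>?I. \<delta> t k * cnj (?v t k))\<bar>
       \<le> 2 * \<bar>\<mu>\<bar> * ((\<rho> + \<bar>\<mu>\<bar> * (9 * (sob_const 1)\<^sup>2 * \<rho> ^ 3)) * D)"
      by (rule mult_left_mono) simp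
    then show ?thesis unfolding Beq by (simp only: abs_mult abs_minus_cancel abs_numeral)
  qed
  define E where "E t = trunc_kinetic n (?c t) + \<mu> / 2 * quartic n (?v t)" for t
  have dE: "(E has_real_derivative 2 * \<mu> * Re (\<Sum>k\<in>?I. p t k * cnj (\<delta> t k))) (at t within {0..T})"
    if t: "t \<in> {0..T}" for t
  proof -
    have dv: "((\<lambda>t. ?v t k) has_vector_derivative trunc n (p t) k) (at t within {0..T})" for k
      unfolding trunc_def using dc[OF t] by (cases "k \<in> ?I") auto
    have "(E has_real_derivative (\<Sum>k\<in>?I. (of_int k)\<^sup>2 * (2 * Re (cnj (?c t k) * p t k)))
       + \<mu> / 2 * (4 * Re (\<Sum>k\<in>?I. trunc n (p t) k * cnj (cubic_seq (?v t) k)))) (at t within {0..T})"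
      unfolding E_def trunc_kinetic_def
      by (intro DERIV_add DERIV_sum DERIV_cmult has_real_derivative_cmod_sq dc quartic_derivative t dv) auto
    moreover have "(\<Sum>k\<in>?I. (of_int k)\<^sup>2 * (2 * Re (cnj (?c t k) * p t k)))
       + \<mu> / 2 * (4 * Re (\<Sum>k\<in>?I. trunc n (p t) k * cnj (cubic_seq (?v t) k)))
      = 2 * (\<Sum>k\<in>?I. Re (p t k * cnj ((of_int k)\<^sup>2 * ?c t k + of_real \<mu> * cubic_seq (?v t) k)))"
      unfolding Re_sum sum_distrib_left sum.distrib[symmetric]
      by (rule sum.cong) (auto simp: trunc_def algebra_simps power2_eq_square)
    moreover have "Re (p t k * cnj ((of_int k)\<^sup>2 * ?c t k + of_real \<mu> * cubic_seq (?v t) k))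
       = \<mu> * Re (p t k * cnj (\<delta> t k))" for k
    proof -
      \<comment> \<open>The gradient of the truncated energy is \<open>\<i> * p\<close> up to the
        commutator, and \<open>Re (p * cnj (\<i> * p)) = 0\<close>.\<close>
      have "(of_int k)\<^sup>2 * ?c t k + of_real \<mu> * cubic_seq (?v t) k = \<i> * p t k + of_real \<mu> * \<delta> t k"
        by (simp add: p_def \<delta>_def algebra_simps)
      then have "Re (p t k * cnj ((of_int k)\<^sup>2 * ?c t k + of_real \<mu> * cubic_seq (?v t) k))
        = Re (p t k * cnj (\<i> * p t k + of_real \<mu> * \<delta> t k))" by simp
      then show ?thesis by (simp add: algebra_simps)
    qed
    ultimately show ?thesis by (simp only: Re_sum sum_distrib_left[symmetric] mult.assoc)
  qed
  \<comment> \<open>The factor \<open>k^2\<close> is shared evenly between the two sides of the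
    pairing, one bracket each, so only \<open>H^1\<close> norms are needed.\<close>
  have bE: "\<bar>2 * \<mu> * Re (\<Sum>k\<in>?I. p t k * cnj (\<delta> t k))\<bar> \<le> B" if t: "t \<in> {0..T}" for t
  proof -
    note cb = tri_hseq_1[OF c1(1)[OF t] c1(1)[OF t] c1(1)[OF t]]
    have "\<bar>Re (\<Sum>k\<in>?I. p t k * cnj (\<delta> t k))\<bar> \<le> (\<Sum>k\<in>?I. (wt 1 k * cmod (?c t k)) * (wt 1 k * cmod (\<delta> t k))
       + \<bar>\<mu>\<bar> * ((wt 1 k * cmod (cubic_seq (?c t) k)) * (wt 1 k * cmod (\<delta> t k))))"
    proof (rule order_trans[OF abs_Re_le_cmod sum_norm_le])
      fix k
      have w: "1 \<le> wt 1 k * wt 1 k" "(of_int k)\<^sup>2 \<le> wt 1 k * wt 1 k"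
        by (simp_all add: wt_2 flip: wt_add)
      have "cmod (p t k) \<le> (of_int k)\<^sup>2 * cmod (?c t k) + \<bar>\<mu>\<bar> * cmod (cubic_seq (?c t) k)"
        unfolding p_def norm_mult
        by (rule order_trans[OF mult_left_mono[OF norm_triangle_ineq]]) (auto simp: norm_mult norm_power)
      also have "\<dots> \<le> (wt 1 k * wt 1 k) * cmod (?c t k) + \<bar>\<mu>\<bar> * ((wt 1 k * wt 1 k) * cmod (cubic_seq (?c t) k))"
        using mult_right_mono[OF w(1), of "cmod (cubic_seq (?c t) k)"]
        by (intro add_mono mult_right_mono mult_left_mono w) auto
      finally have "cmod (p t k) * cmod (\<delta> t k) \<le> ((wt 1 k * wt 1 k) * cmod (?c t k)
         + \<bar>\<mu>\<bar> * ((wt 1 k * wt 1 k) * cmod (cubic_seq (?c t) k))) * cmod (\<delta> t k)"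
        by (intro mult_right_mono) auto
      then show "cmod (p t k * cnj (\<delta> t k)) \<le> (wt 1 k * cmod (?c t k)) * (wt 1 k * cmod (\<delta> t k))
         + \<bar>\<mu>\<bar> * ((wt 1 k * cmod (cubic_seq (?c t) k)) * (wt 1 k * cmod (\<delta> t k)))"
        by (simp add: norm_mult algebra_simps)
    qed
    also have "\<dots> \<le> hnorm 1 (?c t) * hnorm 1 (\<delta> t) + \<bar>\<mu>\<bar> * (hnorm 1 (cubic_seq (?c t)) * hnorm 1 (\<delta> t))"
      unfolding sum.distrib sum_distrib_left[symmetric]
      by (intro add_mono mult_left_mono sum_mult_hnorm c1 \<delta> cb t) auto
    also have "\<dots> \<le> \<rho> * D + \<bar>\<mu>\<bar> * ((9 * (sob_const 1)\<^sup>2 * \<rho> ^ 3) * D)"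
    proof (intro add_mono mult_left_mono mult_mono c1 \<delta> t \<rho>0 hnorm_nonneg)
      show "hnorm 1 (cubic_seq (?c t)) \<le> 9 * (sob_const 1)\<^sup>2 * \<rho> ^ 3"
        unfolding power3_eq_cube
        by (rule order_trans[OF cb(3)]) (intro mult_left_mono mult_mono c1 t \<rho>0 hnorm_nonneg mult_nonneg_nonneg; simp)
    qed (use \<rho>0 in auto)
    also have "\<dots> = (\<rho> + \<bar>\<mu>\<bar> * (9 * (sob_const 1)\<^sup>2 * \<rho> ^ 3)) * D" by (simp add: algebra_simps)
    finally have "2 * \<bar>\<mu>\<bar> * \<bar>Re (\<Sum>k\<in>?I. p t k * cnj (\<delta> t k))\<bar>
       \<le> 2 * \<bar>\<mu>\<bar> * ((\<rho> + \<bar>\<mu>\<bar> * (9 * (sob_const 1)\<^sup>2 * \<rho> ^ 3)) * D)"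
      by (rule mult_left_mono) simp
    then show ?thesis unfolding Beq by (simp only: abs_mult abs_minus_cancel abs_numeral)
  qed
  have "norm (trunc_mass n (?c t) - trunc_mass n (?c 0)) \<le> B * norm (t - 0)"
    by (rule field_differentiable_bound[of "{0..T}", OF _ dM]) (use bM t T in auto)
  then show "\<bar>trunc_mass n (modes r x t) - trunc_mass n (modes r x 0)\<bar> \<le> B * t" using t by simp
  have "norm (E t - E 0) \<le> B * norm (t - 0)"
    by (rule field_differentiable_bound[of "{0..T}", OF _ dE]) (use bE t T in auto)
  then show "\<bar>(trunc_kinetic n (modes r x t) + \<mu> / 2 * quartic n (trunc n (modes r x t)))
      - (trunc_kinetic n (modes r x 0) + \<mu> / 2 * quartic n (trunc n (modes r x 0)))\<bar> \<le> B * t"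
    using t by (simp add: E_def)
qed

end

section \<open>Global trajectories\<close>

definition radial_cut :: "real \<Rightarrow> 'a::real_normed_vector \<Rightarrow> 'a"
  where "radial_cut \<rho> x = (\<rho> / max \<rho> (norm x)) *\<^sub>R x"

lemma radial_cut_eq: "0 < \<rho> \<Longrightarrow> norm x \<le> \<rho> \<Longrightarrow> radial_cut \<rho> x = x"
  by (simp add: radial_cut_def max_def)

lemma norm_radial_cut: "0 < \<rho> \<Longrightarrow> norm (radial_cut \<rho> x) \<le> \<rho>"
  by (auto simp: radial_cut_def max_def field_simps)

text \<open>The difference splits into a rescaling of \<open>x - y\<close> and a change of the scale
  at \<open>y\<close>. Each is at most \<open>norm (x - y)\<close>: in the second the denominators
  \<open>a\<close> and \<open>b\<close> differ by no more than that, and \<open>norm y\<close> is at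
  most \<open>b\<close>.\<close>

lemma radial_cut_lipschitz:
  assumes \<rho>: "0 < \<rho>"
  shows "norm (radial_cut \<rho> x - radial_cut \<rho> y) \<le> 2 * norm (x - y)"
proof -
  define a b where "a = max \<rho> (norm x)" and "b = max \<rho> (norm y)"
  have ab: "0 < a" "0 < b" "\<rho> \<le> a" "norm y \<le> b" using \<rho> by (auto simp: a_def b_def)
  have ba: "\<bar>b - a\<bar> \<le> norm (x - y)"
    unfolding a_def b_def using norm_triangle_ineq3[of x y] by (auto simp: max_def)
  have "radial_cut \<rho> x - radial_cut \<rho> y = (\<rho> / a) *\<^sub>R (x - y) + (\<rho> / a - \<rho> / b) *\<^sub>R y"
    by (simp add: radial_cut_def a_def b_def scaleR_diff_right scaleR_diff_left)
  also have "norm \<dots> \<le> \<rho> / a * norm (x - y) + \<bar>\<rho> / a - \<rho> / b\<bar> * norm y"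
    using ab \<rho> by (intro order_trans[OF norm_triangle_ineq]) auto
  also have "\<rho> / a * norm (x - y) \<le> 1 * norm (x - y)"
    using ab by (intro mult_right_mono) auto
  also have "\<bar>\<rho> / a - \<rho> / b\<bar> * norm y \<le> norm (x - y)"
  proof -
    have "\<rho> / a - \<rho> / b = (\<rho> / a) * ((b - a) / b)"
      using ab by (simp add: field_simps)
    then have "\<bar>\<rho> / a - \<rho> / b\<bar> * norm y = (\<rho> / a) * (\<bar>b - a\<bar> * (norm y / b))"
      using ab \<rho> by (simp add: abs_mult)
    also have "\<dots> \<le> 1 * (norm (x - y) * 1)"
      using ab \<rho> by (intro mult_mono ba) auto
    finally show ?thesis by simp
  qed
  finally show ?thesis by simp
qed

text \<open>Bounds on all sufficiently wide symmetric bands suffice; the truncated energy controls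
  no others.\<close>

lemma hnorm_le_finite:
  assumes "a \<in> hseq s" "\<And>n. n \<ge> n0 \<Longrightarrow> (\<Sum>k\<in>{- int n..int n}. (1 + (of_int k)\<^sup>2) powr s * (cmod (a k))\<^sup>2) \<le> B"
  shows "hnorm s a \<le> sqrt B"
  unfolding hnorm_def
proof (intro real_sqrt_le_mono infsum_le_finite_sums)
  show "(\<lambda>k. (1 + (of_int k)\<^sup>2) powr s * (cmod (a k))\<^sup>2) summable_on UNIV"
    using assms(1) by (simp add: hseq_def)
  fix F :: "int set" assume F: "finite F"
  define n where "n = max n0 (nat (Max (insert 0 (abs ` F))))"
  have "k \<in> {- int n..int n}" if "k \<in> F" for k
  proof -
    have "\<bar>k\<bar> \<le> Max (insert 0 (abs ` F))" using F that by (intro Max_ge) auto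
    also have "\<dots> \<le> int n" by (simp add: n_def)
    finally show ?thesis by auto
  qed
  then have "(\<Sum>k\<in>F. (1 + (of_int k)\<^sup>2) powr s * (cmod (a k))\<^sup>2)
      \<le> (\<Sum>k\<in>{- int n..int n}. (1 + (of_int k)\<^sup>2) powr s * (cmod (a k))\<^sup>2)"
    by (intro sum_mono2) auto
  also have "\<dots> \<le> B" by (rule assms(2)) (simp add: n_def)
  finally show "(\<Sum>k\<in>F. (1 + (of_int k)\<^sup>2) powr s * (cmod (a k))\<^sup>2) \<le> B" .
qed

definition duhamel :: "real \<Rightarrow> real \<Rightarrow> real \<Rightarrow> int ell2 \<Rightarrow> int ell2"
  where "duhamel r \<mu> T x0 = integral {0..T} (\<lambda>s. cubic_op r (phase_mult \<mu> s) x0)"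

context
  fixes r \<mu> :: real
  assumes r: "r > 3 / 2"
begin

lemma apriori_l1:
  obtains A where "0 \<le> A"
    "\<And>T x0 x t. trajectory r \<mu> T x0 x \<Longrightarrow> T \<le> 1 \<Longrightarrow> norm x0 \<le> R \<Longrightarrow> t \<in> {0..T} \<Longrightarrow> l1norm (modes r x t) \<le> A"
proof -
  \<comment> \<open>\<open>M0\<close> bounds the mass, with 1 to spare for the defect of the
    cut-off. \<open>e\<close> is so small that the quartic part of the energy takes at most a
    quarter of mass plus kinetic energy, the added ones keeping the denominator positive;
    \<open>d\<close> collects what is left of the quartic bound.\<close>
  define M0 where "M0 = R\<^sup>2 + 1"
  define \<sigma> where "\<sigma> = (sob_const (3/4))\<^sup>2"
  define e where "e = 1 / (6 * M0 * (\<sigma> + 1) * (\<bar>\<mu>\<bar> + 1))"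
  define d where "d = \<bar>\<mu>\<bar> / 2 * (3 * M0 * (\<sigma> * ((1 / e) ^ 3 * M0)))"
  define K1 where "K1 = 2 * (2 * R\<^sup>2 + M0 + 2 * d + 1)"
  have M0: "1 \<le> M0" "R\<^sup>2 \<le> M0" by (auto simp: M0_def)
  have \<sigma>: "0 \<le> \<sigma>" by (simp add: \<sigma>_def)
  have pos: "0 < 6 * M0 * (\<sigma> + 1) * (\<bar>\<mu>\<bar> + 1)" using M0 \<sigma> by (intro mult_pos_pos) auto
  have e: "0 < e" unfolding e_def using pos by simp
  have d: "0 \<le> d" using e \<sigma> M0 by (simp add: d_def)
  have b: "\<bar>\<mu>\<bar> / 2 * (3 * M0 * (\<sigma> * e)) \<le> 1 / 4"
  proof -
    have "6 * M0 * \<sigma> * \<bar>\<mu>\<bar> \<le> 6 * M0 * (\<sigma> + 1) * (\<bar>\<mu>\<bar> + 1)"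
      using M0 \<sigma> by (intro mult_mono) auto
    then have "6 * M0 * \<sigma> * \<bar>\<mu>\<bar> * e \<le> 1"
      using pos unfolding e_def times_divide_eq_right mult_1_right by (subst divide_le_eq_1_pos)
    then show ?thesis by (simp add: mult_ac)
  qed
  have main: "l1norm (modes r x t) \<le> sob_const 1 * sqrt (M0 + K1)"
    if x: "trajectory r \<mu> T x0 x" and T: "T \<le> 1" and R: "norm x0 \<le> R" and t: "t \<in> {0..T}" for T x0 x t
  proof -
    let ?c = "modes r x"
    have T0: "0 \<le> T" using t by auto
    have x_0: "x 0 = x0" using x T0 by (auto simp: trajectory_def)
    have "bounded (x ` {0..T})"
      using x by (intro compact_imp_bounded compact_continuous_image) (auto simp: trajectory_def)
    then obtain \<rho> where "\<forall>y\<in>x ` {0..T}. norm y \<le> \<rho>"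
      unfolding bounded_iff by blast
    then have \<rho>: "norm (x t) \<le> \<rho>" if "t \<in> {0..T}" for t using that by blast
    \<comment> \<open>The radius \<open>\<rho>\<close> depends on the trajectory, but it enters the
      defect only, where the tail factor makes it harmless for large \<open>n\<close>. The resulting
      bounds \<open>M0\<close> and \<open>K1\<close> do not contain it.\<close>
    define Z where "Z = 2 * \<bar>\<mu>\<bar> * (\<rho> + \<bar>\<mu>\<bar> * (9 * (sob_const 1)\<^sup>2 * \<rho> ^ 3)) * (27 * (sob_const 1)\<^sup>2 * \<rho> ^ 3)"
    have "(\<lambda>n. Z * wt (- (r - 1)) (int n)) \<longlonglongrightarrow> Z * 0"
      using r by (intro tendsto_mult_left wt_neg_tendsto_0) auto
    then have "\<forall>\<^sub>F n in sequentially. Z * wt (- (r - 1)) (int n) < 1"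
      by (intro order_tendstoD(2)) auto
    then obtain n0 where n0: "\<And>n. n \<ge> n0 \<Longrightarrow> Z * wt (- (r - 1)) (int n) < 1"
      by (auto simp: eventually_sequentially)
    have K: "trunc_mass (int n) (?c t) \<le> M0 \<and> trunc_kinetic (int n) (?c t) \<le> K1" if n: "n \<ge> n0" for n
    proof -
      let ?n = "int n"
      have Zn: "2 * \<bar>\<mu>\<bar> * (\<rho> + \<bar>\<mu>\<bar> * (9 * (sob_const 1)\<^sup>2 * \<rho> ^ 3)) * (27 * (sob_const 1)\<^sup>2 * \<rho> ^ 3 * wt (- (r - 1)) ?n) * s \<le> 1"
        if "0 \<le> s" "s \<le> 1" for s
      proof -
        have "Z * wt (- (r - 1)) ?n * s \<le> 1 * 1"
          using n0[OF n] that by (intro mult_mono) auto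
        then show ?thesis by (simp add: Z_def mult_ac)
      qed
      have R0: "trunc_mass ?n (?c 0) \<le> R\<^sup>2" "trunc_kinetic ?n (?c 0) \<le> R\<^sup>2"
        using trunc_mass_trunc_kinetic_le[OF modes_hseq(1), of r ?n x 0] r power_mono[OF R, of 2]
        by (auto simp: x_0)
      have nonneg: "0 \<le> trunc_mass ?n v" "0 \<le> trunc_kinetic ?n v" for v
        by (auto simp: trunc_mass_def trunc_kinetic_def intro!: sum_nonneg)
      have Mt: "trunc_mass ?n (?c s) \<le> M0" if s: "s \<in> {0..T}" for s
      proof -
        have "\<bar>trunc_mass ?n (?c s) - trunc_mass ?n (?c 0)\<bar> \<le> 1"
          by (rule order_trans[OF energy_almost_conserved(1)[OF r x \<rho> T0 _ s] Zn]) (use s T in auto)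
        then show ?thesis using R0 by (simp add: M0_def)
      qed
      have Q: "\<bar>\<mu>\<bar> / 2 * quartic ?n (trunc ?n (?c s)) \<le> 1 / 4 * (M0 + trunc_kinetic ?n (?c s)) + d"
        if s: "s \<in> {0..T}" for s
      proof -
        let ?m = "trunc_mass ?n (?c s)" and ?k = "trunc_kinetic ?n (?c s)"
        have "quartic ?n (trunc ?n (?c s)) \<le> 3 * ?m * (\<sigma> * (e * (?m + ?k) + (1 / e) ^ 3 * ?m))"
        proof -
          have 1: "(\<Sum>k\<in>{-?n..?n}. (cmod (trunc ?n (?c s) k))\<^sup>2) = ?m"
            unfolding trunc_mass_def by (rule sum.cong) (auto simp: trunc_def)
          have 2: "(\<Sum>k\<in>{-?n..?n}. (1 + (of_int k)\<^sup>2) * (cmod (trunc ?n (?c s) k))\<^sup>2) = ?m + ?k"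
            unfolding trunc_mass_def trunc_kinetic_def sum.distrib[symmetric]
            by (rule sum.cong) (auto simp: trunc_def algebra_simps)
          show ?thesis
            using quartic_bound[OF supported_trunc e, of ?n "?c s"] unfolding 1 2 \<sigma>_def .
        qed
        also have "\<dots> \<le> 3 * M0 * (\<sigma> * (e * (M0 + ?k) + (1 / e) ^ 3 * M0))"
          using Mt[OF s] nonneg \<sigma> e M0
          by (intro mult_mono add_mono order_refl mult_nonneg_nonneg add_nonneg_nonneg) auto
        finally have "\<bar>\<mu>\<bar> / 2 * quartic ?n (trunc ?n (?c s)) \<le> \<bar>\<mu>\<bar> / 2 * (3 * M0 * (\<sigma> * (e * (M0 + ?k) + (1 / e) ^ 3 * M0)))"
          by (rule mult_left_mono) simp
        also have "\<dots> = (\<bar>\<mu>\<bar> / 2 * (3 * M0 * (\<sigma> * e))) * (M0 + ?k) + d"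
          by (simp add: d_def algebra_simps)
        also have "\<dots> \<le> 1 / 4 * (M0 + ?k) + d"
          using b nonneg M0 by (intro add_mono mult_right_mono) auto
        finally show ?thesis .
      qed
      have qn: "0 \<le> quartic ?n v" for v by (auto simp: quartic_def intro!: sum_nonneg)
      \<comment> \<open>The quarter of \<open>k\<close> in the bound for \<open>w\<close> is
        absorbed on the left, leaving three quarters; \<open>K1\<close> generously bounds the other
        terms, those at time 0 through \<open>k0 \<le> R\<^sup>2\<close>.\<close>
      have abstract_bound: "k \<le> K1"
        if "\<bar>(k + w) - (k0 + w0)\<bar> \<le> 1" "\<bar>w\<bar> \<le> 1 / 4 * (M0 + k) + d" "\<bar>w0\<bar> \<le> 1 / 4 * (M0 + k0) + d"
          "k0 \<le> R\<^sup>2" "0 \<le> k" for k w k0 w0 :: real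
        using that d M0 zero_le_power2[of R] unfolding K1_def abs_le_iff by argo
      have muq: "\<bar>\<mu> / 2 * quartic ?n (trunc ?n (?c s))\<bar> \<le> 1 / 4 * (M0 + trunc_kinetic ?n (?c s)) + d"
        if "s \<in> {0..T}" for s
        using qn[of "trunc ?n (?c s)"] Q[OF that] by (simp add: abs_mult)
      have "\<bar>(trunc_kinetic ?n (?c t) + \<mu> / 2 * quartic ?n (trunc ?n (?c t)))
          - (trunc_kinetic ?n (?c 0) + \<mu> / 2 * quartic ?n (trunc ?n (?c 0)))\<bar> \<le> 1"
        by (rule order_trans[OF energy_almost_conserved(2)[OF r x \<rho> T0 _ t] Zn]) (use t T in auto)
      then have "trunc_kinetic ?n (?c t) \<le> K1"
        by (rule abstract_bound) (use T0 t muq R0 nonneg in auto)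
      with Mt[OF t] show ?thesis by simp
    qed
    have c1: "?c t \<in> hseq 1" using hseq_weaken(1)[OF modes_hseq(1), of 1 r x t] r by simp
    have "hnorm 1 (?c t) \<le> sqrt (M0 + K1)"
    proof (rule hnorm_le_finite[OF c1])
      fix n assume "n \<ge> n0"
      have "(\<Sum>k\<in>{- int n..int n}. (1 + (of_int k)\<^sup>2) powr 1 * (cmod (?c t k))\<^sup>2)
        = trunc_mass (int n) (?c t) + trunc_kinetic (int n) (?c t)"
        unfolding trunc_mass_def trunc_kinetic_def sum.distrib[symmetric]
        by (rule sum.cong) (auto simp: algebra_simps abs_of_nonneg)
      then show "(\<Sum>k\<in>{- int n..int n}. (1 + (of_int k)\<^sup>2) powr 1 * (cmod (?c t k))\<^sup>2) \<le> M0 + K1"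
        using K[OF \<open>n \<ge> n0\<close>] by simp
    qed
    then have "sob_const 1 * hnorm 1 (?c t) \<le> sob_const 1 * sqrt (M0 + K1)"
      by (rule mult_left_mono) simp
    moreover have "l1norm (?c t) \<le> sob_const 1 * hnorm 1 (?c t)" by (rule hseq_l1(2)[OF _ c1]) simp
    ultimately show ?thesis by linarith
  qed
  show thesis
  proof (rule that)
    show "0 \<le> sob_const 1 * sqrt (M0 + K1)" using M0 d by (simp add: K1_def)
  qed (use main in auto)
qed

text \<open>With the \<open>l1norm\<close> under control, two of the three factors become constants;
  what remains is linear in the \<open>H^r\<close> norm, as Gronwall's inequality requires.\<close>

lemma norm_cubic_op_tame:
  assumes l: "l1norm (unemb r (free_group t x)) \<le> A"
  shows "norm (cubic_op r (phase_mult \<mu> t) x) \<le> 3 * \<bar>\<mu>\<bar> * 3 powr r * A\<^sup>2 * norm x"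
proof -
  let ?c = "unemb r (free_group t x)"
  have A: "0 \<le> A" using l l1norm_nonneg order_trans by blast
  have c: "l1seq ?c" using r by (intro hseq_l1(1)[of r]) auto
  have "norm (cubic_op r (phase_mult \<mu> t) x) = hnorm r (tri (\<lambda>_ _ _. - \<i> * of_real \<mu>) ?c ?c ?c)"
    unfolding cubic_op_phase_mult[OF r] norm_free_group unfolding tri_op_def by (rule norm_emb[OF tri_unemb(2)[OF r admissible_const]])
  also have "\<dots> \<le> \<bar>\<mu>\<bar> * (3 powr r * (hnorm r ?c * l1norm ?c * l1norm ?c
      + l1norm ?c * hnorm r ?c * l1norm ?c + l1norm ?c * l1norm ?c * hnorm r ?c))"
    using r by (intro tri_tame(3) unemb_hseq c) (auto simp: norm_mult)
  also have "\<dots> = \<bar>\<mu>\<bar> * (3 powr r * (3 * ((l1norm ?c)\<^sup>2 * norm x)))"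
    by (simp add: power2_eq_square algebra_simps)
  also have "\<dots> \<le> \<bar>\<mu>\<bar> * (3 powr r * (3 * (A\<^sup>2 * norm x)))"
    using l by (intro mult_left_mono mult_right_mono power_mono) auto
  finally show ?thesis by (simp add: mult_ac)
qed

lemma trajectory_integrable:
  assumes "trajectory r \<mu> T x0 x" "t \<in> {0..T}"
  shows "(\<lambda>s. cubic_op r (phase_mult \<mu> s) (x s)) integrable_on {0..t}"
  using assms
  by (intro integrable_continuous_real continuous_on_cubic_op_phase_mult[OF r])
    (auto simp: trajectory_def intro: continuous_on_subset)

text \<open>The radius is common to all trajectories starting in the ball. The strict inequality
  matters: in \<open>trajectory_exists\<close> it forbids touching the sphere of radius
  \<open>\<rho>\<close>.\<close>

lemma apriori_hr:
  obtains \<rho> where "R < \<rho>" "0 < \<rho>"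
    "\<And>T x0 x t. trajectory r \<mu> T x0 x \<Longrightarrow> T \<le> 1 \<Longrightarrow> norm x0 \<le> R \<Longrightarrow> t \<in> {0..T} \<Longrightarrow> norm (x t) < \<rho>"
proof -
  obtain A where A: "0 \<le> A"
    "\<And>T x0 x t. trajectory r \<mu> T x0 x \<Longrightarrow> T \<le> 1 \<Longrightarrow> norm x0 \<le> R \<Longrightarrow> t \<in> {0..T} \<Longrightarrow> l1norm (modes r x t) \<le> A"
    using apriori_l1 by blast
  define L where "L = 3 * \<bar>\<mu>\<bar> * 3 powr r * A\<^sup>2"
  have L: "0 \<le> L" by (simp add: L_def)
  have main: "norm (x t) \<le> \<bar>R\<bar> * exp L"
    if x: "trajectory r \<mu> T x0 x" and T: "T \<le> 1" and R: "norm x0 \<le> R" and t: "t \<in> {0..T}" for T x0 x t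
  proof -
    have xc: "continuous_on {0..T} x" using x by (simp add: trajectory_def)
    have "norm (x t) \<le> R * exp (L * t)"
    proof (rule gronwall[OF _ _ L t])
      show "continuous_on {0..T} (\<lambda>t. norm (x t))" using xc by (intro continuous_intros)
      fix u assume u: "u \<in> {0..T}"
      have "norm (integral {0..u} (\<lambda>s. cubic_op r (phase_mult \<mu> s) (x s))) \<le> integral {0..u} (\<lambda>s. L * norm (x s))"
      proof (rule integral_norm_bound_integral[OF trajectory_integrable[OF x u]])
        show "(\<lambda>s. L * norm (x s)) integrable_on {0..u}"
          using u by (intro integrable_continuous_real continuous_intros continuous_on_subset[OF xc]) auto
        fix s assume "s \<in> {0..u}"
        then show "norm (cubic_op r (phase_mult \<mu> s) (x s)) \<le> L * norm (x s)"
          unfolding L_def using A(2)[OF x T R, of s] u by (intro norm_cubic_op_tame) (auto simp: modes_def)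
      qed
      moreover have "x u = x0 + integral {0..u} (\<lambda>s. cubic_op r (phase_mult \<mu> s) (x s))"
        using x u by (simp add: trajectory_def)
      ultimately show "norm (x u) \<le> R + L * integral {0..u} (\<lambda>s. norm (x s))"
        using norm_triangle_ineq[of x0 "integral {0..u} (\<lambda>s. cubic_op r (phase_mult \<mu> s) (x s))"] R by simp
    qed
    also have "\<dots> \<le> \<bar>R\<bar> * exp L"
      using t T L by (intro mult_mono) (auto simp: mult_left_le)
    finally show ?thesis .
  qed
  have "\<bar>R\<bar> * 1 \<le> \<bar>R\<bar> * exp L" using L by (intro mult_left_mono) auto
  then have "R < \<bar>R\<bar> * exp L + 1" "0 < \<bar>R\<bar> * exp L + 1" by linarith+
  then show thesis
  proof (rule that)
    fix T x0 x t
    assume "trajectory r \<mu> T x0 x" "T \<le> 1" "norm x0 \<le> R" "t \<in> {0..T}"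
    from main[OF this] show "norm (x t) < \<bar>R\<bar> * exp L + 1" by linarith
  qed
qed

text \<open>The vector field is cut off outside a ball that the a priori bound shows never to be left.\<close>

lemma trajectory_exists:
  assumes T: "0 \<le> T" "T \<le> 1"
  obtains x where "trajectory r \<mu> T x0 x"
proof -
  obtain \<rho> where \<rho>: "norm x0 < \<rho>" "0 < \<rho>"
    "\<And>T x t. trajectory r \<mu> T x0 x \<Longrightarrow> T \<le> 1 \<Longrightarrow> t \<in> {0..T} \<Longrightarrow> norm (x t) < \<rho>"
    using apriori_hr[of "norm x0"] by (metis order_refl)
  let ?f = "\<lambda>t x. cubic_op r (phase_mult \<mu> t) (radial_cut \<rho> x)"
  \<comment> \<open>The Lipschitz constant of the cubic operator on the ball, times 2 for the radial
    cut; the final 1 makes it positive.\<close>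
  define L where "L = 3 * (3 * \<bar>\<mu>\<bar> * tri_const r * \<rho>\<^sup>2) * 2 + 1"
  have L: "0 < L" unfolding L_def by (intro add_nonneg_pos mult_nonneg_nonneg) auto
  have cut_cont: "continuous_on {0..T} (\<lambda>t. radial_cut \<rho> (x t))" if "continuous_on {0..T} x" for x :: "real \<Rightarrow> int ell2"
    unfolding radial_cut_def using that \<rho>(2)
    by (intro continuous_intros) (auto simp: max_def)
  have lip: "norm (?f t x - ?f t y) \<le> L * norm (x - y)" for t x y
  proof -
    have "norm (?f t x - ?f t y) \<le> 3 * (3 * \<bar>\<mu>\<bar> * tri_const r * \<rho>\<^sup>2) * norm (radial_cut \<rho> x - radial_cut \<rho> y)"
      by (intro cubic_op_lipschitz[OF r admissible_phase_mult] norm_radial_cut \<rho>)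
    also have "\<dots> \<le> 3 * (3 * \<bar>\<mu>\<bar> * tri_const r * \<rho>\<^sup>2) * (2 * norm (x - y))"
      by (intro mult_left_mono radial_cut_lipschitz \<rho>) auto
    also have "\<dots> \<le> L * norm (x - y)" by (simp add: L_def algebra_simps)
    finally show ?thesis .
  qed
  obtain x where xc: "continuous_on {0..T} x"
    and x: "\<And>t. t \<in> {0..T} \<Longrightarrow> x t = x0 + integral {0..t} (\<lambda>s. ?f s (x s))"
    using lipschitz_ode_exists[of T L ?f x0] T L lip continuous_on_cubic_op_phase_mult[OF r cut_cont] by blast
  have nc: "continuous_on {0..T} (\<lambda>t. norm (x t))" using xc by (intro continuous_intros)
  have tr: "trajectory r \<mu> T' x0 x" if T': "T' \<in> {0..T}" and le: "\<And>s. s \<in> {0..T'} \<Longrightarrow> norm (x s) \<le> \<rho>" for T'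
    unfolding trajectory_def
  proof (intro conjI ballI)
    show "continuous_on {0..T'} x" using T' by (intro continuous_on_subset[OF xc]) auto
    fix t assume t: "t \<in> {0..T'}"
    have "integral {0..t} (\<lambda>s. ?f s (x s)) = integral {0..t} (\<lambda>s. cubic_op r (phase_mult \<mu> s) (x s))"
      using t by (intro integral_cong) (simp add: radial_cut_eq[OF \<rho>(2) le])
    then show "x t = x0 + integral {0..t} (\<lambda>s. cubic_op r (phase_mult \<mu> s) (x s))" using x[of t] t T' by simp
  qed
  have x_0: "norm (x 0) < \<rho>" using x[of 0] T \<rho>(1) by simp
  have "norm (x t) \<le> \<rho>" if t: "t \<in> {0..T}" for t
  proof (rule ccontr)
    assume "\<not> norm (x t) \<le> \<rho>"
    have iv: "\<exists>u\<in>{0..s}. norm (x u) = \<rho>" if "s \<in> {0..T}" "\<rho> \<le> norm (x s)" for s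
      using IVT'[of "\<lambda>t. norm (x t)" 0 \<rho> s] x_0 that continuous_on_subset[OF nc, of "{0..s}"]
      by fastforce
    \<comment> \<open>The first time \<open>u\<close> at which the norm reaches
      \<open>\<rho>\<close> is wanted. Up to it the cut is inactive, so the a priori bound applies
      on \<open>{0..u}\<close> and contradicts \<open>norm (x u) = \<rho>\<close>.\<close>
    let ?S = "{u \<in> {0..T}. norm (x u) = \<rho>}"
    have "?S \<noteq> {}" using iv[OF t] \<open>\<not> norm (x t) \<le> \<rho>\<close> t by fastforce
    have "closed ?S"
      using continuous_closed_preimage_constant[OF nc closed_atLeastAtMost] by simp
    moreover have "bounded ?S" by (rule bounded_subset[OF bounded_closed_interval[of 0 T]]) auto
    ultimately have "compact ?S" unfolding compact_eq_bounded_closed by blast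
    from compact_attains_inf[OF this \<open>?S \<noteq> {}\<close>]
    obtain u where u: "u \<in> ?S" "\<And>v. v \<in> ?S \<Longrightarrow> u \<le> v" by blast
    have "norm (x s) \<le> \<rho>" if s: "s \<in> {0..u}" for s
    proof (rule ccontr)
      assume "\<not> norm (x s) \<le> \<rho>"
      then obtain v where v: "v \<in> {0..s}" "norm (x v) = \<rho>" using iv[of s] s u(1) by auto
      with u(2)[of v] s u(1) have "v = s" by auto
      with v \<open>\<not> norm (x s) \<le> \<rho>\<close> show False by simp
    qed
    then have "trajectory r \<mu> u x0 x" using u(1) by (intro tr) auto
    from \<rho>(3)[OF this, of u] u(1) T show False by auto
  qed
  then have "trajectory r \<mu> T x0 x" using T by (intro tr) auto
  then show thesis by (rule that)
qed

section \<open>Dependence on the initial value and the Picard remainder\<close>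

lemma trajectory_lipschitz:
  assumes x: "trajectory r \<mu> T x0 x" "\<And>t. t \<in> {0..T} \<Longrightarrow> norm (x t) \<le> \<rho>"
    and y: "trajectory r \<mu> T y0 y" "\<And>t. t \<in> {0..T} \<Longrightarrow> norm (y t) \<le> \<rho>" and t: "t \<in> {0..T}"
  shows "norm (x t - y t) \<le> norm (x0 - y0) * exp (9 * (\<bar>\<mu>\<bar> * tri_const r * \<rho>\<^sup>2) * t)"
proof -
  define L where "L = 9 * (\<bar>\<mu>\<bar> * tri_const r * \<rho>\<^sup>2)"
  have c: "continuous_on {0..T} x" "continuous_on {0..T} y" using x y by (auto simp: trajectory_def)
  show ?thesis
    unfolding L_def[symmetric]
  proof (rule gronwall[OF _ _ _ t])
    show "0 \<le> L" by (simp add: L_def)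
    show "continuous_on {0..T} (\<lambda>t. norm (x t - y t))" using c by (intro continuous_intros)
    fix u assume u: "u \<in> {0..T}"
    let ?I = "integral {0..u} (\<lambda>s. cubic_op r (phase_mult \<mu> s) (x s) - cubic_op r (phase_mult \<mu> s) (y s))"
    have "norm ?I \<le> integral {0..u} (\<lambda>s. L * norm (x s - y s))"
    proof (rule integral_norm_bound_integral)
      show "(\<lambda>s. cubic_op r (phase_mult \<mu> s) (x s) - cubic_op r (phase_mult \<mu> s) (y s)) integrable_on {0..u}"
        by (intro integrable_diff trajectory_integrable[OF x(1) u] trajectory_integrable[OF y(1) u])
      show "(\<lambda>s. L * norm (x s - y s)) integrable_on {0..u}"
        using u by (intro integrable_continuous_real continuous_intros continuous_on_subset[OF c(1)] continuous_on_subset[OF c(2)]) auto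
      fix s assume "s \<in> {0..u}"
      then show "norm (cubic_op r (phase_mult \<mu> s) (x s) - cubic_op r (phase_mult \<mu> s) (y s)) \<le> L * norm (x s - y s)"
        using cubic_op_lipschitz[OF r admissible_phase_mult x(2)[of s] y(2)[of s], of \<mu> s] u by (simp add: L_def)
    qed
    moreover have "x u - y u = (x0 - y0) + ?I"
      using x(1) y(1) u
      by (subst integral_diff[OF trajectory_integrable[OF x(1) u] trajectory_integrable[OF y(1) u]])
        (auto simp: trajectory_def)
    ultimately show "norm (x u - y u) \<le> norm (x0 - y0) + L * integral {0..u} (\<lambda>s. norm (x s - y s))"
      using norm_triangle_ineq[of "x0 - y0" ?I] by simp
  qed
qed

lemma trajectory_unique:
  assumes x: "trajectory r \<mu> T x0 x" and y: "trajectory r \<mu> T x0 y" and T: "T \<le> 1" and t: "t \<in> {0..T}"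
  shows "x t = y t"
proof -
  obtain \<rho> where \<rho>: "\<And>T x t. trajectory r \<mu> T x0 x \<Longrightarrow> T \<le> 1 \<Longrightarrow> t \<in> {0..T} \<Longrightarrow> norm (x t) < \<rho>"
    using apriori_hr[of "norm x0"] by (metis order_refl)
  have "norm (x t - y t) \<le> norm (x0 - x0) * exp (9 * (\<bar>\<mu>\<bar> * tri_const r * \<rho>\<^sup>2) * t)"
    by (rule trajectory_lipschitz[OF x _ y _ t]) (use \<rho>[OF x T] \<rho>[OF y T] in \<open>auto intro: less_imp_le\<close>)
  then show ?thesis by simp
qed

lemma cubic_op_phase_mult_integrable: "(\<lambda>s. cubic_op r (phase_mult \<mu> s) x0) integrable_on {a..b}"
  by (intro integrable_continuous_real continuous_on_cubic_op_phase_mult[OF r] continuous_intros)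

lemma duhamel_lipschitz:
  assumes "0 \<le> T" "norm x0 \<le> R" "norm y0 \<le> R"
  shows "norm (duhamel r \<mu> T x0 - duhamel r \<mu> T y0) \<le> 9 * (\<bar>\<mu>\<bar> * tri_const r * R\<^sup>2) * T * norm (x0 - y0)"
proof -
  have "norm (integral {0..T} (\<lambda>s. cubic_op r (phase_mult \<mu> s) x0 - cubic_op r (phase_mult \<mu> s) y0))
     \<le> integral {0..T} (\<lambda>s. 9 * (\<bar>\<mu>\<bar> * tri_const r * R\<^sup>2) * norm (x0 - y0))"
    using cubic_op_lipschitz[OF r admissible_phase_mult assms(2,3), of \<mu>]
    by (intro integral_norm_bound_integral integrable_diff cubic_op_phase_mult_integrable) (auto simp: mult.assoc)
  then show ?thesis
    using assms(1) unfolding duhamel_def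
    by (subst (asm) integral_diff) (auto simp: cubic_op_phase_mult_integrable mult_ac)
qed

text \<open>The remainder is the time integral of the vector field at \<open>x s\<close> minus the
  vector field at \<open>x0\<close>. In the difference of two remainders the integrand is a mixed
  second difference, every term of which contains an increment in time and hence a factor
  \<open>T\<close>; integration supplies the second one.\<close>

lemma picard_remainder:
  obtains C where "0 \<le> C"
    "\<And>T x0 x y0 y. \<lbrakk>trajectory r \<mu> T x0 x; trajectory r \<mu> T y0 y; 0 \<le> T; T \<le> 1; norm x0 \<le> R; norm y0 \<le> R\<rbrakk> \<Longrightarrow>
      norm ((x T - x0 - duhamel r \<mu> T x0) - (y T - y0 - duhamel r \<mu> T y0)) \<le> C * T\<^sup>2 * norm (x0 - y0)"
proof -
  obtain \<rho> where \<rho>: "R < \<rho>" "0 < \<rho>"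
    "\<And>T x0 x t. trajectory r \<mu> T x0 x \<Longrightarrow> T \<le> 1 \<Longrightarrow> norm x0 \<le> R \<Longrightarrow> t \<in> {0..T} \<Longrightarrow> norm (x t) < \<rho>"
    using apriori_hr by blast
  define K where "K = 3 * \<bar>\<mu>\<bar> * tri_const r"
  define L where "L = 9 * (\<bar>\<mu>\<bar> * tri_const r * \<rho>\<^sup>2)"
  have K: "0 \<le> K" and L: "0 \<le> L" by (simp_all add: K_def L_def)
  \<comment> \<open>The bound of \<open>cubic_op_diff_diff\<close> with
    \<open>d = K * \<rho> ^ 3 * T\<close>, \<open>e = exp L\<close> and
    \<open>f = L * exp L * T\<close>, the last two times \<open>norm (x0 - y0)\<close>.\<close>
  define C where "C = K * (3 * (L * exp L * \<rho>\<^sup>2) + 6 * (K * \<rho> ^ 3 * exp L * \<rho>))"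
  have C: "0 \<le> C" unfolding C_def using K L \<rho>(2) by (intro mult_nonneg_nonneg add_nonneg_nonneg) auto
  show thesis
  proof (rule that[OF C])
    fix T x0 x y0 y
    assume x: "trajectory r \<mu> T x0 x" and y: "trajectory r \<mu> T y0 y" and T: "0 \<le> T" "T \<le> 1"
      and R: "norm x0 \<le> R" "norm y0 \<le> R"
    have xb: "norm (x t) \<le> \<rho>" and yb: "norm (y t) \<le> \<rho>" if "t \<in> {0..T}" for t
      using \<rho>(3)[OF x T(2) R(1) that] \<rho>(3)[OF y T(2) R(2) that] by auto
    have x0b: "norm x0 \<le> \<rho>" "norm y0 \<le> \<rho>" using R \<rho> by auto
    have op_bound: "norm (cubic_op r (phase_mult \<mu> s) z) \<le> K * \<rho> ^ 3" if "norm z \<le> \<rho>" for s z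
    proof -
      have "norm (cubic_op r (phase_mult \<mu> s) z) \<le> K * (norm z * norm z * norm z)"
        unfolding K_def by (rule norm_tri_op[OF r admissible_phase_mult])
      also have "\<dots> \<le> K * (\<rho> * \<rho> * \<rho>)"
        using that \<rho>(2) K by (intro mult_left_mono mult_mono) auto
      finally show ?thesis by (simp add: power3_eq_cube)
    qed
    have eL: "exp (L * s) \<le> exp L" if "s \<in> {0..T}" for s
      using that T L by (auto simp: mult_left_le)
    have lip: "norm (x s - y s) \<le> exp L * norm (x0 - y0)" if s: "s \<in> {0..T}" for s
    proof -
      have "norm (x s - y s) \<le> norm (x0 - y0) * exp (L * s)"
        unfolding L_def by (rule trajectory_lipschitz[OF x xb y yb s])
      also have "\<dots> \<le> norm (x0 - y0) * exp L" by (intro mult_left_mono eL s) auto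
      finally show ?thesis by (simp add: mult.commute)
    qed
    have dev: "norm (z s - z0) \<le> K * \<rho> ^ 3 * T"
      if z: "trajectory r \<mu> T z0 z" "\<And>t. t \<in> {0..T} \<Longrightarrow> norm (z t) \<le> \<rho>" and s: "s \<in> {0..T}" for z z0 s
    proof -
      have "norm (integral {0..s} (\<lambda>u. cubic_op r (phase_mult \<mu> u) (z u))) \<le> integral {0..s} (\<lambda>u. K * \<rho> ^ 3)"
        using s z(2) by (intro integral_norm_bound_integral trajectory_integrable[OF z(1) s] op_bound) auto
      also have "\<dots> = K * \<rho> ^ 3 * s" using s by simp
      also have "\<dots> \<le> K * \<rho> ^ 3 * T" using s K \<rho>(2) by (intro mult_left_mono) auto
      finally show ?thesis using z(1) s by (auto simp: trajectory_def)
    qed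
    have dd: "norm ((x s - x0) - (y s - y0)) \<le> L * exp L * T * norm (x0 - y0)" if s: "s \<in> {0..T}" for s
    proof -
      have "norm (integral {0..s} (\<lambda>u. cubic_op r (phase_mult \<mu> u) (x u) - cubic_op r (phase_mult \<mu> u) (y u)))
          \<le> integral {0..s} (\<lambda>u. L * (exp L * norm (x0 - y0)))"
      proof (intro integral_norm_bound_integral integrable_diff trajectory_integrable[OF x s] trajectory_integrable[OF y s])
        fix u assume u: "u \<in> {0..s}"
        then have u': "u \<in> {0..T}" using s by auto
        have "norm (cubic_op r (phase_mult \<mu> u) (x u) - cubic_op r (phase_mult \<mu> u) (y u)) \<le> L * norm (x u - y u)"
          using cubic_op_lipschitz[OF r admissible_phase_mult xb[OF u'] yb[OF u'], of \<mu> u] by (simp add: L_def)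
        also have "\<dots> \<le> L * (exp L * norm (x0 - y0))" by (intro mult_left_mono lip u' L)
        finally show "norm (cubic_op r (phase_mult \<mu> u) (x u) - cubic_op r (phase_mult \<mu> u) (y u)) \<le> L * (exp L * norm (x0 - y0))" .
      qed auto
      also have "\<dots> = L * (exp L * norm (x0 - y0)) * s" using s by simp
      also have "\<dots> \<le> L * (exp L * norm (x0 - y0)) * T" using s L by (intro mult_left_mono) auto
      finally show ?thesis
        using x y s
        by (subst (asm) integral_diff[OF trajectory_integrable[OF x s] trajectory_integrable[OF y s]])
          (auto simp: trajectory_def mult_ac)
    qed
    let ?g = "\<lambda>s. (cubic_op r (phase_mult \<mu> s) (x s) - cubic_op r (phase_mult \<mu> s) x0) - (cubic_op r (phase_mult \<mu> s) (y s) - cubic_op r (phase_mult \<mu> s) y0)"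
    have T_mem: "T \<in> {0..T}" using T by simp
    have e1: "1 \<le> exp L" using L by simp
    have "norm (integral {0..T} ?g) \<le> integral {0..T} (\<lambda>s. C * T * norm (x0 - y0))"
    proof (intro integral_norm_bound_integral integrable_diff trajectory_integrable[OF x T_mem]
        trajectory_integrable[OF y T_mem] cubic_op_phase_mult_integrable)
      fix s assume s: "s \<in> {0..T}"
      have "norm (?g s) \<le> K * (3 * ((L * exp L * T * norm (x0 - y0)) * \<rho>\<^sup>2)
          + 6 * ((K * \<rho> ^ 3 * T) * (exp L * norm (x0 - y0)) * \<rho>))"
        by (rule cubic_op_diff_diff[OF r admissible_phase_mult[of \<mu> s] xb[OF s] x0b(1) yb[OF s] x0b(2), folded K_def])
          (use dev[OF x xb s] dev[OF y yb s] lip[OF s] dd[OF s] mult_right_mono[OF e1, of "norm (x0 - y0)"] in auto)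
      also have "\<dots> = C * T * norm (x0 - y0)" by (simp add: C_def algebra_simps)
      finally show "norm (?g s) \<le> C * T * norm (x0 - y0)" .
    qed auto
    also have "\<dots> = C * T\<^sup>2 * norm (x0 - y0)" using T by (simp add: power2_eq_square)
    also have "integral {0..T} ?g = (x T - x0 - duhamel r \<mu> T x0) - (y T - y0 - duhamel r \<mu> T y0)"
    proof -
      have "x T - x0 = integral {0..T} (\<lambda>s. cubic_op r (phase_mult \<mu> s) (x s))" "y T - y0 = integral {0..T} (\<lambda>s. cubic_op r (phase_mult \<mu> s) (y s))"
        using x y T_mem by (auto simp: trajectory_def)
      then show ?thesis
        unfolding duhamel_def
        by (simp add: integral_diff integrable_diff trajectory_integrable[OF x T_mem] trajectory_integrable[OF y T_mem] cubic_op_phase_mult_integrable)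
    qed
    finally show "norm ((x T - x0 - duhamel r \<mu> T x0) - (y T - y0 - duhamel r \<mu> T y0)) \<le> C * T\<^sup>2 * norm (x0 - y0)" .
  qed
qed

end

section \<open>Fourier series\<close>

abbreviation ecis :: "int \<Rightarrow> real \<Rightarrow> complex"
  where "ecis k x \<equiv> exp (\<i> * of_int k * of_real x)"

definition fser :: "(int \<Rightarrow> complex) \<Rightarrow> real \<Rightarrow> complex"
  where "fser c x = (\<Sum>\<^sub>\<infinity>k. c k * ecis k x)"

lemma ecis_add: "ecis (j + k) x = ecis j x * ecis k x"
  by (simp add: algebra_simps flip: exp_add)

lemma cnj_ecis: "cnj (ecis k x) = ecis (- k) x"
  by (simp add: exp_cnj)

lemma ecis_2pi: "ecis k (2 * pi) = 1"
  using exp_integer_2pi[of "of_int k"] by (simp add: mult_ac)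

lemma ecis_period: "ecis k (x + 2 * pi) = ecis k x"
proof -
  have "ecis k (x + 2 * pi) = ecis k x * ecis k (2 * pi)"
    by (simp add: algebra_simps flip: exp_add)
  then show ?thesis by (simp only: ecis_2pi mult_1_right)
qed

lemma continuous_on_ecis [continuous_intros]: "continuous_on A (ecis k)"
  by (intro continuous_intros)

lemma fser_has_sum:
  assumes "l1seq c"
  shows "((\<lambda>k. c k * ecis k x) has_sum fser c x) UNIV"
  unfolding fser_def
  by (rule has_sum_infsum, rule abs_summable_summable) (simp add: norm_mult assms)

lemma norm_fser_le:
  assumes "l1seq c"
  shows "cmod (fser c x) \<le> l1norm c"
  unfolding l1norm_def
  by (rule norm_infsum_le[OF fser_has_sum[OF assms] has_sum_infsum[OF assms]]) (simp add: norm_mult)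

lemma continuous_on_fser:
  assumes "l1seq c"
  shows "continuous_on A (fser c)"
  unfolding fser_def[abs_def]
  by (rule infsum_continuous_on[where g = "\<lambda>k. cmod (c k)"])
    (auto intro!: continuous_intros simp: norm_mult assms)

lemma fser_period: "fser c (x + 2 * pi) = fser c x"
  unfolding fser_def ecis_period ..

lemma l1seq_add: "l1seq a \<Longrightarrow> l1seq b \<Longrightarrow> l1seq (\<lambda>k. a k + b k)"
  by (rule summable_on_comparison_test[OF summable_on_add[of "\<lambda>k. cmod (a k)" UNIV "\<lambda>k. cmod (b k)"]])
    (auto intro: norm_triangle_ineq)

lemma l1seq_mult:
  assumes "l1seq a" "\<And>k. cmod (m k) \<le> M"
  shows "l1seq (\<lambda>k. m k * a k)"
  by (rule summable_on_comparison_test[OF summable_on_cmult_right[OF assms(1), of M]])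
    (auto simp: norm_mult intro!: mult_right_mono assms)

lemma l1seq_cmult: "l1seq a \<Longrightarrow> l1seq (\<lambda>k. z * a k)"
  by (rule l1seq_mult[of _ "\<lambda>_. z" "cmod z"]) auto

lemma l1seq_diff: "l1seq a \<Longrightarrow> l1seq b \<Longrightarrow> l1seq (\<lambda>k. a k - b k)"
  using l1seq_add[of a "\<lambda>k. (-1) * b k"] l1seq_cmult[of b "-1"] by simp

lemma fser_add:
  assumes "l1seq a" "l1seq b"
  shows "fser (\<lambda>k. a k + b k) x = fser a x + fser b x"
  using has_sum_add[OF fser_has_sum[OF assms(1)] fser_has_sum[OF assms(2)], of x]
  unfolding fser_def[of "\<lambda>k. a k + b k"] by (auto intro!: infsumI simp: distrib_right)

lemma fser_cmult: "fser (\<lambda>k. z * a k) x = z * fser a x"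
  unfolding fser_def infsum_cmult_right'[symmetric] by (simp add: mult.assoc)

lemma fser_diff:
  assumes "l1seq a" "l1seq b"
  shows "fser (\<lambda>k. a k - b k) x = fser a x - fser b x"
  using fser_add[OF assms(1) l1seq_cmult[OF assms(2)], of "-1" x] fser_cmult[of "-1" b x] by simp

lemma fser_delta: "fser (\<lambda>k. if k = 0 then z else 0) x = z"
proof -
  have "fser (\<lambda>k. if k = 0 then z else 0) x = (\<Sum>\<^sub>\<infinity>k\<in>{0}. (if k = 0 then z else 0) * ecis k x)"
    unfolding fser_def by (rule infsum_cong_neutral) auto
  then show ?thesis by simp
qed

lemma l1seq_delta: "l1seq (\<lambda>k. if k = 0 then z else 0)"
proof -
  have "(\<lambda>k. cmod (if k = 0 then z else 0)) summable_on {0 :: int}" by simp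
  also have "?this \<longleftrightarrow> l1seq (\<lambda>k. if k = 0 then z else 0)"
    by (rule summable_on_cong_neutral) auto
  finally show ?thesis .
qed

lemma mean0_ecis: "mean0 (ecis k) = (if k = 0 then 1 else 0)"
proof (cases "k = 0")
  case False
  have "((ecis k) has_integral (ecis k (2 * pi) / (\<i> * of_int k) - ecis k 0 / (\<i> * of_int k))) {0..2 * pi}"
  proof (rule fundamental_theorem_of_calculus)
    fix x
    show "((\<lambda>x. ecis k x / (\<i> * of_int k)) has_vector_derivative ecis k x) (at x within {0..2 * pi})"
      using False by (intro has_vector_derivative_real_field) (auto intro!: derivative_eq_intros)
  qed simp
  then have "integral {0..2 * pi} (ecis k) = 0"
    unfolding ecis_2pi by (auto dest!: integral_unique)
  then show ?thesis using False by (simp add: mean0_def)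
qed (simp add: mean0_def scaleR_conv_of_real)

lemma mean0_fser_ecis:
  assumes "l1seq c"
  shows "mean0 (\<lambda>x. fser c x * ecis (- k) x) = c k"
proof -
  let ?f = "\<lambda>j x. c j * ecis (j - k) x"
  have sum: "(\<Sum>\<^sub>\<infinity>j. ?f j x) = fser c x * ecis (- k) x" for x
    unfolding fser_def infsum_cmult_left'[symmetric]
    using ecis_add[of _ "- k" x] by (intro infsum_cong) simp
  have "((\<lambda>j. integral {0..2 * pi} (?f j)) has_sum integral {0..2 * pi} (\<lambda>x. \<Sum>\<^sub>\<infinity>j. ?f j x)) UNIV"
    by (rule infsum_integral[where g = "\<lambda>k. cmod (c k)"])
      (auto intro!: continuous_intros simp: norm_mult assms simp del: of_int_diff)
  moreover have "integral {0..2 * pi} (?f j) = (if j = k then 2 * pi * c k else 0)" for j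
    using mean0_ecis[of "j - k"]
    by (auto simp: mean0_def scaleR_conv_of_real simp del: of_int_diff split: if_splits)
  ultimately have "((\<lambda>j. if j = k then 2 * pi * c k else 0) has_sum
      integral {0..2 * pi} (\<lambda>x. fser c x * ecis (- k) x)) UNIV"
    unfolding sum by simp
  moreover have "((\<lambda>j. if j = k then 2 * pi * c k else 0) has_sum (2 * pi * c k)) UNIV"
    using has_sum_finite[of "{k}" "\<lambda>j. if j = k then 2 * pi * c k else 0"]
    by (subst has_sum_cong_neutral[where T = "{k}"]) auto
  ultimately have "integral {0..2 * pi} (\<lambda>x. fser c x * ecis (- k) x) = 2 * pi * c k"
    by (rule has_sum_unique)
  then show ?thesis by (simp add: mean0_def)
qed

lemma fourier_coeff_fser:
  assumes "l1seq c"
  shows "fourier_coeff (fser c) k = c k"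
  using mean0_fser_ecis[OF assms, of k] by (simp add: fourier_coeff_def)

lemma mean0_fser: "l1seq c \<Longrightarrow> mean0 (fser c) = c 0"
  using mean0_fser_ecis[of c 0] by simp

lemma fser_inject: "l1seq a \<Longrightarrow> l1seq b \<Longrightarrow> (\<And>x. fser a x = fser b x) \<Longrightarrow> a k = b k"
  using fourier_coeff_fser[of a k] fourier_coeff_fser[of b k] by (metis ext)

lemma fourier_mult_eq: "fourier_mult m f = fser (\<lambda>k. m k * fourier_coeff f k)"
  by (simp add: fourier_mult_def fser_def fun_eq_iff)

lemma fourier_mult_fser: "l1seq c \<Longrightarrow> fourier_mult m (fser c) = fser (\<lambda>k. m k * c k)"
  by (simp add: fourier_mult_eq fourier_coeff_fser)

subsection \<open>Completeness of the trigonometric system\<close>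

inductive trigp :: "(real \<Rightarrow> complex) \<Rightarrow> bool" where
  mono: "trigp (\<lambda>x. z * ecis k x)"
| add: "trigp f \<Longrightarrow> trigp g \<Longrightarrow> trigp (\<lambda>x. f x + g x)"

lemma trigp_mult_mono: "trigp g \<Longrightarrow> trigp (\<lambda>x. z * ecis k x * g x)"
proof (induction rule: trigp.induct)
  case (mono w j)
  have "(\<lambda>x. z * ecis k x * (w * ecis j x)) = (\<lambda>x. (z * w) * ecis (k + j) x)"
    unfolding ecis_add by (rule ext) (simp only: mult_ac)
  then show ?case by (simp only: trigp.mono)
next
  case (add f g)
  then show ?case using trigp.add by (simp only: distrib_left)
qed

lemma trigp_mult: "trigp f \<Longrightarrow> trigp g \<Longrightarrow> trigp (\<lambda>x. f x * g x)"
proof (induction rule: trigp.induct)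
  case (add f1 f2)
  then show ?case using trigp.add by (simp only: distrib_right)
qed (rule trigp_mult_mono)

lemma trigp_const: "trigp (\<lambda>x. z)"
  using trigp.mono[of z 0] by simp

text \<open>A real-linear functional on the plane restricted to the circle is
  \<open>cos x * p 1 + sin x * p \<i>\<close>; sums and products of trigonometric polynomials are
  again such.\<close>

lemma trigp_real_polynomial:
  assumes "real_polynomial_function p"
  shows "trigp (\<lambda>x. complex_of_real (p (cis x)))"
  using assms
proof (induction rule: real_polynomial_function.induct)
  case (linear p)
  interpret p: bounded_linear p by fact
  have pc: "p (cis x) = cos x * p 1 + sin x * p \<i>" for x
  proof -
    have "cis x = cos x *\<^sub>R 1 + sin x *\<^sub>R \<i>" by (simp add: complex_eq_iff)
    then show ?thesis by (simp add: p.add p.scaleR)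
  qed
  have C: "complex_of_real (cos x) = (1/2) * ecis 1 x + (1/2) * ecis (-1) x"
    and S: "complex_of_real (sin x) = (- \<i> / 2) * ecis 1 x + (\<i> / 2) * ecis (-1) x" for x
    by (simp_all add: cos_of_real[symmetric] sin_of_real[symmetric] cos_exp_eq sin_exp_eq field_simps)
  have "complex_of_real (p (cis x)) = (of_real (p 1) / 2 - \<i> / 2 * of_real (p \<i>)) * ecis 1 x
      + (of_real (p 1) / 2 + \<i> / 2 * of_real (p \<i>)) * ecis (-1) x" for x
    unfolding pc of_real_add of_real_mult C S by (simp add: algebra_simps)
  then show ?case by (simp only:) (intro trigp.intros)
next
  case (const c)
  then show ?case by (rule trigp_const)
next
  case (add f g)
  then show ?case using trigp.add by (simp add: of_real_add)
next
  case (mult f g)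
  then show ?case using trigp_mult by simp
qed

lemma trigp_polynomial:
  assumes "polynomial_function (g :: complex \<Rightarrow> complex)"
  shows "trigp (\<lambda>x. g (cis x))"
proof -
  have "real_polynomial_function (Re \<circ> g)" "real_polynomial_function (Im \<circ> g)"
    using assms by (auto simp: polynomial_function_def bounded_linear_Re bounded_linear_Im)
  from this[THEN trigp_real_polynomial]
  have "trigp (\<lambda>x. complex_of_real (Re (g (cis x))) + \<i> * complex_of_real (Im (g (cis x))))"
    by (intro trigp.add trigp_mult[OF trigp_const]) (auto simp: o_def)
  then show ?thesis by (simp flip: complex_eq)
qed

text \<open>A periodic function descends to the unit circle, a compact set on which the theorem of
  Stone and Weierstrass applies.\<close>

lemma trigp_approx:
  fixes f :: "real \<Rightarrow> complex"
  assumes f: "continuous_on UNIV f" "\<And>x. f (x + 2 * pi) = f x" and e: "0 < e"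
  obtains h where "trigp h" "\<And>x. x \<in> {0..2 * pi} \<Longrightarrow> cmod (f x - h x) < e"
proof -
  let ?S = "sphere (0::complex) 1"
  define F where "F z = f (Arg2pi z)" for z
  have F: "F (cis x) = f x" if "x \<in> {0..2 * pi}" for x
  proof (cases "x = 2 * pi")
    case True
    then show ?thesis using f(2)[of 0] Arg2pi_of_real[of 1] by (simp add: F_def)
  next
    case False
    then have "Arg2pi (cis x) = x"
      using that by (intro Arg2pi_unique[of 1]) (auto simp: cis_conv_exp)
    then show ?thesis by (simp add: F_def)
  qed
  have S: "\<exists>x\<in>{0..2 * pi}. z = cis x" if "z \<in> ?S" for z
    using that Arg2pi_ge_0[of z] Arg2pi_lt_2pi[of z] Arg2pi_eq[of z]
    by (intro bexI[of _ "Arg2pi z"]) (auto simp: cis_conv_exp)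
  \<comment> \<open>\<open>Arg2pi\<close> jumps at 1, so \<open>F\<close> is not simply a
    composition of continuous maps. The preimage of a closed set is the image under
    \<open>cis\<close> of a compact subset of \<open>{0..2 * pi}\<close>, hence closed.\<close>
  have "continuous_on ?S F"
  proof (subst continuous_on_closed_vimage[OF closed_sphere], intro allI impI)
    fix B :: "complex set" assume B: "closed B"
    have "F -` B \<inter> ?S = cis ` (f -` B \<inter> {0..2 * pi})"
      using S F by fastforce
    moreover have "closed (f -` B)"
      using f(1) B by (simp add: continuous_on_closed_vimage)
    then have "compact (f -` B \<inter> {0..2 * pi})" by (intro closed_Int_compact) auto
    then have "compact (cis ` (f -` B \<inter> {0..2 * pi}))"
      by (intro compact_continuous_image continuous_intros)
    ultimately show "closed (F -` B \<inter> ?S)" by (simp add: compact_imp_closed)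
  qed
  then obtain g where g: "polynomial_function g" "\<And>z. z \<in> ?S \<Longrightarrow> cmod (F z - g z) < e"
    using Stone_Weierstrass_polynomial_function[OF compact_sphere _ e] by metis
  show thesis
  proof (rule that)
    show "trigp (\<lambda>x. g (cis x))" by (rule trigp_polynomial[OF g(1)])
    show "cmod (f x - g (cis x)) < e" if "x \<in> {0..2 * pi}" for x
      using g(2)[of "cis x"] F[OF that] by simp
  qed
qed

lemma trigp_orthogonal:
  assumes f: "continuous_on UNIV f" "\<And>k. fourier_coeff f k = 0" and h: "trigp h"
  shows "continuous_on UNIV h \<and> integral {0..2 * pi} (\<lambda>x. f x * h x) = 0"
  using h
proof (induction rule: trigp.induct)
  case (mono z k)
  have "(\<lambda>x. f x * (z * ecis k x)) = (\<lambda>x. z * (f x * exp (- (\<i> * of_int (- k) * of_real x))))"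
    by (rule ext) simp
  moreover have "integral {0..2 * pi} (\<lambda>x. f x * exp (- (\<i> * of_int (- k) * of_real x))) = 0"
    using f(2)[of "- k"] by (simp add: fourier_coeff_def mean0_def)
  ultimately show ?case by (simp only: integral_mult_right mult_zero_right) (auto intro!: continuous_intros)
next
  case (add g h)
  have "(\<lambda>x. f x * g x) integrable_on {0..2 * pi}" "(\<lambda>x. f x * h x) integrable_on {0..2 * pi}"
    using add f(1) by (auto intro!: integrable_continuous_real continuous_intros intro: continuous_on_subset)
  then show ?case using add by (simp add: distrib_left integral_add continuous_on_add)
qed

text \<open>If \<open>h\<close> approximates \<open>cnj f\<close> within \<open>e\<close>, the
  integral of \<open>|f|^2\<close> equals that of \<open>f * (cnj f - h)\<close>, because
  \<open>f\<close> is orthogonal to \<open>h\<close>, and is at most \<open>e\<close> times the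
  integral of \<open>|f|\<close>. Through this an element of \<open>sobolev r\<close> is identified
  with its Fourier series.\<close>

lemma fourier_unique:
  fixes f :: "real \<Rightarrow> complex"
  assumes f: "continuous_on UNIV f" "\<And>x. f (x + 2 * pi) = f x" "\<And>k. fourier_coeff f k = 0"
  shows "f x = 0"
proof -
  have fc: "continuous_on {0..2 * pi} f" using f(1) by (rule continuous_on_subset) simp
  let ?I = "{0..2 * pi}"
  have cnjc: "continuous_on UNIV (\<lambda>x. cnj (f x))" using f(1) by (intro continuous_intros)
  define A where "A = integral ?I (\<lambda>x. cmod (f x))"
  have A: "0 \<le> A" unfolding A_def by (rule integral_nonneg) (auto intro!: integrable_continuous_real continuous_intros fc)
  have le: "integral ?I (\<lambda>x. (cmod (f x))\<^sup>2) \<le> e * A" if e: "0 < e" for e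
  proof -
    obtain h where h: "trigp h" "\<And>x. x \<in> ?I \<Longrightarrow> cmod (cnj (f x) - h x) < e"
      using trigp_approx[OF cnjc _ e] f(2) by metis
    have hc: "continuous_on ?I h" and o: "integral ?I (\<lambda>x. f x * h x) = 0"
      using trigp_orthogonal[OF f(1,3) h(1)] by (auto intro: continuous_on_subset)
    have "(\<lambda>x. (cmod (f x))\<^sup>2) integrable_on ?I"
      by (intro integrable_continuous_real continuous_intros fc)
    moreover have "bounded_linear complex_of_real" by (rule bounded_linear_of_real)
    ultimately have "integral ?I (complex_of_real \<circ> (\<lambda>x. (cmod (f x))\<^sup>2)) = complex_of_real (integral ?I (\<lambda>x. (cmod (f x))\<^sup>2))"
      by (rule integral_linear)
    then
    have "complex_of_real (integral ?I (\<lambda>x. (cmod (f x))\<^sup>2)) = integral ?I (\<lambda>x. complex_of_real ((cmod (f x))\<^sup>2))"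
      by (simp only: o_def)
    also have "\<dots> = integral ?I (\<lambda>x. f x * cnj (f x))"
      by (simp only: complex_norm_square)
    also have "\<dots> = integral ?I (\<lambda>x. f x * cnj (f x)) - integral ?I (\<lambda>x. f x * h x)"
      by (simp add: o)
    also have "\<dots> = integral ?I (\<lambda>x. f x * (cnj (f x) - h x))"
      unfolding right_diff_distrib
      by (intro integral_diff[symmetric] integrable_continuous_real continuous_intros fc hc)
    finally have "\<bar>integral ?I (\<lambda>x. (cmod (f x))\<^sup>2)\<bar> = cmod (integral ?I (\<lambda>x. f x * (cnj (f x) - h x)))"
      by (metis norm_of_real)
    also have "\<dots> \<le> integral ?I (\<lambda>x. e * cmod (f x))"
    proof (rule integral_norm_bound_integral)
      show "(\<lambda>x. f x * (cnj (f x) - h x)) integrable_on ?I"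
        by (intro integrable_continuous_real continuous_intros fc hc)
      show "(\<lambda>x. e * cmod (f x)) integrable_on ?I"
        by (intro integrable_continuous_real continuous_intros fc)
      show "cmod (f x * (cnj (f x) - h x)) \<le> e * cmod (f x)" if "x \<in> ?I" for x
        using mult_left_mono[OF less_imp_le[OF h(2)[OF that]], of "cmod (f x)"]
        by (simp add: norm_mult mult.commute)
    qed
    finally show ?thesis by (simp add: A_def)
  qed
  have sc: "continuous_on ?I (\<lambda>x. (cmod (f x))\<^sup>2)" by (intro continuous_intros fc)
  have "integral ?I (\<lambda>x. (cmod (f x))\<^sup>2) \<le> 0"
  proof (rule field_le_epsilon)
    fix e :: real assume "0 < e"
    have "integral ?I (\<lambda>x. (cmod (f x))\<^sup>2) \<le> (e / (A + 1)) * A" using A \<open>0 < e\<close> by (intro le) simp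
    also have "\<dots> \<le> e" using A \<open>0 < e\<close> by (simp add: field_simps)
    finally show "integral ?I (\<lambda>x. (cmod (f x))\<^sup>2) \<le> 0 + e" by simp
  qed
  then have "integral ?I (\<lambda>x. (cmod (f x))\<^sup>2) = 0"
    using integral_nonneg[OF integrable_continuous_real[OF sc]] by force
  then have z: "f y = 0" if "y \<in> ?I" for y
    using integral_eq_0_iff[OF sc, of] that by auto
  have per: "f (y + 2 * pi * of_int n) = f y" for y n
  proof (induction n rule: int_induct[where k = 0])
    case (step1 i)
    then show ?case using f(2)[of "y + 2 * pi * of_int i"] by (simp add: algebra_simps)
  next
    case (step2 i)
    then show ?case using f(2)[of "y + 2 * pi * of_int (i - 1)"] by (simp add: algebra_simps)
  qed simp
  define n where "n = \<lfloor>x / (2 * pi)\<rfloor>"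
  have "x - 2 * pi * of_int n \<in> ?I"
    using floor_correct[of "x / (2 * pi)"] unfolding n_def[symmetric] by (auto simp: field_simps)
  from z[OF this] per[of "x - 2 * pi * of_int n" n] show ?thesis by simp
qed

lemma sobolev_fourier:
  assumes "r > 1 / 2" "f \<in> sobolev r"
  shows "fourier_coeff f \<in> hseq r" "l1seq (fourier_coeff f)" "f = fser (fourier_coeff f)"
proof -
  show h: "fourier_coeff f \<in> hseq r" using assms(2) by (simp add: sobolev_def hseq_def)
  show l: "l1seq (fourier_coeff f)" by (rule hseq_l1[OF assms(1) h])
  have f: "continuous_on UNIV f" "f (x + 2 * pi) = f x" for x using assms(2) by (auto simp: sobolev_def)
  have "f x - fser (fourier_coeff f) x = 0" for x
  proof (rule fourier_unique[of "\<lambda>x. f x - fser (fourier_coeff f) x"])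
    show "continuous_on UNIV (\<lambda>x. f x - fser (fourier_coeff f) x)"
      by (intro continuous_intros f continuous_on_fser l)
    fix k
    have i: "(\<lambda>x. g x * exp (- (\<i> * of_int k * of_real x))) integrable_on {0..2 * pi}"
      if "continuous_on UNIV g" for g
      using that by (auto intro!: integrable_continuous_real continuous_intros intro: continuous_on_subset)
    have "fourier_coeff (\<lambda>x. f x - fser (fourier_coeff f) x) k
        = fourier_coeff f k - fourier_coeff (fser (fourier_coeff f)) k"
      unfolding fourier_coeff_def mean0_def left_diff_distrib
      by (subst integral_diff[OF i[OF f(1)] i[OF continuous_on_fser[OF l, unfolded fourier_coeff_def mean0_def]]])
        (simp add: diff_divide_distrib)
    then show "fourier_coeff (\<lambda>x. f x - fser (fourier_coeff f) x) k = 0"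
      by (simp add: fourier_coeff_fser[OF l])
  qed (simp add: fser_period f)
  then show "f = fser (fourier_coeff f)" by (intro ext) (metis eq_iff_diff_eq_0)
qed

lemma fser_sobolev:
  assumes "r > 1 / 2" "c \<in> hseq r"
  shows "fser c \<in> sobolev r" "sobolev_norm r (fser c) = hnorm r c"
proof -
  have l: "l1seq c" by (rule hseq_l1[OF assms])
  show "fser c \<in> sobolev r"
    using assms(2) by (simp add: sobolev_def hseq_def continuous_on_fser[OF l] fser_period fourier_coeff_fser[OF l])
  show "sobolev_norm r (fser c) = hnorm r c"
    by (simp add: sobolev_norm_def hnorm_def fourier_coeff_fser[OF l])
qed

subsection \<open>Products and derivatives\<close>

definition conv :: "(int \<Rightarrow> complex) \<Rightarrow> (int \<Rightarrow> complex) \<Rightarrow> int \<Rightarrow> complex"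
  where "conv a b k = (\<Sum>\<^sub>\<infinity>i. a i * b (k - i))"

lemma conv_summable:
  assumes "l1seq a" "l1seq b"
  shows "(\<lambda>(k, i). cmod (a i * b (k - i))) summable_on UNIV"
proof -
  have "(\<lambda>p. cmod (a (fst p)) * cmod (b (snd p))) summable_on UNIV"
    by (rule product_summable) (use assms in auto)
  also have "?this \<longleftrightarrow> (\<lambda>(k, i). cmod (a i * b (k - i))) summable_on UNIV"
    by (rule summable_on_reindex_bij_witness[of _ "\<lambda>(k, i). (i, k - i)" "\<lambda>(i, j). (i + j, i)"])
      (auto simp: norm_mult)
  finally show ?thesis .
qed

lemma conv_l1seq:
  assumes "l1seq a" "l1seq b"
  shows "l1seq (conv a b)"
proof -
  have s: "(\<lambda>(k, i). cmod (a i * b (k - i))) summable_on Sigma UNIV (\<lambda>_. UNIV)"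
    using conv_summable[OF assms] by simp
  have s1: "(\<lambda>i. cmod (a i * b (k - i))) summable_on UNIV" for k
    using summable_on_SigmaD1[OF s, of k] by simp
  show ?thesis
  proof (rule summable_on_comparison_test[OF summable_on_Sigma_banach[OF s]])
    show "cmod (conv a b k) \<le> (\<Sum>\<^sub>\<infinity>i. cmod (a i * b (k - i)))" for k
      unfolding conv_def by (rule norm_infsum_bound) (rule s1)
  qed auto
qed

lemma fser_mult:
  assumes "l1seq a" "l1seq b"
  shows "fser a x * fser b x = fser (conv a b) x"
proof -
  let ?f = "\<lambda>(k, i). a i * b (k - i) * ecis k x"
  have s: "?f summable_on Sigma UNIV (\<lambda>_. UNIV)"
    by (rule abs_summable_summable) (use conv_summable[OF assms] in \<open>simp add: case_prod_unfold norm_mult\<close>)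
  have "fser (conv a b) x = (\<Sum>\<^sub>\<infinity>k. \<Sum>\<^sub>\<infinity>i. a i * b (k - i) * ecis k x)"
    unfolding fser_def conv_def by (simp add: infsum_cmult_left')
  also have "\<dots> = infsum ?f UNIV"
    using infsum_Sigma'_banach[OF s] by simp
  also have "\<dots> = (\<Sum>\<^sub>\<infinity>(i, j). a i * ecis i x * (b j * ecis j x))"
  proof (rule infsum_reindex_bij_witness[of _ "\<lambda>(i, j). (i + j, i)" "\<lambda>(k, i). (i, k - i)"])
    fix p :: "int \<times> int"
    obtain k i where p: "p = (k, i)" by force
    have "ecis k x = ecis i x * ecis (k - i) x" by (subst ecis_add[symmetric]) simp
    then show "(case case p of (k, i) \<Rightarrow> (i, k - i) of (i, j) \<Rightarrow> a i * ecis i x * (b j * ecis j x)) = ?f p"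
      by (simp only: p prod.case mult_ac)
  qed auto
  also have "\<dots> = (\<Sum>\<^sub>\<infinity>i. \<Sum>\<^sub>\<infinity>j. a i * ecis i x * (b j * ecis j x))"
  proof -
    have "(\<lambda>p. cmod (a (fst p)) * cmod (b (snd p))) summable_on UNIV"
      by (rule product_summable) (use assms in auto)
    then have "(\<lambda>(i, j). a i * ecis i x * (b j * ecis j x)) summable_on Sigma UNIV (\<lambda>_. UNIV)"
      by - (rule abs_summable_summable, simp add: case_prod_unfold norm_mult)
    from infsum_Sigma'_banach[OF this] show ?thesis by simp
  qed
  also have "\<dots> = fser a x * fser b x"
    by (simp add: fser_def infsum_cmult_left' infsum_cmult_right')
  finally show ?thesis ..
qed

definition cnj_seq :: "(int \<Rightarrow> complex) \<Rightarrow> int \<Rightarrow> complex"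
  where "cnj_seq a k = cnj (a (- k))"

lemma cnj_seq_l1seq: "l1seq a \<Longrightarrow> l1seq (cnj_seq a)"
  unfolding cnj_seq_def complex_mod_cnj
  by (subst summable_on_reindex_bij_witness[of UNIV uminus uminus UNIV "\<lambda>k. cmod (a k)"]) auto

lemma cnj_fser: "cnj (fser a x) = fser (cnj_seq a) x"
proof -
  have "cnj (fser a x) = (\<Sum>\<^sub>\<infinity>k. cnj (a k) * ecis (- k) x)"
    unfolding fser_def infsum_cnj[symmetric] complex_cnj_mult cnj_ecis ..
  also have "\<dots> = fser (cnj_seq a) x"
    unfolding fser_def cnj_seq_def
    by (rule infsum_reindex_bij_witness[of _ uminus uminus]) auto
  finally show ?thesis .
qed

lemma mean0_mult_cnj:
  assumes "l1seq a" "l1seq b"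
  shows "mean0 (\<lambda>x. fser a x * cnj (fser b x)) = (\<Sum>\<^sub>\<infinity>k. a k * cnj (b k))"
  unfolding cnj_fser fser_mult[OF assms(1) cnj_seq_l1seq[OF assms(2)]]
  unfolding mean0_fser[OF conv_l1seq[OF assms(1) cnj_seq_l1seq[OF assms(2)]]]
  by (simp add: conv_def cnj_seq_def)

text \<open>Integrating the derived series term by term replaces any limit of difference quotients;
  the fundamental theorem then returns the derivative.\<close>

lemma fser_has_vector_derivative:
  assumes c: "l1seq c" and c': "l1seq (\<lambda>k. \<i> * of_int k * c k)"
  shows "(fser c has_vector_derivative fser (\<lambda>k. \<i> * of_int k * c k) x) (at x)"
proof -
  let ?G = "fser (\<lambda>k. \<i> * of_int k * c k)"
  let ?I = "{x - 1..x + 1}"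
  have G: "fser c u = fser c (x - 1) + integral {x - 1..u} ?G" if u: "u \<in> ?I" for u
  proof -
    let ?f = "\<lambda>k y. \<i> * of_int k * c k * ecis k y"
    have "((\<lambda>k. integral {x - 1..u} (?f k)) has_sum integral {x - 1..u} (\<lambda>y. \<Sum>\<^sub>\<infinity>k. ?f k y)) UNIV"
    proof (rule infsum_integral[OF _ _ c'])
      show "continuous_on {x - 1..u} (?f k)" for k by (intro continuous_intros)
      show "cmod (?f k y) \<le> cmod (\<i> * of_int k * c k)" for k y
        using norm_mult[of "\<i> * of_int k * c k" "ecis k y"] by simp
    qed
    moreover have "integral {x - 1..u} (?f k) = c k * ecis k u - c k * ecis k (x - 1)" for k
    proof (rule integral_unique, rule fundamental_theorem_of_calculus)
      fix y
      show "((\<lambda>y. c k * ecis k y) has_vector_derivative ?f k y) (at y within {x - 1..u})"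
        by (rule has_vector_derivative_real_field) (auto intro!: derivative_eq_intros)
    qed (use u in auto)
    ultimately have "((\<lambda>k. c k * ecis k u - c k * ecis k (x - 1)) has_sum integral {x - 1..u} ?G) UNIV"
      by (simp add: fser_def[abs_def])
    moreover have "((\<lambda>k. c k * ecis k u - c k * ecis k (x - 1)) has_sum (fser c u - fser c (x - 1))) UNIV"
      using has_sum_add[OF fser_has_sum[OF c, of u] has_sum_uminusI[OF fser_has_sum[OF c, of "x - 1"]]] by simp
    ultimately show ?thesis using has_sum_unique by fastforce
  qed
  have d: "((\<lambda>u. fser c (x - 1) + integral {x - 1..u} ?G) has_vector_derivative 0 + ?G x) (at x within ?I)"
    by (intro has_vector_derivative_add integral_has_vector_derivative continuous_on_fser c') auto
  have xI: "x \<in> ?I" by simp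
  have "(fser c has_vector_derivative ?G x) (at x within ?I)"
    using has_vector_derivative_transform[OF xI G d] by (simp only: add_0)
  moreover have "at x within ?I = at x"
    by (rule at_within_interior) (simp only: interior_atLeastAtMost_real greaterThanLessThan_iff, simp)
  ultimately show ?thesis by (simp only:)
qed

lemma tri_bounded_summable:
  assumes l: "l1seq a" "l1seq b" "l1seq c" and m: "\<And>i j. cmod (m k i j) \<le> M"
  shows "tri_summable m a b c k"
  by (rule tri_bound(1)[OF l, where D = M]) (auto simp: norm_mult intro!: mult_right_mono m)

text \<open>With \<open>l = i + j - k\<close>, the product \<open>a cnj b\<close> carries the
  frequency \<open>i - l = k - j\<close>, at which \<open>f\<close> is evaluated. This serves the
  terms of the form \<open>u * dinv (abs_sq u)\<close>.\<close>

lemma conv_tri1: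
  assumes l: "l1seq a" "l1seq b" "l1seq c" and f: "\<And>m. cmod (f m) \<le> M"
  shows "conv (\<lambda>m. f m * conv a (cnj_seq b) m) c k = tri (\<lambda>k i j. f (k - j)) a b c k"
proof -
  let ?F = "\<lambda>m i. f m * (a i * cnj (b (i - m)) * c (k - m))"
  have "tri_summable (\<lambda>k i j. f (k - j)) a b c k"
    by (rule tri_bounded_summable[OF l]) (rule f)
  also have "?this \<longleftrightarrow> (\<lambda>(m, i). ?F m i) summable_on UNIV"
    unfolding tri_summable_def
    by (rule summable_on_reindex_bij_witness[of _ "\<lambda>(m, i). (i, k - m)" "\<lambda>(i, j). (k - j, i)"])
      (auto simp: algebra_simps)
  finally have s: "(\<lambda>(m, i). ?F m i) summable_on Sigma UNIV (\<lambda>_. UNIV)" by simp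
  have "conv (\<lambda>m. f m * conv a (cnj_seq b) m) c k = (\<Sum>\<^sub>\<infinity>m. \<Sum>\<^sub>\<infinity>i. ?F m i)"
    unfolding conv_def cnj_seq_def infsum_cmult_right'[symmetric] infsum_cmult_left'[symmetric]
    by (simp add: mult_ac)
  also have "\<dots> = (\<Sum>\<^sub>\<infinity>(m, i). ?F m i)" using infsum_Sigma'_banach[OF s] by simp
  also have "\<dots> = tri (\<lambda>k i j. f (k - j)) a b c k"
    unfolding tri_def
    by (rule infsum_reindex_bij_witness[of _ "\<lambda>(i, j). (k - j, i)" "\<lambda>(m, i). (i, k - m)"])
      (auto simp: algebra_simps)
  finally show ?thesis .
qed

text \<open>Here \<open>a c\<close> carries the frequency \<open>i + j\<close> and
  \<open>cnj b\<close> carries \<open>- l = k - i - j\<close>, as in the product of the evolved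
  \<open>u^2\<close> and \<open>cnj u\<close>.\<close>

lemma conv_tri2:
  assumes l: "l1seq a" "l1seq b" "l1seq c" and f: "\<And>m. cmod (f m) \<le> M" and g: "\<And>m. cmod (g m) \<le> N"
  shows "conv (\<lambda>m. f m * conv a c m) (\<lambda>m. g m * cnj_seq b m) k
    = tri (\<lambda>k i j. f (i + j) * g (k - i - j)) a b c k"
proof -
  let ?F = "\<lambda>m i. f m * g (k - m) * (a i * cnj (b (m - k)) * c (m - i))"
  have "cmod (f (i + j) * g (k - i - j)) \<le> M * N" for i j
    unfolding norm_mult using order_trans[OF norm_ge_zero f] by (intro mult_mono f g) auto
  then have "tri_summable (\<lambda>k i j. f (i + j) * g (k - i - j)) a b c k"
    by (rule tri_bounded_summable[OF l])
  also have "?this \<longleftrightarrow> (\<lambda>(m, i). ?F m i) summable_on UNIV"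
    unfolding tri_summable_def
    by (rule summable_on_reindex_bij_witness[of _ "\<lambda>(m, i). (i, m - i)" "\<lambda>(i, j). (i + j, i)"])
      (auto simp: algebra_simps)
  finally have s: "(\<lambda>(m, i). ?F m i) summable_on Sigma UNIV (\<lambda>_. UNIV)" by simp
  have "conv (\<lambda>m. f m * conv a c m) (\<lambda>m. g m * cnj_seq b m) k = (\<Sum>\<^sub>\<infinity>m. \<Sum>\<^sub>\<infinity>i. ?F m i)"
    unfolding conv_def cnj_seq_def infsum_cmult_right'[symmetric] infsum_cmult_left'[symmetric]
    by (simp add: mult_ac)
  also have "\<dots> = (\<Sum>\<^sub>\<infinity>(m, i). ?F m i)" using infsum_Sigma'_banach[OF s] by simp
  also have "\<dots> = tri (\<lambda>k i j. f (i + j) * g (k - i - j)) a b c k"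
    unfolding tri_def
    by (rule infsum_reindex_bij_witness[of _ "\<lambda>(i, j). (i + j, i)" "\<lambda>(m, i). (i, m - i)"])
      (auto simp: algebra_simps)
  finally show ?thesis .
qed

lemma abs_sq_fser: "l1seq a \<Longrightarrow> abs_sq (fser a) = fser (conv a (cnj_seq a))"
  unfolding abs_sq_def complex_norm_square
  by (rule ext) (simp add: cnj_fser fser_mult cnj_seq_l1seq)

lemma cubic_fser:
  assumes a: "l1seq a"
  shows "cubic (fser a) = fser (cubic_seq a)" "l1seq (cubic_seq a)"
proof -
  have l: "l1seq (conv a (cnj_seq a))" by (intro conv_l1seq cnj_seq_l1seq a)
  have c: "conv (conv a (cnj_seq a)) a = cubic_seq a"
    using conv_tri1[OF a a a, of "\<lambda>_. 1" 1] by (simp add: fun_eq_iff)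
  show "cubic (fser a) = fser (cubic_seq a)"
    using fser_mult[OF l a] abs_sq_fser[OF a] by (simp add: cubic_def abs_sq_def fun_eq_iff c)
  show "l1seq (cubic_seq a)" unfolding c[symmetric] by (rule conv_l1seq[OF l a])
qed

lemma schroedinger_group_eq:
  "schroedinger_group t f = fser (\<lambda>k. phase t k * fourier_coeff f k)"
  by (simp add: schroedinger_group_def fourier_mult_eq)

section \<open>Mild solutions\<close>

context
  fixes r \<mu> :: real
  assumes r: "r > 3 / 2"
begin

lemma r_half: "r > 1 / 2"
  using r by simp

lemma unemb_l1seq: "l1seq (unemb r b)"
  by (rule hseq_l1(1)[OF r_half unemb_hseq])

text \<open>The supremum is below the \<open>l1norm\<close>, so point evaluation is continuous. It
  links the pointwise Duhamel integral to the vector-valued one.\<close>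

lemma bounded_linear_eval: "bounded_linear (\<lambda>b. fser (unemb r b) x)"
proof (rule bounded_linear_intro[where K = "sob_const r"])
  have "unemb r (a + b) = (\<lambda>k. unemb r a k + unemb r b k)" for a b
    by (rule ext) (simp add: unemb_def add_divide_distrib)
  then show "fser (unemb r (a + b)) x = fser (unemb r a) x + fser (unemb r b) x" for a b
    by (simp add: fser_add unemb_l1seq)
  have "unemb r (c *\<^sub>R b) = (\<lambda>k. of_real c * unemb r b k)" for c b
    by (rule ext) (simp add: unemb_def scaleR_conv_of_real)
  then show "fser (unemb r (c *\<^sub>R b)) x = c *\<^sub>R fser (unemb r b) x" for c b
    by (simp add: fser_cmult scaleR_conv_of_real)
  show "cmod (fser (unemb r b) x) \<le> norm b * sob_const r" for b
    using order_trans[OF norm_fser_le[OF unemb_l1seq] hseq_l1(2)[OF r_half unemb_hseq]]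
    by (simp add: mult.commute)
qed

lemma fser_unemb_inject: "(\<And>x. fser (unemb r a) x = fser (unemb r b) x) \<Longrightarrow> a = b"
  using fser_inject[OF unemb_l1seq unemb_l1seq, of a b] emb_unemb[of r a] emb_unemb[of r b]
  by (metis ext)

text \<open>The group over time \<open>t - s\<close> splits: the part \<open>- s\<close>, together
  with the phases inside the cubic term, forms \<open>phase_mult\<close>, and the part
  \<open>t\<close> can stay outside the integral over \<open>s\<close>.\<close>

lemma duhamel_integrand:
  "- \<i> * of_real \<mu> * schroedinger_group (t - s) (cubic (fser (unemb r (free_group s b)))) x
    = fser (unemb r (free_group t (cubic_op r (phase_mult \<mu> s) b))) x"
proof -
  let ?c = "unemb r (free_group s b)"
  note cc = cubic_fser[OF unemb_l1seq, of "free_group s b"]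
  have "unemb r (free_group t (cubic_op r (phase_mult \<mu> s) b)) k
      = - \<i> * of_real \<mu> * (phase (t - s) k * cubic_seq ?c k)" for k
  proof -
    have e: "phase t k * exp (\<i> * of_real s * (of_int k)\<^sup>2)
        = phase (t - s) k"
      by (simp add: algebra_simps flip: exp_add)
    have c: "?c = (\<lambda>k. phase s k * unemb r b k)"
      by (rule ext) (rule unemb_free_group)
    have "unemb r (cubic_op r (phase_mult \<mu> s) b) k = tri (phase_mult \<mu> s) (unemb r b) (unemb r b) (unemb r b) k"
      by (simp add: unemb_def[of r "cubic_op r (phase_mult \<mu> s) b"] coord_tri_op[OF r admissible_phase_mult])
    also have "\<dots> = exp (\<i> * of_real s * (of_int k)\<^sup>2) * (- \<i> * of_real \<mu> * cubic_seq ?c k)"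
      unfolding tri_phase[OF refl] c tri_const_mult[of "- \<i> * of_real \<mu>"] ..
    finally show ?thesis
      unfolding unemb_free_group e[symmetric] by (simp only: mult_ac)
  qed
  then have "unemb r (free_group t (cubic_op r (phase_mult \<mu> s) b)) = (\<lambda>k.
      - \<i> * of_real \<mu> * (phase (t - s) k * cubic_seq ?c k))" by (rule ext)
  then show ?thesis
    unfolding schroedinger_group_eq cc(1) fourier_coeff_fser[OF cc(2)] fser_cmult[symmetric]
    by (simp only:)
qed

lemma eval_integral:
  assumes "f integrable_on {0..t}"
  shows "integral {0..t} (\<lambda>s. fser (unemb r (free_group t (f s))) x)
    = fser (unemb r (free_group t (integral {0..t} f))) x"
proof -
  have "bounded_linear (\<lambda>b. fser (unemb r (free_group t b)) x)"
    using bounded_linear_compose[OF bounded_linear_eval bounded_linear_free_group] .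
  from integral_linear[OF assms this] show ?thesis by (simp add: o_def)
qed

lemma emb_fourier:
  assumes "v \<in> sobolev r"
  shows "v = fser (unemb r (emb r (fourier_coeff v)))"
  using sobolev_fourier[OF r_half assms] by simp

lemma sobolev_norm_diff:
  "sobolev_norm r (fser (unemb r a) - fser (unemb r b)) = norm (a - b)"
  "fser (unemb r a) - fser (unemb r b) \<in> sobolev r"
proof -
  have "fser (unemb r a) - fser (unemb r b) = fser (unemb r (a - b))"
    by (rule ext) (simp add: unemb_diff fser_diff unemb_l1seq)
  then show "sobolev_norm r (fser (unemb r a) - fser (unemb r b)) = norm (a - b)"
    "fser (unemb r a) - fser (unemb r b) \<in> sobolev r"
    using fser_sobolev[OF r_half unemb_hseq, of "a - b"] by simp_all
qed

text \<open>Serves both directions of the correspondence: along a trajectory it yields a mild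
  solution, and along a mild solution it yields the integrated differential equation, since
  evaluations separate points.\<close>

lemma mild_equation:
  assumes v: "v \<in> sobolev r" and u: "\<And>s. s \<in> {0..t} \<Longrightarrow> u s = fser (unemb r (free_group s (y s)))"
    and y: "continuous_on {0..t} y"
  shows "schroedinger_group t v x
      - \<i> * of_real \<mu> * integral {0..t} (\<lambda>s. schroedinger_group (t - s) (cubic (u s)) x)
    = fser (unemb r (free_group t (emb r (fourier_coeff v) + integral {0..t} (\<lambda>s. cubic_op r (phase_mult \<mu> s) (y s))))) x"
proof -
  have i: "(\<lambda>s. cubic_op r (phase_mult \<mu> s) (y s)) integrable_on {0..t}"
    by (intro integrable_continuous_real continuous_on_cubic_op_phase_mult[OF r] y)
  have "- \<i> * of_real \<mu> * integral {0..t} (\<lambda>s. schroedinger_group (t - s) (cubic (u s)) x)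
      = integral {0..t} (\<lambda>s. - \<i> * of_real \<mu> * schroedinger_group (t - s) (cubic (u s)) x)"
    by simp
  also have "\<dots> = integral {0..t} (\<lambda>s. fser (unemb r (free_group t (cubic_op r (phase_mult \<mu> s) (y s)))) x)"
    by (rule integral_cong) (simp only: u duhamel_integrand)
  also have "\<dots> = fser (unemb r (free_group t (integral {0..t} (\<lambda>s. cubic_op r (phase_mult \<mu> s) (y s))))) x"
    by (rule eval_integral[OF i])
  finally have 1: "- \<i> * of_real \<mu> * integral {0..t} (\<lambda>s. schroedinger_group (t - s) (cubic (u s)) x)
      = fser (unemb r (free_group t (integral {0..t} (\<lambda>s. cubic_op r (phase_mult \<mu> s) (y s))))) x" .
  have 2: "schroedinger_group t v x = fser (unemb r (free_group t (emb r (fourier_coeff v)))) x"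
    unfolding schroedinger_group_eq unemb_free_group[abs_def]
    using sobolev_fourier(1)[OF r_half v] by simp
  have "fser (unemb r (free_group t (a + b))) x = fser (unemb r (free_group t a)) x + fser (unemb r (free_group t b)) x" for a b
    unfolding free_group_add by (rule linear_add[OF bounded_linear.linear[OF bounded_linear_eval]])
  with 1 2 show ?thesis by simp
qed

lemma mild_of_trajectory:
  assumes v: "v \<in> sobolev r" and x: "trajectory r \<mu> T (emb r (fourier_coeff v)) x"
  shows "nls_mild_solution \<mu> r T v (\<lambda>t. fser (modes r x t))"
  unfolding nls_mild_solution_def
proof (intro conjI ballI allI)
  have xc: "continuous_on {0..T} x" using x by (simp add: trajectory_def)
  fix t assume t: "t \<in> {0..T}"
  show "fser (modes r x t) \<in> sobolev r"
    by (rule fser_sobolev(1)[OF r_half modes_hseq(1)])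
  have "continuous_on {0..T} (\<lambda>t. free_group t (x t))"
    by (intro continuous_on_free_group continuous_intros xc)
  then have "((\<lambda>s. free_group s (x s)) \<longlongrightarrow> free_group t (x t)) (at t within {0..T})"
    using t by (auto simp: continuous_on_def)
  then show "((\<lambda>s. sobolev_norm r (fser (modes r x s) - fser (modes r x t))) \<longlongrightarrow> 0) (at t within {0..T})"
    unfolding modes_def sobolev_norm_diff(1) by (simp add: tendsto_norm_zero_iff LIM_zero_iff)
  fix z
  have "fser (modes r x t) z = fser (unemb r (free_group t (emb r (fourier_coeff v) + integral {0..t} (\<lambda>s. cubic_op r (phase_mult \<mu> s) (x s))))) z"
    using x t by (auto simp: trajectory_def modes_def)
  also have "\<dots> = schroedinger_group t v z
      - \<i> * of_real \<mu> * integral {0..t} (\<lambda>s. schroedinger_group (t - s) (cubic (fser (modes r x s))) z)"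
    by (rule mild_equation[OF v, symmetric]) (use t in \<open>auto simp: modes_def intro: continuous_on_subset[OF xc]\<close>)
  finally show "fser (modes r x t) z = schroedinger_group t v z
      - \<i> * of_real \<mu> * integral {0..t} (\<lambda>s. schroedinger_group (t - s) (cubic (fser (modes r x s))) z)" .
qed

text \<open>Transfers uniqueness from trajectories to all mild solutions, as the definite
  description in \<open>nls_propagator\<close> demands.\<close>

lemma trajectory_of_mild:
  assumes v: "v \<in> sobolev r" and u: "nls_mild_solution \<mu> r T v u"
  obtains y where "trajectory r \<mu> T (emb r (fourier_coeff v)) y" "\<And>t. t \<in> {0..T} \<Longrightarrow> u t = fser (modes r y t)"
proof -
  define b where "b t = emb r (fourier_coeff (u t))" for t
  define y where "y t = free_group (- t) (b t)" for t
  have us: "u t \<in> sobolev r" if "t \<in> {0..T}" for t using u that by (simp add: nls_mild_solution_def)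
  have ub: "u t = fser (unemb r (b t))" if "t \<in> {0..T}" for t
    unfolding b_def by (rule emb_fourier[OF us[OF that]])
  have uy: "u t = fser (unemb r (free_group t (y t)))" if "t \<in> {0..T}" for t
    using ub[OF that] by (simp add: y_def free_group_comp)
  have "continuous_on {0..T} b"
    unfolding continuous_on_def
  proof (intro ballI)
    fix t assume t: "t \<in> {0..T}"
    have "((\<lambda>s. sobolev_norm r (u s - u t)) \<longlongrightarrow> 0) (at t within {0..T})"
      using u t by (simp add: nls_mild_solution_def)
    moreover have "\<forall>\<^sub>F s in at t within {0..T}. sobolev_norm r (u s - u t) = norm (b s - b t)"
      unfolding eventually_at_filter
      by (rule always_eventually) (use t in \<open>auto simp: ub sobolev_norm_diff(1)\<close>)
    ultimately have "((\<lambda>s. norm (b s - b t)) \<longlongrightarrow> 0) (at t within {0..T})"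
      by (rule Lim_transform_eventually)
    then show "(b \<longlongrightarrow> b t) (at t within {0..T})" by (simp add: tendsto_norm_zero_iff LIM_zero_iff)
  qed
  then have yc: "continuous_on {0..T} y"
    unfolding y_def by (intro continuous_on_free_group continuous_intros)
  have "y t = emb r (fourier_coeff v) + integral {0..t} (\<lambda>s. cubic_op r (phase_mult \<mu> s) (y s))" if t: "t \<in> {0..T}" for t
  proof -
    have "fser (unemb r (free_group t (y t))) z
      = fser (unemb r (free_group t (emb r (fourier_coeff v) + integral {0..t} (\<lambda>s. cubic_op r (phase_mult \<mu> s) (y s))))) z" for z
    proof -
      have "fser (unemb r (free_group t (y t))) z = schroedinger_group t v z
        - \<i> * of_real \<mu> * integral {0..t} (\<lambda>s. schroedinger_group (t - s) (cubic (u s)) z)"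
        using u t unfolding uy[OF t, symmetric] nls_mild_solution_def by blast
      also have "\<dots> = fser (unemb r (free_group t (emb r (fourier_coeff v) + integral {0..t} (\<lambda>s. cubic_op r (phase_mult \<mu> s) (y s))))) z"
        by (rule mild_equation[OF v]) (use t uy in \<open>auto intro: continuous_on_subset[OF yc]\<close>)
      finally show ?thesis .
    qed
    then have "free_group t (y t) = free_group t (emb r (fourier_coeff v) + integral {0..t} (\<lambda>s. cubic_op r (phase_mult \<mu> s) (y s)))"
      by (rule fser_unemb_inject)
    then have "free_group (- t) (free_group t (y t))
      = free_group (- t) (free_group t (emb r (fourier_coeff v) + integral {0..t} (\<lambda>s. cubic_op r (phase_mult \<mu> s) (y s))))" by simp
    then show ?thesis by (simp add: free_group_comp)
  qed
  with yc have "trajectory r \<mu> T (emb r (fourier_coeff v)) y" by (simp add: trajectory_def)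
  then show thesis using uy by (intro that) (auto simp: modes_def)
qed

lemma nls_propagator_eq:
  assumes v: "v \<in> sobolev r" and T: "0 \<le> T" "T \<le> 1" and x: "trajectory r \<mu> T (emb r (fourier_coeff v)) x"
  shows "nls_propagator \<mu> r T v = fser (modes r x T)"
  unfolding nls_propagator_def
proof (rule the_equality)
  show "\<exists>u. nls_mild_solution \<mu> r T v u \<and> u T = fser (modes r x T)"
    using mild_of_trajectory[OF v x] by blast
  fix w assume "\<exists>u. nls_mild_solution \<mu> r T v u \<and> u T = w"
  then obtain u where u: "nls_mild_solution \<mu> r T v u" "u T = w" by blast
  obtain y where y: "trajectory r \<mu> T (emb r (fourier_coeff v)) y" "\<And>t. t \<in> {0..T} \<Longrightarrow> u t = fser (modes r y t)"
    using trajectory_of_mild[OF v u(1)] by blast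
  have "y T = x T" by (rule trajectory_unique[OF r y(1) x T(2)]) (use T in auto)
  then show "w = fser (modes r x T)" using y(2)[of T] u(2) T by (simp add: modes_def)
qed

end

section \<open>The filtered scheme in Fourier variables\<close>

lemma norm_exp_i_diff_le: "cmod (exp (\<i> * of_real x) - exp (\<i> * of_real y)) \<le> \<bar>x - y\<bar>"
proof -
  have "exp (\<i> * of_real x) - exp (\<i> * of_real y) = exp (\<i> * of_real y) * (exp (\<i> * of_real (x - y)) - 1)"
    by (simp add: algebra_simps flip: exp_add)
  then have "cmod (exp (\<i> * of_real x) - exp (\<i> * of_real y)) = 2 * \<bar>sin ((x - y) / 2)\<bar>"
    by (simp only: norm_mult norm_exp_i_times dist_exp_i_1 mult_1_left)
  also have "\<dots> \<le> 2 * \<bar>(x - y) / 2\<bar>" by (intro mult_left_mono abs_sin_x_le_abs_x) simp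
  finally show ?thesis by simp
qed

definition osc :: "real \<Rightarrow> real \<Rightarrow> complex"
  where "osc \<tau> \<theta> = integral {0..\<tau>} (\<lambda>s. exp (\<i> * of_real (s * \<theta>)))"

lemma osc_integrable: "(\<lambda>s. exp (\<i> * of_real (s * \<theta>))) integrable_on {a..b}"
  by (intro integrable_continuous_real continuous_intros)

lemma norm_osc_le:
  assumes "0 \<le> \<tau>"
  shows "cmod (osc \<tau> \<theta>) \<le> \<tau>"
proof -
  have "cmod (osc \<tau> \<theta>) \<le> integral {0..\<tau>} (\<lambda>s. 1 :: real)"
    unfolding osc_def by (rule integral_norm_bound_integral[OF osc_integrable]) (auto simp: norm_exp_i_times)
  then show ?thesis using assms by simp
qed

text \<open>The price of replacing one phase by another: one \<open>\<tau>\<close> comes from the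
  length of the interval, the other from \<open>s \<le> \<tau>\<close>.\<close>

lemma osc_diff_le:
  assumes "0 \<le> \<tau>"
  shows "cmod (osc \<tau> \<theta> - osc \<tau> \<eta>) \<le> \<tau>\<^sup>2 * \<bar>\<theta> - \<eta>\<bar>"
proof -
  have "cmod (integral {0..\<tau>} (\<lambda>s. exp (\<i> * of_real (s * \<theta>)) - exp (\<i> * of_real (s * \<eta>))))
      \<le> integral {0..\<tau>} (\<lambda>s. \<tau> * \<bar>\<theta> - \<eta>\<bar>)"
  proof (intro integral_norm_bound_integral integrable_diff osc_integrable)
    fix s assume s: "s \<in> {0..\<tau>}"
    have "cmod (exp (\<i> * of_real (s * \<theta>)) - exp (\<i> * of_real (s * \<eta>))) \<le> \<bar>s * \<theta> - s * \<eta>\<bar>"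
      by (rule norm_exp_i_diff_le)
    also have "\<dots> = s * \<bar>\<theta> - \<eta>\<bar>" using s by (simp add: abs_mult flip: right_diff_distrib)
    also have "\<dots> \<le> \<tau> * \<bar>\<theta> - \<eta>\<bar>" using s by (intro mult_right_mono) auto
    finally show "cmod (exp (\<i> * of_real (s * \<theta>)) - exp (\<i> * of_real (s * \<eta>))) \<le> \<tau> * \<bar>\<theta> - \<eta>\<bar>" .
  qed auto
  then show ?thesis
    using assms unfolding osc_def
    by (subst (asm) integral_diff[OF osc_integrable osc_integrable]) (simp add: power2_eq_square mult.assoc)
qed

lemma osc_0: "0 \<le> \<tau> \<Longrightarrow> osc \<tau> 0 = of_real \<tau>"
  by (simp add: osc_def scaleR_conv_of_real)

text \<open>Stated without division, so that the resonance \<open>\<theta> = 0\<close> is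
  included.\<close>

lemma osc_mult:
  assumes "0 \<le> \<tau>"
  shows "\<i> * of_real \<theta> * osc \<tau> \<theta> = exp (\<i> * of_real (\<tau> * \<theta>)) - 1"
proof -
  have "((\<lambda>s. \<i> * of_real \<theta> * exp (\<i> * of_real (s * \<theta>))) has_integral
      exp (\<i> * of_real (\<tau> * \<theta>)) - exp (\<i> * of_real (0 * \<theta>))) {0..\<tau>}"
  proof (rule fundamental_theorem_of_calculus[OF assms])
    fix s
    have "((\<lambda>s. exp (\<i> * (s * of_real \<theta>))) has_field_derivative
        \<i> * of_real \<theta> * exp (\<i> * (of_real s * of_real \<theta>))) (at (of_real s))"
      by (auto intro!: derivative_eq_intros)
    from has_vector_derivative_real_field[OF this, of "{0..\<tau>}"]
    show "((\<lambda>s. exp (\<i> * of_real (s * \<theta>))) has_vector_derivative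
        \<i> * of_real \<theta> * exp (\<i> * of_real (s * \<theta>))) (at s within {0..\<tau>})"
      by (simp add: o_def)
  qed
  from integral_unique[OF this] show ?thesis unfolding osc_def by simp
qed

section \<open>The resonant exponential factor\<close>

definition expo_rem :: "real \<Rightarrow> real \<Rightarrow> complex"
  where "expo_rem \<mu> y = exp (- 2 * \<i> * of_real \<mu> * of_real y) - 1 + 2 * \<i> * of_real \<mu> * of_real y"

text \<open>A second-order Taylor remainder: its derivative vanishes at 0 and is at most
  \<open>4 * \<mu>\<^sup>2 * Y\<close> on the segment, so the mean value inequality yields a small
  Lipschitz constant.\<close>

lemma expo_rem_diff_le:
  assumes "\<bar>x\<bar> \<le> Y" "\<bar>y\<bar> \<le> Y"
  shows "cmod (expo_rem \<mu> x - expo_rem \<mu> y) \<le> 4 * \<mu>\<^sup>2 * Y * \<bar>x - y\<bar>"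
proof -
  let ?S = "closed_segment (complex_of_real y) (of_real x)"
  let ?f = "\<lambda>z. exp (- 2 * \<i> * of_real \<mu> * z) - 1 + 2 * \<i> * of_real \<mu> * z"
  let ?f' = "\<lambda>z. - 2 * \<i> * of_real \<mu> * (exp (- 2 * \<i> * of_real \<mu> * z) - 1)"
  have "cmod (?f (of_real x) - ?f (of_real y)) \<le> (4 * \<mu>\<^sup>2 * Y) * cmod (of_real x - of_real y)"
  proof (rule field_differentiable_bound[of ?S])
    fix z assume "z \<in> ?S"
    then obtain u where u: "z = of_real u" "u \<in> closed_segment y x"
      by (auto simp: closed_segment_of_real)
    have uY: "\<bar>u\<bar> \<le> Y" using u(2) assms by (auto simp: closed_segment_eq_real_ivl split: if_splits)
    show "(?f has_field_derivative ?f' z) (at z within ?S)"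
      by (auto intro!: derivative_eq_intros simp: algebra_simps)
    have "cmod (exp (\<i> * of_real (- 2 * \<mu> * u)) - exp (\<i> * of_real 0)) \<le> \<bar>- 2 * \<mu> * u - 0\<bar>"
      by (rule norm_exp_i_diff_le)
    then have "cmod (exp (- 2 * \<i> * of_real \<mu> * z) - 1) \<le> 2 * \<bar>\<mu>\<bar> * \<bar>u\<bar>"
      by (simp add: u(1) abs_mult mult_ac)
    then have "2 * \<bar>\<mu>\<bar> * cmod (exp (- 2 * \<i> * of_real \<mu> * z) - 1) \<le> 2 * \<bar>\<mu>\<bar> * (2 * \<bar>\<mu>\<bar> * \<bar>u\<bar>)"
      by (intro mult_left_mono) auto
    also have "\<dots> = 4 * \<mu>\<^sup>2 * \<bar>u\<bar>" by (simp add: power2_eq_square abs_mult_self_eq)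
    also have "\<dots> \<le> 4 * \<mu>\<^sup>2 * Y" using uY by (intro mult_left_mono) auto
    finally show "cmod (?f' z) \<le> 4 * \<mu>\<^sup>2 * Y" by (simp add: norm_mult)
  qed (auto simp: convex_closed_segment)
  then show ?thesis by (simp add: expo_rem_def flip: of_real_diff)
qed

lemma hseq_product_summable:
  assumes "a \<in> hseq s" "b \<in> hseq s"
  shows "(\<lambda>k. (wt s k * cmod (a k)) * (wt s k * cmod (b k))) summable_on UNIV"
    "(\<Sum>\<^sub>\<infinity>k. (wt s k * cmod (a k)) * (wt s k * cmod (b k))) \<le> hnorm s a * hnorm s b"
proof -
  show s: "(\<lambda>k. (wt s k * cmod (a k)) * (wt s k * cmod (b k))) summable_on UNIV"
    using sum_mult_hnorm[OF assms]
    by (intro nonneg_bdd_above_summable_on) (auto intro!: bdd_aboveI2[where M = "hnorm s a * hnorm s b"])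
  show "(\<Sum>\<^sub>\<infinity>k. (wt s k * cmod (a k)) * (wt s k * cmod (b k))) \<le> hnorm s a * hnorm s b"
    by (rule infsum_le_finite_sums[OF s]) (auto intro: sum_mult_hnorm[OF assms])
qed

text \<open>Quadratic forms diagonal in frequency: weight 1 gives the mass, weight
  \<open>of_int\<close> the momentum up to the factor \<open>- \<i>\<close>.\<close>

definition quad :: "(int \<Rightarrow> real) \<Rightarrow> (int \<Rightarrow> complex) \<Rightarrow> real"
  where "quad q a = (\<Sum>\<^sub>\<infinity>k. q k * (cmod (a k))\<^sup>2)"

lemma quad_summable:
  assumes "a \<in> hseq 1" "\<And>k. \<bar>q k\<bar> \<le> wt 2 k"
  shows "(\<lambda>k. q k * (cmod (a k))\<^sup>2) summable_on UNIV" "\<bar>quad q a\<bar> \<le> (hnorm 1 a)\<^sup>2"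
proof -
  note P = hseq_product_summable[OF assms(1,1)]
  have le: "norm (q k * (cmod (a k))\<^sup>2) \<le> (wt 1 k * cmod (a k)) * (wt 1 k * cmod (a k))" for k
  proof -
    have "\<bar>q k\<bar> * (cmod (a k))\<^sup>2 \<le> wt 2 k * (cmod (a k))\<^sup>2" by (intro mult_right_mono assms) simp
    then show ?thesis using wt_add[of 1 1 k] by (simp add: abs_mult power2_eq_square mult_ac)
  qed
  have "(\<lambda>k. norm (q k * (cmod (a k))\<^sup>2)) summable_on UNIV"
    by (rule summable_on_comparison_test[OF P(1)]) (use le in auto)
  then show s: "(\<lambda>k. q k * (cmod (a k))\<^sup>2) summable_on UNIV" by (rule abs_summable_summable)
  have "norm (quad q a) \<le> (\<Sum>\<^sub>\<infinity>k. (wt 1 k * cmod (a k)) * (wt 1 k * cmod (a k)))"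
    unfolding quad_def by (rule norm_infsum_le[OF has_sum_infsum[OF s] has_sum_infsum[OF P(1)] le])
  then show "\<bar>quad q a\<bar> \<le> (hnorm 1 a)\<^sup>2" using P(2) by (simp add: power2_eq_square)
qed

lemma quad_diff_le:
  assumes a: "a \<in> hseq 1" "hnorm 1 a \<le> R" and b: "b \<in> hseq 1" "hnorm 1 b \<le> R"
    and q: "\<And>k. \<bar>q k\<bar> \<le> wt 2 k"
  shows "\<bar>quad q a - quad q b\<bar> \<le> 2 * R * hnorm 1 (\<lambda>k. a k - b k)"
proof -
  let ?d = "\<lambda>k. a k - b k"
  let ?P = "\<lambda>c k. (wt 1 k * cmod (?d k)) * (wt 1 k * cmod (c k))"
  have d: "?d \<in> hseq 1" by (intro hseq_diff a b)
  note Pa = hseq_product_summable[OF d a(1)] and Pb = hseq_product_summable[OF d b(1)]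
  note sa = quad_summable(1)[OF a(1) q] and sb = quad_summable(1)[OF b(1) q]
  have hs: "((\<lambda>k. q k * (cmod (a k))\<^sup>2 + - (q k * (cmod (b k))\<^sup>2)) has_sum (quad q a + - quad q b)) UNIV"
    unfolding quad_def by (intro has_sum_add has_sum_uminusI has_sum_infsum sa sb)
  have "norm (quad q a + - quad q b) \<le> (\<Sum>\<^sub>\<infinity>k. ?P a k) + (\<Sum>\<^sub>\<infinity>k. ?P b k)"
  proof (rule norm_infsum_le[OF hs has_sum_add[OF has_sum_infsum[OF Pa(1)] has_sum_infsum[OF Pb(1)]]])
    fix k
    have "\<bar>(cmod (a k))\<^sup>2 - (cmod (b k))\<^sup>2\<bar> = \<bar>cmod (a k) - cmod (b k)\<bar> * (cmod (a k) + cmod (b k))"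
      by (simp add: power2_eq_square square_diff_square_factored abs_mult mult.commute)
    also have "\<dots> \<le> cmod (?d k) * (cmod (a k) + cmod (b k))"
      by (intro mult_right_mono norm_triangle_ineq3) auto
    finally have "\<bar>q k\<bar> * \<bar>(cmod (a k))\<^sup>2 - (cmod (b k))\<^sup>2\<bar> \<le> wt 2 k * (cmod (?d k) * (cmod (a k) + cmod (b k)))"
      by (intro mult_mono q) auto
    then show "norm (q k * (cmod (a k))\<^sup>2 + - (q k * (cmod (b k))\<^sup>2)) \<le> ?P a k + ?P b k"
      using wt_add[of 1 1 k] by (simp add: abs_mult[symmetric] algebra_simps)
  qed
  also have "\<dots> \<le> hnorm 1 ?d * R + hnorm 1 ?d * R"
    by (intro add_mono order_trans[OF Pa(2)] order_trans[OF Pb(2)] mult_left_mono a b hnorm_nonneg)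
  finally show ?thesis by simp
qed

text \<open>The eigenvalue \<open>M + P / (i k)\<close>, where \<open>P = - i (\<Sum>j. j |a\<^sub>j|\<^sup>2)\<close>;
  division by zero makes it \<open>M\<close> at \<open>k = 0\<close>.\<close>

definition eigv :: "(int \<Rightarrow> complex) \<Rightarrow> int \<Rightarrow> real"
  where "eigv a k = quad (\<lambda>_. 1) a - quad of_int a / of_int k"

lemma quad_weights: "\<bar>1 :: real\<bar> \<le> wt 2 k" "\<bar>of_int k\<bar> \<le> wt 2 k"
proof -
  show "\<bar>1 :: real\<bar> \<le> wt 2 k" by (simp add: wt_2)
  have "wt 1 k \<le> wt 2 k" by (rule wt_mono) simp
  with abs_le_wt_1[of k] show "\<bar>of_int k\<bar> \<le> wt 2 k" by linarith
qed

lemma abs_divide_int_le: "\<bar>x / real_of_int k\<bar> \<le> \<bar>x\<bar>"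
proof (cases "k = 0")
  case False
  then have "1 \<le> \<bar>real_of_int k\<bar>" by linarith
  then show ?thesis by (simp add: abs_divide divide_le_eq mult_le_cancel_left1)
qed simp

lemma eigv_bound:
  assumes "a \<in> hseq 1" "hnorm 1 a \<le> R"
  shows "\<bar>eigv a k\<bar> \<le> 2 * R\<^sup>2"
proof -
  have "(hnorm 1 a)\<^sup>2 \<le> R\<^sup>2" using assms(2) by (intro power_mono) auto
  then show ?thesis
    using quad_summable(2)[OF assms(1), of "\<lambda>_. 1", OF quad_weights(1)]
      quad_summable(2)[OF assms(1), of of_int, OF quad_weights(2)] abs_divide_int_le[of "quad of_int a" k]
    unfolding eigv_def by linarith
qed

lemma eigv_diff_le:
  assumes "a \<in> hseq 1" "hnorm 1 a \<le> R" "b \<in> hseq 1" "hnorm 1 b \<le> R"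
  shows "\<bar>eigv a k - eigv b k\<bar> \<le> 4 * R * hnorm 1 (\<lambda>k. a k - b k)"
proof -
  have "eigv a k - eigv b k = (quad (\<lambda>_. 1) a - quad (\<lambda>_. 1) b) - (quad of_int a - quad of_int b) / of_int k"
    by (simp add: eigv_def diff_divide_distrib)
  then show ?thesis
    using quad_diff_le[OF assms, of "\<lambda>_. 1", OF quad_weights(1)] quad_diff_le[OF assms, of of_int, OF quad_weights(2)]
      abs_divide_int_le[of "quad of_int a - quad of_int b" k] by linarith
qed

definition res_rem :: "real \<Rightarrow> real \<Rightarrow> (int \<Rightarrow> complex) \<Rightarrow> int \<Rightarrow> complex"
  where "res_rem \<mu> \<tau> a k = expo_rem \<mu> (\<tau> * eigv a k) * a k"

text \<open>\<open>expo_rem\<close> is quadratic in \<open>\<tau> * eigv\<close>, and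
  \<open>eigv\<close> is bounded on \<open>H^1\<close> balls: this gives the square of
  \<open>\<tau>\<close> without loss of derivatives. With \<open>Y = 2 \<tau> R^2\<close> the
  product rule contributes \<open>16 R^4\<close> from the difference of the sequences and
  \<open>32 R^3\<close> times \<open>R\<close> from that of the eigenvalues, together 48.\<close>

lemma res_rem_lipschitz:
  assumes r: "1 \<le> r" and a: "a \<in> hseq r" "hnorm r a \<le> R" and b: "b \<in> hseq r" "hnorm r b \<le> R" and \<tau>: "0 \<le> \<tau>"
  shows "res_rem \<mu> \<tau> a \<in> hseq r"
    "hnorm r (\<lambda>k. res_rem \<mu> \<tau> a k - res_rem \<mu> \<tau> b k) \<le> 48 * \<mu>\<^sup>2 * R ^ 4 * \<tau>\<^sup>2 * hnorm r (\<lambda>k. a k - b k)"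
proof -
  let ?d = "\<lambda>k. a k - b k"
  have R: "0 \<le> R" using a(2) hnorm_nonneg order_trans by blast
  have d: "?d \<in> hseq r" by (intro hseq_diff a b)
  have a1: "a \<in> hseq 1" "hnorm 1 a \<le> R" and b1: "b \<in> hseq 1" "hnorm 1 b \<le> R"
    and d1: "hnorm 1 ?d \<le> hnorm r ?d"
    using hseq_weaken[OF a(1) r] hseq_weaken[OF b(1) r] hseq_weaken[OF d r] a(2) b(2) by auto
  let ?Y = "\<tau> * (2 * R\<^sup>2)"
  have Y: "\<bar>\<tau> * eigv a k\<bar> \<le> ?Y" "\<bar>\<tau> * eigv b k\<bar> \<le> ?Y" "0 \<le> ?Y" for k
    using \<tau> by (auto simp: abs_mult intro!: mult_left_mono eigv_bound a1 b1)
  have psi: "cmod (expo_rem \<mu> (\<tau> * eigv a k)) \<le> 16 * \<mu>\<^sup>2 * R ^ 4 * \<tau>\<^sup>2" for k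
  proof -
    have "cmod (expo_rem \<mu> (\<tau> * eigv a k) - expo_rem \<mu> 0) \<le> 4 * \<mu>\<^sup>2 * ?Y * \<bar>\<tau> * eigv a k - 0\<bar>"
      using Y by (intro expo_rem_diff_le) auto
    also have "\<dots> \<le> 4 * \<mu>\<^sup>2 * ?Y * ?Y"
      using Y by (intro mult_left_mono) auto
    finally show ?thesis by (simp add: expo_rem_def power2_eq_square power4_eq_xxxx mult_ac)
  qed

  have dpsi: "cmod (expo_rem \<mu> (\<tau> * eigv a k) - expo_rem \<mu> (\<tau> * eigv b k))
      \<le> 32 * \<mu>\<^sup>2 * R ^ 3 * \<tau>\<^sup>2 * hnorm r ?d" for k
  proof -
    have "cmod (expo_rem \<mu> (\<tau> * eigv a k) - expo_rem \<mu> (\<tau> * eigv b k)) \<le> 4 * \<mu>\<^sup>2 * ?Y * \<bar>\<tau> * eigv a k - \<tau> * eigv b k\<bar>"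
      by (intro expo_rem_diff_le Y)
    also have "\<bar>\<tau> * eigv a k - \<tau> * eigv b k\<bar> = \<tau> * \<bar>eigv a k - eigv b k\<bar>"
      using \<tau> by (simp add: abs_mult flip: right_diff_distrib)
    also have "4 * \<mu>\<^sup>2 * ?Y * (\<tau> * \<bar>eigv a k - eigv b k\<bar>) \<le> 4 * \<mu>\<^sup>2 * ?Y * (\<tau> * (4 * R * hnorm r ?d))"
      using eigv_diff_le[OF a1 b1, of k] mult_left_mono[OF d1, of "4 * R"] R \<tau> Y(3)
      by (intro mult_left_mono) auto
    finally show ?thesis by (simp add: power2_eq_square power3_eq_cube mult_ac)
  qed
  let ?x = "\<lambda>k. expo_rem \<mu> (\<tau> * eigv a k) * ?d k"
  let ?y = "\<lambda>k. (expo_rem \<mu> (\<tau> * eigv a k) - expo_rem \<mu> (\<tau> * eigv b k)) * b k"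
  have mult: "(\<lambda>k. m k * c k) \<in> hseq r \<and> hnorm r (\<lambda>k. m k * c k) \<le> C * hnorm r c"
    if c: "c \<in> hseq r" and m: "\<And>k. cmod (m k) \<le> C" for m c C
  proof -
    have "0 \<le> C" using m[of 0] norm_ge_zero order_trans by blast
    moreover have "wt r k * cmod (m k * c k) \<le> C * (wt r k * cmod (c k))" for k
      using mult_right_mono[OF m[of k], of "wt r k * cmod (c k)"] by (simp add: norm_mult mult_ac)
    ultimately show ?thesis using hseq_mono[OF c, of r "\<lambda>k. m k * c k" C] by blast
  qed
  show "res_rem \<mu> \<tau> a \<in> hseq r"
    using mult[OF a(1) psi] by (simp add: res_rem_def[abs_def])
  have x: "?x \<in> hseq r" "hnorm r ?x \<le> 16 * \<mu>\<^sup>2 * R ^ 4 * \<tau>\<^sup>2 * hnorm r ?d"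
    using mult[OF d psi] by auto
  have y: "?y \<in> hseq r" "hnorm r ?y \<le> 32 * \<mu>\<^sup>2 * R ^ 3 * \<tau>\<^sup>2 * hnorm r ?d * hnorm r b"
    using mult[OF b(1) dpsi] by auto
  have "(\<lambda>k. res_rem \<mu> \<tau> a k - res_rem \<mu> \<tau> b k) = (\<lambda>k. ?x k + ?y k)"
    by (rule ext) (simp add: res_rem_def algebra_simps)
  then have "hnorm r (\<lambda>k. res_rem \<mu> \<tau> a k - res_rem \<mu> \<tau> b k) \<le> hnorm r ?x + hnorm r ?y"
    using hnorm_triangle[OF x(1) y(1)] by simp
  also have "\<dots> \<le> 16 * \<mu>\<^sup>2 * R ^ 4 * \<tau>\<^sup>2 * hnorm r ?d + 32 * \<mu>\<^sup>2 * R ^ 3 * \<tau>\<^sup>2 * hnorm r ?d * R"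
    using b(2) R by (intro add_mono x order_trans[OF y(2)] mult_left_mono) auto
  finally show "hnorm r (\<lambda>k. res_rem \<mu> \<tau> a k - res_rem \<mu> \<tau> b k) \<le> 48 * \<mu>\<^sup>2 * R ^ 4 * \<tau>\<^sup>2 * hnorm r ?d"
    by (simp add: power4_eq_xxxx power3_eq_cube algebra_simps)
qed

section \<open>The trilinear remainder\<close>

abbreviation res_phase :: "int \<Rightarrow> int \<Rightarrow> int \<Rightarrow> real"
  where "res_phase k i j \<equiv> of_int (2 * (k - i) * (k - j))"

text \<open>Multiplier of the scheme minus that of the exact phase integral. At
  \<open>k = 0\<close>, where a weight \<open>l / k\<close> makes no sense, the scheme freezes the
  phase at 0 instead.\<close>

definition rem_mult :: "real \<Rightarrow> real \<Rightarrow> int \<Rightarrow> int \<Rightarrow> int \<Rightarrow> complex"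
  where "rem_mult \<mu> \<tau> k i j = - \<i> * of_real \<mu> *
    (if k = 0 then osc \<tau> 0 - osc \<tau> (res_phase k i j)
     else of_int (i + j - k) / of_int k * (osc \<tau> (of_int (- 2 * k * (i + j - k))) - osc \<tau> (res_phase k i j)))"

text \<open>For \<open>k\<close> not 0 the phases differ by \<open>2 i j\<close>, the third bracket
  comes from \<open>l\<close>, and since \<open>wt 1 k\<close> is at most \<open>2 |k|\<close> the
  factor \<open>1 / k\<close> pays for the output weight; \<open>4 = 2 * 2\<close>. At
  \<open>k = 0\<close> the true phase is \<open>2 i j\<close> itself and the output weight is 1,
  which leaves a factor 2 to spare.\<close>

lemma admissible_rem_mult:
  assumes \<tau>: "0 \<le> \<tau>"
  shows "admissible (4 * \<bar>\<mu>\<bar> * \<tau>\<^sup>2) (rem_mult \<mu> \<tau>)"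
  unfolding admissible_def
proof (intro conjI allI)
  show "0 \<le> 4 * \<bar>\<mu>\<bar> * \<tau>\<^sup>2" by simp
  fix k i j :: int
  let ?l = "i + j - k"
  let ?W = "wt 1 i * wt 1 ?l * wt 1 j"
  show "cmod (rem_mult \<mu> \<tau> k i j) * wt 1 k \<le> 4 * \<bar>\<mu>\<bar> * \<tau>\<^sup>2 * ?W"
  proof (cases "k = 0")
    case True
    have "\<bar>real_of_int i\<bar> * 1 * \<bar>of_int j\<bar> \<le> ?W"
      by (intro mult_mono abs_le_wt_1 wt_ge1 mult_nonneg_nonneg) auto
    moreover have "cmod (osc \<tau> 0 - osc \<tau> (res_phase k i j)) \<le> \<tau>\<^sup>2 * (2 * (\<bar>of_int i\<bar> * \<bar>of_int j\<bar>))"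
      using osc_diff_le[OF \<tau>, of 0 "res_phase k i j"] True by (simp add: abs_mult)
    ultimately have "cmod (osc \<tau> 0 - osc \<tau> (res_phase k i j)) \<le> \<tau>\<^sup>2 * (2 * ?W)"
      by (smt (verit) mult_left_mono zero_le_power2)
    also have "\<dots> \<le> \<tau>\<^sup>2 * (4 * ?W)" by (intro mult_left_mono mult_right_mono) auto
    finally have "\<bar>\<mu>\<bar> * cmod (osc \<tau> 0 - osc \<tau> (res_phase k i j)) \<le> \<bar>\<mu>\<bar> * (\<tau>\<^sup>2 * (4 * ?W))"
      by (rule mult_left_mono) simp
    then show ?thesis using True wt_1[of 0] by (simp add: rem_mult_def norm_mult mult_ac)
  next
    case False
    then have k1: "1 \<le> \<bar>real_of_int k\<bar>" by linarith
    have "wt 1 k \<le> 2 * \<bar>of_int k\<bar>"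
      unfolding wt_1 using one_le_power[OF k1, of 2] by (intro real_le_lsqrt) (auto simp: power_mult_distrib)
    then have wk: "wt 1 k / \<bar>of_int k\<bar> \<le> 2" using k1 by (simp add: field_simps)
    have "res_phase k i j - of_int (- 2 * k * ?l) = 2 * (of_int i * of_int j)"
      by (simp add: algebra_simps)
    then have "cmod (osc \<tau> (of_int (- 2 * k * ?l)) - osc \<tau> (res_phase k i j)) \<le> \<tau>\<^sup>2 * (2 * (\<bar>of_int i\<bar> * \<bar>of_int j\<bar>))"
      using osc_diff_le[OF \<tau>, of "res_phase k i j" "of_int (- 2 * k * ?l)"]
      by (simp add: abs_mult norm_minus_commute)
    also have "\<dots> \<le> \<tau>\<^sup>2 * (2 * (wt 1 i * wt 1 j))"
      by (intro mult_left_mono mult_mono abs_le_wt_1) auto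
    finally have "\<bar>of_int ?l\<bar> * (wt 1 k / \<bar>of_int k\<bar>) * cmod (osc \<tau> (of_int (- 2 * k * ?l)) - osc \<tau> (res_phase k i j))
        \<le> wt 1 ?l * 2 * (\<tau>\<^sup>2 * (2 * (wt 1 i * wt 1 j)))"
      by (intro mult_mono wk abs_le_wt_1) auto
    then have "\<bar>\<mu>\<bar> * (\<bar>of_int ?l\<bar> * (wt 1 k / \<bar>of_int k\<bar>) * cmod (osc \<tau> (of_int (- 2 * k * ?l)) - osc \<tau> (res_phase k i j)))
        \<le> \<bar>\<mu>\<bar> * (wt 1 ?l * 2 * (\<tau>\<^sup>2 * (2 * (wt 1 i * wt 1 j))))"
      by (rule mult_left_mono) simp
    then show ?thesis using False
      by (simp add: rem_mult_def norm_mult norm_divide mult_ac del: of_int_add of_int_diff of_int_mult)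
  qed
qed

section \<open>Rules for combining multipliers\<close>

lemma tri_add_mult:
  assumes "tri_summable m a b c k" "tri_summable m' a b c k"
  shows "tri_summable (\<lambda>k i j. m k i j + m' k i j) a b c k"
    "tri (\<lambda>k i j. m k i j + m' k i j) a b c k = tri m a b c k + tri m' a b c k"
proof -
  have eq: "(\<lambda>(i, j). (m k i j + m' k i j) * (a i * cnj (b (i + j - k)) * c j))
    = (\<lambda>p. (case p of (i, j) \<Rightarrow> m k i j * (a i * cnj (b (i + j - k)) * c j))
       + (case p of (i, j) \<Rightarrow> m' k i j * (a i * cnj (b (i + j - k)) * c j)))"
    by (rule ext) (auto simp: algebra_simps)
  show "tri_summable (\<lambda>k i j. m k i j + m' k i j) a b c k"
    using assms unfolding tri_summable_def eq by (rule summable_on_add)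
  show "tri (\<lambda>k i j. m k i j + m' k i j) a b c k = tri m a b c k + tri m' a b c k"
    using assms unfolding tri_def tri_summable_def eq by (rule infsum_add)
qed

lemma tri_cmult_mult:
  shows "tri_summable m a b c k \<Longrightarrow> tri_summable (\<lambda>k i j. z k * m k i j) a b c k"
    "tri (\<lambda>k i j. z k * m k i j) a b c k = z k * tri m a b c k"
proof -
  have eq: "(\<lambda>(i, j). z k * m k i j * (a i * cnj (b (i + j - k)) * c j))
    = (\<lambda>p. z k * (case p of (i, j) \<Rightarrow> m k i j * (a i * cnj (b (i + j - k)) * c j)))"
    by (rule ext) (auto simp: algebra_simps)
  show "tri_summable m a b c k \<Longrightarrow> tri_summable (\<lambda>k i j. z k * m k i j) a b c k"
    unfolding tri_summable_def eq by (rule summable_on_cmult_right)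
  show "tri (\<lambda>k i j. z k * m k i j) a b c k = z k * tri m a b c k"
    unfolding tri_def eq by (rule infsum_cmult_right')
qed

lemma tri_cong:
  assumes "\<And>i j. m k i j = m' k i j"
  shows "tri m a b c k = tri m' a b c k" "tri_summable m a b c k = tri_summable m' a b c k"
  by (simp_all add: tri_def tri_summable_def assms)

lemma tri_swap: "tri m a b a k = tri (\<lambda>k i j. m k j i) a b a k"
  unfolding tri_def
  by (rule infsum_reindex_bij_witness[of _ prod.swap prod.swap]) (auto simp: add.commute mult_ac)

lemma tri_phase_mult:
  assumes e: "\<And>k. e k = phase t k"
  shows "tri m (\<lambda>k. e k * a k) (\<lambda>k. e k * b k) (\<lambda>k. e k * c k) k
    = e k * tri (\<lambda>k i j. m k i j * exp (\<i> * of_real (t * res_phase k i j))) a b c k"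
proof -
  have *: "m k i j * ((e i * a i) * cnj (e (i + j - k) * b (i + j - k)) * (e j * c j))
      = e k * (m k i j * exp (\<i> * of_real (t * res_phase k i j)) * (a i * cnj (b (i + j - k)) * c j))" for i j
  proof -
    have "e i * cnj (e (i + j - k)) * e j = e k * exp (\<i> * of_real (t * res_phase k i j))"
      unfolding e by (rule phase_factor)
    then have "m k i j * ((e i * cnj (e (i + j - k)) * e j) * (a i * cnj (b (i + j - k)) * c j))
      = m k i j * ((e k * exp (\<i> * of_real (t * res_phase k i j))) * (a i * cnj (b (i + j - k)) * c j))" by simp
    then show ?thesis by (simp only: complex_cnj_mult mult_ac)
  qed
  show ?thesis
    unfolding tri_def infsum_cmult_right'[symmetric] by (rule infsum_cong) (simp only: case_prod_unfold *)
qed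

lemma norm_dinv_symbol: "cmod (dinv_symbol k) \<le> 1"
  using abs_divide_int_le[of 1 k] by (simp add: dinv_symbol_def norm_divide norm_mult)

lemma dinv_symbol_0 [simp]: "dinv_symbol 0 = 0"
  by (simp add: dinv_symbol_def)

text \<open>The filtered terms of \<open>Phi_c2\<close> with the outer free group factored out; each
  exponential minus 1 pairs a term at time \<open>\<tau>\<close> with its counterpart at time
  0.\<close>

definition filt_mult :: "real \<Rightarrow> real \<Rightarrow> int \<Rightarrow> int \<Rightarrow> int \<Rightarrow> complex"
  where "filt_mult \<mu> \<tau> k i j =
    - of_real \<mu> / 2 * (dinv_symbol k)\<^sup>2 * (exp (\<i> * of_real (\<tau> * of_int (- 2 * k * (i + j - k)))) - 1)
    + of_real \<mu> * dinv_symbol k * dinv_symbol (k - j) * (exp (\<i> * of_real (\<tau> * res_phase k i j)) - 1)"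

definition duh_mult :: "real \<Rightarrow> real \<Rightarrow> int \<Rightarrow> int \<Rightarrow> int \<Rightarrow> complex"
  where "duh_mult \<mu> \<tau> k i j = - \<i> * of_real \<mu> * osc \<tau> (res_phase k i j)"

lemma wt_prod_ge: "1 \<le> wt 1 i * wt 1 l * wt 1 j" "\<bar>of_int l\<bar> \<le> wt 1 i * wt 1 l * wt 1 j"
  "wt 1 i \<le> wt 1 i * wt 1 l * wt 1 j" "wt 1 j \<le> wt 1 i * wt 1 l * wt 1 j"
proof -
  have ge: "1 \<le> wt 1 n" for n by (rule wt_ge1) simp
  have p: "1 \<le> x * y" if "1 \<le> x" "1 \<le> y" for x y :: real
    using mult_mono[OF that] that by simp
  show "1 \<le> wt 1 i * wt 1 l * wt 1 j" by (intro p ge)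
  have "wt 1 l * 1 \<le> wt 1 l * (wt 1 i * wt 1 j)" by (intro mult_left_mono p ge) simp
  then have "wt 1 l \<le> wt 1 i * wt 1 l * wt 1 j" by (simp only: mult_1_right mult_ac)
  with abs_le_wt_1[of l] show "\<bar>of_int l\<bar> \<le> wt 1 i * wt 1 l * wt 1 j" by linarith
  have "wt 1 i * 1 \<le> wt 1 i * (wt 1 l * wt 1 j)" by (intro mult_left_mono p ge) simp
  then show "wt 1 i \<le> wt 1 i * wt 1 l * wt 1 j" by (simp add: mult_ac)
  have "wt 1 j * 1 \<le> wt 1 j * (wt 1 i * wt 1 l)" by (intro mult_left_mono p ge) simp
  then show "wt 1 j \<le> wt 1 i * wt 1 l * wt 1 j" by (simp add: mult_ac)
qed

context
  fixes r :: real
  assumes r: "r > 3 / 2"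
begin

text \<open>Some pieces into which \<open>filt_mult\<close> is decomposed below are bounded only
  with constants growing in \<open>k\<close>. Summability at each single \<open>k\<close> is what
  rearranging the sums requires.\<close>

lemma tri_summable_at:
  assumes h: "a \<in> hseq r" "b \<in> hseq r" "c \<in> hseq r"
    and m: "\<And>i j. cmod (m k i j) \<le> D * (wt 1 i * wt 1 (i + j - k) * wt 1 j)"
  shows "tri_summable m a b c k"
proof -
  define W where "W f k = of_real (wt 1 k) * f k" for f :: "int \<Rightarrow> complex" and k
  have W [simp]: "cmod (W f k) = wt 1 k * cmod (f k)" for f k by (simp add: W_def norm_mult)
  have l: "l1seq (W f)" if "f \<in> hseq r" for f
    using hseq_wt(1)[of f "r - 1" 1] that r by (intro hseq_l1(1)[of "r - 1"]) (simp_all add: W_def[abs_def])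
  show ?thesis
  proof (rule tri_bound(1)[OF l[OF h(1)] l[OF h(2)] l[OF h(3)]])
    fix i j
    have "cmod (m k i j) * cmod (a i * cnj (b (i + j - k)) * c j)
      \<le> D * (wt 1 i * wt 1 (i + j - k) * wt 1 j) * cmod (a i * cnj (b (i + j - k)) * c j)"
      by (intro mult_right_mono m) simp
    then show "cmod (m k i j * (a i * cnj (b (i + j - k)) * c j))
      \<le> D * (cmod (W a i) * cmod (W b (i + j - k)) * cmod (W c j))"
      by (simp add: norm_mult mult_ac)
  qed
qed

lemma l1seq_derivative:
  assumes "a \<in> hseq r"
  shows "l1seq (\<lambda>k. \<i> * of_int k * a k)"
proof -
  have "(\<lambda>k. of_real (wt 1 k) * a k) \<in> hseq (r - 1)"
    using hseq_wt(1)[of a "r - 1" 1] assms by simp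
  then have "l1seq (\<lambda>k. of_real (wt 1 k) * a k)"
    using r by (intro hseq_l1(1)[of "r - 1"]) auto
  then show ?thesis
    by (rule summable_on_comparison_test) (auto simp: norm_mult intro!: mult_right_mono abs_le_wt_1)
qed

lemma mass_fser:
  assumes a: "a \<in> hseq r"
  shows "mass (fser a) = of_real (quad (\<lambda>_. 1) a)"
proof -
  have a1: "a \<in> hseq 1" using hseq_weaken(1)[OF a, of 1] r by simp
  have l: "l1seq a" using hseq_l1(1)[OF _ a] r by simp
  have "mass (fser a) = (\<Sum>\<^sub>\<infinity>k. a k * cnj (a k))"
    unfolding mass_def abs_sq_def complex_norm_square by (rule mean0_mult_cnj[OF l l])
  moreover have "((\<lambda>k. complex_of_real (1 * (cmod (a k))\<^sup>2)) has_sum of_real (quad (\<lambda>_. 1) a)) UNIV"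
    unfolding quad_def
    by (rule has_sum_of_real[OF has_sum_infsum[OF quad_summable(1)[OF a1 quad_weights(1)]]])
  then have "((\<lambda>k. a k * cnj (a k)) has_sum of_real (quad (\<lambda>_. 1) a)) UNIV"
    by (simp only: complex_norm_square mult_1_left)
  ultimately show ?thesis by (simp add: infsumI)
qed

lemma momentum_fser:
  assumes a: "a \<in> hseq r"
  shows "momentum (fser a) = - \<i> * of_real (quad of_int a)"
proof -
  have a1: "a \<in> hseq 1" using hseq_weaken(1)[OF a, of 1] r by simp
  have l: "l1seq a" using hseq_l1(1)[OF _ a] r by simp
  note l' = l1seq_derivative[OF a]
  have "vector_derivative (\<lambda>y. cnj (fser a y)) (at x) = cnj (fser (\<lambda>k. \<i> * of_int k * a k) x)" for x
    by (intro vector_derivative_at bounded_linear.has_vector_derivative[OF bounded_linear_cnj]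
        fser_has_vector_derivative l l')
  then have "momentum (fser a) = (\<Sum>\<^sub>\<infinity>k. a k * cnj (\<i> * of_int k * a k))"
    unfolding momentum_def by (simp only: mean0_mult_cnj[OF l l'])
  moreover have "((\<lambda>k. - \<i> * complex_of_real (of_int k * (cmod (a k))\<^sup>2)) has_sum - \<i> * of_real (quad of_int a)) UNIV"
    unfolding quad_def
    by (intro has_sum_cmult_right has_sum_of_real has_sum_infsum quad_summable(1)[OF a1 quad_weights(2)])
  then have "((\<lambda>k. a k * cnj (\<i> * of_int k * a k)) has_sum - \<i> * of_real (quad of_int a)) UNIV"
    unfolding of_real_mult complex_norm_square by (simp add: mult_ac)
  ultimately show ?thesis by (simp add: infsumI)
qed

lemma mass_momentum_eigv:
  assumes "a \<in> hseq r"
  shows "mass (fser a) + momentum (fser a) * dinv_symbol k = of_real (eigv a k)"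
  by (simp add: mass_fser momentum_fser assms eigv_def dinv_symbol_def)

text \<open>On the diagonal \<open>j = k\<close> one has \<open>l = i\<close>, so the double sum
  collapses to that of \<open>(k - i) / k * |a_i|^2\<close>, whose two parts are the two forms in
  \<open>eigv\<close>.\<close>

lemma resonant_sum:
  assumes a: "a \<in> hseq r" and k: "k \<noteq> 0"
  shows "tri (\<lambda>k i j. if j = k then z * of_int (k - i) / of_int k else 0) a a a k = z * of_real (eigv a k) * a k"
proof -
  have a1: "a \<in> hseq 1" using hseq_weaken(1)[OF a, of 1] r by simp
  let ?f = "\<lambda>(i, j). (if j = k then z * of_int (k - i) / of_int k else 0) * (a i * cnj (a (i + j - k)) * a j)"
  have "tri (\<lambda>k i j. if j = k then z * of_int (k - i) / of_int k else 0) a a a k = infsum ?f (range (\<lambda>i. (i, k)))"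
    unfolding tri_def by (rule infsum_cong_neutral) auto
  also have "\<dots> = (\<Sum>\<^sub>\<infinity>i. z * of_int (k - i) / of_int k * (a i * cnj (a i) * a k))"
    by (subst infsum_reindex) (auto simp: inj_on_def o_def)
  also have "\<dots> = z * of_real (eigv a k) * a k"
  proof (rule infsumI)
    have "((\<lambda>i. 1 * (cmod (a i))\<^sup>2 + - (of_int i * (cmod (a i))\<^sup>2 * (1 / of_int k))) has_sum
        (quad (\<lambda>_. 1) a + - (quad of_int a * (1 / of_int k)))) UNIV"
      unfolding quad_def
      by (intro has_sum_add has_sum_uminusI has_sum_cmult_left has_sum_infsum
          quad_summable(1)[OF a1 quad_weights(1)] quad_summable(1)[OF a1 quad_weights(2)])
    then have "((\<lambda>i. z * of_real (1 * (cmod (a i))\<^sup>2 + - (of_int i * (cmod (a i))\<^sup>2 * (1 / of_int k))) * a k) has_sum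
        z * of_real (quad (\<lambda>_. 1) a + - (quad of_int a * (1 / of_int k))) * a k) UNIV"
      by (intro has_sum_cmult_left has_sum_cmult_right has_sum_of_real)
    moreover have "z * of_real (1 * (cmod (a i))\<^sup>2 + - (of_int i * (cmod (a i))\<^sup>2 * (1 / of_int k))) * a k
       = z * of_int (k - i) / of_int k * (a i * cnj (a i) * a k)" for i
    proof -
      have "1 * (cmod (a i))\<^sup>2 + - (of_int i * (cmod (a i))\<^sup>2 * (1 / of_int k)) = of_int (k - i) / of_int k * (cmod (a i))\<^sup>2"
        using k by (simp add: field_simps)
      then show ?thesis
        by (simp only: of_real_mult complex_norm_square of_real_divide of_real_of_int_eq) (simp add: mult_ac)
    qed
    ultimately show "((\<lambda>i. z * of_int (k - i) / of_int k * (a i * cnj (a i) * a k)) has_sum z * of_real (eigv a k) * a k) UNIV"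
      by (simp add: eigv_def)
  qed
  finally show ?thesis .
qed

text \<open>The second part of \<open>filt_mult\<close> is \<open>B + E\<close>: the term \<open>E\<close> corrects the resonance \<open>j = k\<close>, where
  \<open>dinv_symbol\<close> vanishes, and sums to the eigenvalue; exchanging \<open>i\<close> and \<open>j\<close> replaces the factor
  \<open>2 (k - i)\<close> in \<open>B\<close> by \<open>2 k - i - j\<close>.\<close>

lemma filt_identity_nonzero:
  assumes a: "a \<in> hseq r" and k: "k \<noteq> 0" and \<tau>: "0 \<le> \<tau>"
  shows "tri (filt_mult \<mu> \<tau>) a a a k
    = tri (duh_mult \<mu> \<tau>) a a a k + tri (rem_mult \<mu> \<tau>) a a a k + 2 * \<i> * of_real \<mu> * of_real \<tau> * of_real (eigv a k) * a k"
proof -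
  \<comment> \<open>\<open>A\<close> has weight \<open>l / k\<close> and the phase used by the
    scheme. In \<open>B\<close> the factor \<open>1 / (k - j)\<close> coming from
    \<open>dinv\<close> has cancelled against the phase \<open>2 (k - i) (k - j)\<close>;
    \<open>B'\<close> is its symmetrisation in \<open>i\<close> and \<open>j\<close>.\<close>
  define A where "A k i j = - \<i> * of_real \<mu> * (of_int (i + j - k) / of_int k * osc \<tau> (of_int (- 2 * k * (i + j - k))))" for k i j
  define B where "B k i j = - 2 * \<i> * of_real \<mu> * (of_int (k - i) / of_int k * osc \<tau> (res_phase k i j))" for k i j
  define B' where "B' k i j = - \<i> * of_real \<mu> * (of_int (2 * k - i - j) / of_int k * osc \<tau> (res_phase k i j))" for k i j
  define E where "E k i j = (if j = k then 2 * \<i> * of_real \<mu> * of_real \<tau> * of_int (k - i) / of_int k else 0)" for k i j :: int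
  note at = tri_summable_at[OF a a a]
  have div: "cmod (of_int n / of_int k * w) \<le> \<bar>of_int n\<bar> * \<tau>" if "cmod w \<le> \<tau>" for n w
    using mult_mono[OF abs_divide_int_le[of "of_int n" k] that] by (simp add: norm_mult norm_divide)
  have l: "\<bar>of_int (i + j - k)\<bar> * \<tau> \<le> \<tau> * (wt 1 i * wt 1 (i + j - k) * wt 1 j)" for i j
    using mult_left_mono[OF wt_prod_ge(2)[of "i + j - k" i j] \<tau>] by (simp add: mult.commute)
  have ki: "\<bar>of_int (k - i)\<bar> \<le> (2 + wt 1 k) * (wt 1 i * wt 1 (i + j - k) * wt 1 j)" for i j
  proof -
    have "wt 1 k * 1 \<le> wt 1 k * (wt 1 i * wt 1 (i + j - k) * wt 1 j)"
      by (intro mult_left_mono wt_prod_ge) simp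
    moreover have "0 \<le> wt 1 i * wt 1 (i + j - k) * wt 1 j" by simp
    ultimately show ?thesis
      using abs_le_wt_1[of k] abs_le_wt_1[of i] wt_prod_ge(3)[of i "i + j - k" j]
      unfolding distrib_right of_int_diff by linarith
  qed
  have sA: "tri_summable A a a a k"
  proof (rule at)
    fix i j
    have "cmod (A k i j) \<le> \<bar>\<mu>\<bar> * (\<bar>of_int (i + j - k)\<bar> * \<tau>)"
      unfolding A_def norm_mult[of "- \<i> * of_real \<mu>"] by (intro mult_mono div norm_osc_le \<tau>) (auto simp: norm_mult)
    also have "\<dots> \<le> \<bar>\<mu>\<bar> * (\<tau> * (wt 1 i * wt 1 (i + j - k) * wt 1 j))"
      by (intro mult_left_mono l) simp
    finally show "cmod (A k i j) \<le> (\<bar>\<mu>\<bar> * \<tau>) * (wt 1 i * wt 1 (i + j - k) * wt 1 j)" by (simp add: mult.assoc)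
  qed
  have sB: "tri_summable B a a a k"
  proof (rule at)
    fix i j
    have "cmod (B k i j) \<le> (2 * \<bar>\<mu>\<bar>) * (\<bar>of_int (k - i)\<bar> * \<tau>)"
      unfolding B_def norm_mult[of "- 2 * \<i> * of_real \<mu>"] by (intro mult_mono div norm_osc_le \<tau>) (auto simp: norm_mult)
    also have "\<dots> \<le> (2 * \<bar>\<mu>\<bar>) * (((2 + wt 1 k) * (wt 1 i * wt 1 (i + j - k) * wt 1 j)) * \<tau>)"
      by (intro mult_left_mono mult_right_mono ki \<tau>) simp
    finally show "cmod (B k i j) \<le> (2 * \<bar>\<mu>\<bar> * (2 + wt 1 k) * \<tau>) * (wt 1 i * wt 1 (i + j - k) * wt 1 j)"
      by (simp only: mult_ac)
  qed
  have sE: "tri_summable E a a a k"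
  proof (rule at)
    fix i j
    have "cmod (E k i j) \<le> (2 * \<bar>\<mu>\<bar> * \<tau>) * \<bar>of_int (k - i)\<bar>"
      using mult_left_mono[OF abs_divide_int_le[of "of_int (k - i)" k], of "2 * \<bar>\<mu>\<bar> * \<tau>"] \<tau>
      by (auto simp: E_def norm_mult norm_divide simp del: of_int_diff)
    also have "\<dots> \<le> (2 * \<bar>\<mu>\<bar> * \<tau>) * ((2 + wt 1 k) * (wt 1 i * wt 1 (i + j - k) * wt 1 j))"
      by (intro mult_left_mono ki) (use \<tau> in auto)
    finally show "cmod (E k i j) \<le> (2 * \<bar>\<mu>\<bar> * \<tau> * (2 + wt 1 k)) * (wt 1 i * wt 1 (i + j - k) * wt 1 j)"
      by (simp only: mult_ac)
  qed
  have sD: "tri_summable (duh_mult \<mu> \<tau>) a a a k"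
  proof (rule at)
    fix i j
    have "cmod (duh_mult \<mu> \<tau> k i j) \<le> \<bar>\<mu>\<bar> * \<tau> * 1"
      using norm_osc_le[OF \<tau>] by (simp add: duh_mult_def norm_mult mult_left_mono)
    also have "\<dots> \<le> (\<bar>\<mu>\<bar> * \<tau>) * (wt 1 i * wt 1 (i + j - k) * wt 1 j)"
      by (intro mult_left_mono wt_prod_ge) (use \<tau> in auto)
    finally show "cmod (duh_mult \<mu> \<tau> k i j) \<le> (\<bar>\<mu>\<bar> * \<tau>) * (wt 1 i * wt 1 (i + j - k) * wt 1 j)" .
  qed
  have sR: "tri_summable (rem_mult \<mu> \<tau>) a a a k"
    using tri_unemb(1)[OF r admissible_rem_mult[OF \<tau>], of \<mu> "emb r a" "emb r a" "emb r a" k] a by simp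
  have sB2: "tri_summable (\<lambda>k i j. B k j i) a a a k"
  proof -
    have "tri_summable B a a a k \<longleftrightarrow> tri_summable (\<lambda>k i j. B k j i) a a a k"
      unfolding tri_summable_def
      by (rule summable_on_reindex_bij_witness[of _ prod.swap prod.swap]) (auto simp: add.commute mult_ac)
    then show ?thesis using sB by simp
  qed
  \<comment> \<open>As \<open>(i + j - k) + (2 * k - i - j) = k\<close>, the two weights add up to 1
    and recover the Duhamel multiplier, up to the change of phase in \<open>A\<close>.\<close>
  have AB': "A k i j + B' k i j = duh_mult \<mu> \<tau> k i j + rem_mult \<mu> \<tau> k i j" for i j
    using k by (simp add: A_def B'_def duh_mult_def rem_mult_def field_simps)
  have BB: "B k i j + B k j i = B' k i j + B' k i j" for i j
    using k by (simp add: B_def B'_def field_simps)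
  have sB': "tri_summable B' a a a k"
  proof -
    have "tri_summable (\<lambda>k i j. (1/2) * (B k i j + B k j i)) a a a k"
      by (rule tri_cmult_mult(1)[OF tri_add_mult(1)[OF sB sB2], of "\<lambda>_. 1/2"])
    then show ?thesis by (subst (asm) tri_cong(2)[of _ k B']) (simp_all add: BB)
  qed
  have "tri B a a a k + tri B a a a k = tri B' a a a k + tri B' a a a k"
  proof -
    have "tri B a a a k + tri B a a a k = tri B a a a k + tri (\<lambda>k i j. B k j i) a a a k"
      by (subst (2) tri_swap) simp
    also have "\<dots> = tri (\<lambda>k i j. B k i j + B k j i) a a a k" by (rule tri_add_mult(2)[OF sB sB2, symmetric])
    also have "\<dots> = tri (\<lambda>k i j. B' k i j + B' k i j) a a a k" by (rule tri_cong(1)) (rule BB)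
    finally show ?thesis by (simp only: tri_add_mult(2)[OF sB' sB'])
  qed
  then have B: "tri B a a a k = tri B' a a a k" by simp
  have F: "filt_mult \<mu> \<tau> k i j = (A k i j + B k i j) + E k i j" for i j
  proof -
    have 1: "- of_real \<mu> / 2 * (dinv_symbol k)\<^sup>2 * (exp (\<i> * of_real (\<tau> * of_int (- 2 * k * (i + j - k)))) - 1) = A k i j"
      unfolding osc_mult[OF \<tau>, symmetric] A_def dinv_symbol_def using k by (simp add: field_simps power2_eq_square)
    have 2: "of_real \<mu> * dinv_symbol k * dinv_symbol (k - j) * (exp (\<i> * of_real (\<tau> * res_phase k i j)) - 1) = B k i j + E k i j"
    proof (cases "j = k")
      case True
      then show ?thesis using k \<tau> by (simp add: B_def E_def osc_0 field_simps)
    next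
      case False
      then have "of_int (k - j) \<noteq> (0 :: complex)" by simp
      then show ?thesis
        unfolding osc_mult[OF \<tau>, symmetric] B_def E_def dinv_symbol_def using k False
        by (simp add: divide_simps)
    qed
    show ?thesis unfolding filt_mult_def 1 2 by simp
  qed
  have "tri (filt_mult \<mu> \<tau>) a a a k = tri (\<lambda>k i j. (A k i j + B k i j) + E k i j) a a a k"
    by (rule tri_cong(1)) (rule F)
  also have "\<dots> = tri A a a a k + tri B a a a k + tri E a a a k"
    by (simp only: tri_add_mult(2)[OF tri_add_mult(1)[OF sA sB] sE] tri_add_mult(2)[OF sA sB])
  also have "tri A a a a k + tri B a a a k = tri (\<lambda>k i j. A k i j + B' k i j) a a a k"
    by (simp only: B tri_add_mult(2)[OF sA sB'])
  also have "\<dots> = tri (\<lambda>k i j. duh_mult \<mu> \<tau> k i j + rem_mult \<mu> \<tau> k i j) a a a k"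
    by (rule tri_cong(1)) (rule AB')
  also have "\<dots> = tri (duh_mult \<mu> \<tau>) a a a k + tri (rem_mult \<mu> \<tau>) a a a k"
    by (rule tri_add_mult(2)[OF sD sR])
  also have "tri E a a a k = 2 * \<i> * of_real \<mu> * of_real \<tau> * of_real (eigv a k) * a k"
    unfolding E_def by (rule resonant_sum[OF a k])
  finally show ?thesis .
qed

end

text \<open>With \<open>l = i + j - k\<close>: \<open>l\<^sup>2 - (i + j)\<^sup>2 = - k\<^sup>2 - 2 k l\<close>.\<close>

lemma phase_factor2:
  "phase t (i + j) * phase (- t) (k - i - j)
    = phase t k * exp (\<i> * of_real (t * of_int (- 2 * k * (i + j - k))))"
  unfolding exp_add[symmetric] by (rule arg_cong[of _ _ exp]) (simp add: power2_eq_square algebra_simps)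

section \<open>The scheme as a perturbation of the first Picard iterate\<close>

definition phi_ell2 :: "real \<Rightarrow> real \<Rightarrow> real \<Rightarrow> int ell2 \<Rightarrow> int ell2"
  where "phi_ell2 r \<mu> \<tau> x = duhamel r \<mu> \<tau> x + emb r (res_rem \<mu> \<tau> (unemb r x)) + cubic_op r (rem_mult \<mu> \<tau>) x"

context
  fixes r :: real
  assumes r: "r > 3 / 2"
begin

text \<open>For \<open>k\<close> not 0 the linear term of the exponential cancels the resonant sum
  of \<open>filt_identity_nonzero\<close>. At \<open>k = 0\<close> every filtered term vanishes
  through \<open>dinv\<close>; of the two mean-value terms one supplies the Duhamel term with frozen
  phase and the other cancels the linear term of the exponential.\<close>

lemma filt_identity:
  assumes a: "a \<in> hseq r" and \<tau>: "0 \<le> \<tau>"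
  shows "(exp (- 2 * \<i> * of_real \<mu> * of_real \<tau> * (mass (fser a) + momentum (fser a) * dinv_symbol k)) - 1) * a k
      + (if k = 0 then - \<i> * of_real \<mu> * of_real \<tau> * cubic_seq a 0 + 2 * \<i> * of_real \<mu> * of_real \<tau> * mass (fser a) * a 0 else 0)
      + tri (filt_mult \<mu> \<tau>) a a a k
    = tri (duh_mult \<mu> \<tau>) a a a k + res_rem \<mu> \<tau> a k + tri (rem_mult \<mu> \<tau>) a a a k"
proof -
  let ?lam = "complex_of_real (eigv a k)"
  have rr: "(exp (- 2 * \<i> * of_real \<mu> * of_real \<tau> * ?lam) - 1) * a k
      = res_rem \<mu> \<tau> a k - 2 * \<i> * of_real \<mu> * of_real \<tau> * ?lam * a k"
    by (simp add: res_rem_def expo_rem_def algebra_simps)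
  show ?thesis
  proof (cases "k = 0")
    case False
    then show ?thesis
      unfolding mass_momentum_eigv[OF r a] rr filt_identity_nonzero[OF r a False \<tau>] by simp
  next
    case True
    have l: "l1seq a" using hseq_l1(1)[OF _ a] r by simp
    have "mass (fser a) = ?lam" using mass_momentum_eigv[OF r a, of 0] True by simp
    moreover have "tri (filt_mult \<mu> \<tau>) a a a k = 0"
      by (subst tri_cong(1)[of _ _ "\<lambda>_ _ _. 0"]) (simp_all add: filt_mult_def True tri_def case_prod_unfold)
    moreover have "tri (duh_mult \<mu> \<tau>) a a a k + tri (rem_mult \<mu> \<tau>) a a a k = - \<i> * of_real \<mu> * of_real \<tau> * cubic_seq a k"
    proof -
      have b: "cmod (duh_mult \<mu> \<tau> k i j) \<le> \<bar>\<mu>\<bar> * \<tau>" for i j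
        using norm_osc_le[OF \<tau>] by (simp add: duh_mult_def norm_mult mult_left_mono)
      have sR: "tri_summable (rem_mult \<mu> \<tau>) a a a k"
        using tri_unemb(1)[OF r admissible_rem_mult[OF \<tau>], of \<mu> "emb r a" "emb r a" "emb r a" k] a by simp
      have "tri (duh_mult \<mu> \<tau>) a a a k + tri (rem_mult \<mu> \<tau>) a a a k
          = tri (\<lambda>k i j. duh_mult \<mu> \<tau> k i j + rem_mult \<mu> \<tau> k i j) a a a k"
        by (rule tri_add_mult(2)[OF tri_bounded_summable[where m = "duh_mult \<mu> \<tau>" and k = k, OF l l l b] sR, symmetric])
      also have "\<dots> = tri (\<lambda>_ _ _. - \<i> * of_real \<mu> * of_real \<tau>) a a a k"
        by (rule tri_cong(1)) (use True \<tau> in \<open>simp add: duh_mult_def rem_mult_def osc_0 right_diff_distrib\<close>)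
      also have "\<dots> = - \<i> * of_real \<mu> * of_real \<tau> * cubic_seq a k" by (rule tri_const_mult)
      finally show ?thesis .
    qed
    ultimately show ?thesis
      unfolding mass_momentum_eigv[OF r a] rr using True by (simp add: algebra_simps)
  qed
qed

text \<open>All terms share the factor \<open>e k\<close>: either the group is applied last, or the
  phases inside a product combine to it by \<open>phase_factor\<close> and
  \<open>phase_factor2\<close>; for the mean values it is 1.\<close>

lemma Phi_fser:
  fixes \<mu> \<tau> :: real
  assumes a: "a \<in> hseq r"
  defines "e \<equiv> \<lambda>k. phase \<tau> k"
  defines "\<Psi> \<equiv> \<lambda>k. (exp (- 2 * \<i> * of_real \<mu> * of_real \<tau> * (mass (fser a) + momentum (fser a) * dinv_symbol k)) - 1) * a k
      + (if k = 0 then - \<i> * of_real \<mu> * of_real \<tau> * cubic_seq a 0 + 2 * \<i> * of_real \<mu> * of_real \<tau> * mass (fser a) * a 0 else 0)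
      + tri (filt_mult \<mu> \<tau>) a a a k"
  shows "Phi_c2 \<mu> \<tau> (fser a) = fser (\<lambda>k. e k * \<Psi> k)"
proof -
  have la: "l1seq a" using hseq_l1(1)[OF _ a] r by simp
  define \<rho> where "\<rho> k = exp (- 2 * \<i> * of_real \<mu> * of_real \<tau> * (mass (fser a) + momentum (fser a) * dinv_symbol k))" for k
  \<comment> \<open>Mass and momentum combine to the real number \<open>eigv a k\<close>, so the
    resonant factor is unimodular and preserves \<open>l1seq\<close>.\<close>
  have n\<rho>: "cmod (\<rho> k) \<le> 1" for k
  proof -
    have "- 2 * \<i> * of_real \<mu> * of_real \<tau> * of_real (eigv a k) = \<i> * of_real (- 2 * \<mu> * \<tau> * eigv a k)" by simp
    then show ?thesis unfolding \<rho>_def mass_momentum_eigv[OF r a] by (simp only: norm_exp_i_times)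
  qed
  let ?d = dinv_symbol
  let ?S = "schroedinger_group \<tau>"
  define e' where "e' k = phase (- \<tau>) k" for k
  have ne: "cmod (e k) \<le> 1" "cmod (e' k) \<le> 1" for k unfolding e_def e'_def by simp_all
  have S: "?S (fser c) = fser (\<lambda>k. e k * c k)" if "l1seq c" for c
    unfolding schroedinger_group_def e_def by (rule fourier_mult_fser[OF that])
  have S': "schroedinger_group (- \<tau>) (fser c) = fser (\<lambda>k. e' k * c k)" if "l1seq c" for c
    unfolding schroedinger_group_def e'_def by (rule fourier_mult_fser[OF that])
  have D: "dinv (fser c) = fser (\<lambda>k. ?d k * c k)" if "l1seq c" for c
    unfolding dinv_def by (rule fourier_mult_fser[OF that])
  have le: "l1seq (\<lambda>k. e k * c k)" "l1seq (\<lambda>k. e' k * c k)" "l1seq (\<lambda>k. ?d k * c k)" if "l1seq c" for c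
    using l1seq_mult[OF that ne(1)] l1seq_mult[OF that ne(2)] l1seq_mult[OF that norm_dinv_symbol] by auto
  define w where "w k = e k * a k" for k
  have lw: "l1seq w" using le(1)[OF la] by (simp add: w_def)
  define N where "N = cubic_seq a"
  have lN: "l1seq N" using cubic_fser(2)[OF la] by (simp add: N_def)
  define X where "X = conv (\<lambda>m. e m * conv a a m) (\<lambda>m. e' m * cnj_seq a m)"
  define Y where "Y = conv (\<lambda>m. ?d m * conv w (cnj_seq w) m) w"
  define Z where "Z = conv (\<lambda>m. ?d m * conv a (cnj_seq a) m) a"
  have lX: "l1seq X" and lY: "l1seq Y" and lZ: "l1seq Z"
    unfolding X_def Y_def Z_def by (intro conv_l1seq le cnj_seq_l1seq la lw)+
  define p1 where "p1 k = e k * (\<rho> k * a k - a k)" for k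
  define p2 where "p2 k = ?d k * (?d k * X k)" for k
  define p3 where "p3 k = e k * (?d k * (?d k * N k))" for k
  define p4 where "p4 k = ?d k * Y k" for k
  define p5 where "p5 k = e k * (?d k * Z k)" for k
  have l\<rho>: "l1seq (\<lambda>k. \<rho> k * a k)" by (rule l1seq_mult[OF la n\<rho>])
  have lp: "l1seq p1" "l1seq p2" "l1seq p3" "l1seq p4" "l1seq p5"
    unfolding p1_def p2_def p3_def p4_def p5_def
    by (intro le l1seq_diff l\<rho> la lN lX lY lZ)+
  have P1: "?S (\<lambda>y. resonant_op \<mu> \<tau> (fser a) (fser a) y - fser a y) = fser p1"
  proof -
    have "resonant_op \<mu> \<tau> (fser a) (fser a) = fser (\<lambda>k. \<rho> k * a k)"
      unfolding resonant_op_def \<rho>_def by (rule fourier_mult_fser[OF la])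
    then have "(\<lambda>y. resonant_op \<mu> \<tau> (fser a) (fser a) y - fser a y) = fser (\<lambda>k. \<rho> k * a k - a k)"
      by (simp add: fun_eq_iff fser_diff[OF l\<rho> la])
    then show ?thesis by (simp add: S l1seq_diff l\<rho> la p1_def[abs_def])
  qed
  have P2: "dinv (dinv (\<lambda>y. schroedinger_group (- \<tau>) (\<lambda>z. cnj (fser a z)) y * ?S (\<lambda>z. (fser a z)\<^sup>2) y)) = fser p2"
  proof -
    have sq: "(\<lambda>z. (fser a z)\<^sup>2) = fser (conv a a)"
      by (rule ext) (simp add: power2_eq_square fser_mult la)
    have cj: "(\<lambda>z. cnj (fser a z)) = fser (cnj_seq a)" by (rule ext) (rule cnj_fser)
    have "(\<lambda>y. schroedinger_group (- \<tau>) (\<lambda>z. cnj (fser a z)) y * ?S (\<lambda>z. (fser a z)\<^sup>2) y) = fser X"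
      unfolding X_def sq cj S[OF conv_l1seq[OF la la]] S'[OF cnj_seq_l1seq[OF la]]
      by (rule ext) (simp add: fser_mult[symmetric] conv_l1seq cnj_seq_l1seq la le mult.commute)
    then show ?thesis by (simp add: D lX le p2_def[abs_def])
  qed
  have P3: "?S (dinv (dinv (cubic (fser a)))) = fser p3"
    unfolding cubic_fser(1)[OF la] N_def[symmetric] by (simp add: D S lN le p3_def[abs_def])
  have P4: "dinv (\<lambda>y. ?S (fser a) y * dinv (abs_sq (?S (fser a))) y) = fser p4"
  proof -
    have sw: "?S (fser a) = fser w" by (simp add: S la w_def[abs_def])
    have "(\<lambda>y. ?S (fser a) y * dinv (abs_sq (?S (fser a))) y) = fser Y"
      unfolding Y_def sw
      by (simp add: abs_sq_fser lw D conv_l1seq cnj_seq_l1seq le fser_mult[symmetric] fun_eq_iff mult.commute)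
    then show ?thesis by (simp add: D lY p4_def[abs_def])
  qed
  have P5: "?S (dinv (\<lambda>y. fser a y * dinv (abs_sq (fser a)) y)) = fser p5"
  proof -
    have "(\<lambda>y. fser a y * dinv (abs_sq (fser a)) y) = fser Z"
      unfolding Z_def
      by (simp add: abs_sq_fser la D conv_l1seq cnj_seq_l1seq le fser_mult[symmetric] fun_eq_iff mult.commute)
    then show ?thesis by (simp add: D S lZ le p5_def[abs_def])
  qed
  define z0 where "z0 = - \<i> * of_real \<mu> * of_real \<tau> * cubic_seq a 0 + 2 * \<i> * of_real \<mu> * of_real \<tau> * mass (fser a) * a 0"
  have mc: "mean0 (cubic (fser a)) = cubic_seq a 0" "mean0 (fser a) = a 0"
    unfolding cubic_fser(1)[OF la] by (rule mean0_fser[OF cubic_fser(2)[OF la]], rule mean0_fser[OF la])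
  have Phi: "Phi_c2 \<mu> \<tau> (fser a) = fser (\<lambda>k. p1 k + (if k = 0 then z0 else 0) + (- of_real \<mu> / 2) * p2 k
      + (of_real \<mu> / 2) * p3 k + of_real \<mu> * p4 k + (- of_real \<mu>) * p5 k)"
  proof (rule ext)
    fix x
    have "Phi_c2 \<mu> \<tau> (fser a) x = fser p1 x + z0 - of_real \<mu> / 2 * fser p2 x + of_real \<mu> / 2 * fser p3 x
        + of_real \<mu> * fser p4 x - of_real \<mu> * fser p5 x"
      unfolding Phi_c2_def Let_def P1 P2 P3 P4 P5 mc z0_def by simp
    then show "Phi_c2 \<mu> \<tau> (fser a) x = fser (\<lambda>k. p1 k + (if k = 0 then z0 else 0) + (- of_real \<mu> / 2) * p2 k
      + (of_real \<mu> / 2) * p3 k + of_real \<mu> * p4 k + (- of_real \<mu>) * p5 k) x"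
      by (simp only: fser_add fser_cmult fser_delta l1seq_add l1seq_cmult l1seq_delta lp) simp
  qed
  have "p1 k + (if k = 0 then z0 else 0) + (- of_real \<mu> / 2) * p2 k
      + (of_real \<mu> / 2) * p3 k + of_real \<mu> * p4 k + (- of_real \<mu>) * p5 k = e k * \<Psi> k" for k
  proof -
    let ?t = "\<lambda>m. tri m a a a k"
    let ?E1 = "\<lambda>k i j. exp (\<i> * of_real (\<tau> * of_int (- 2 * k * (i + j - k))))"
    let ?E2 = "\<lambda>k i j. exp (\<i> * of_real (\<tau> * res_phase k i j))"
    have nE: "cmod (?E1 k i j) = 1" "cmod (?E2 k i j) = 1" for i j by (simp_all only: norm_exp_i_times)
    have X: "X k = e k * ?t ?E1"
    proof -
      have "X k = ?t (\<lambda>k i j. e (i + j) * e' (k - i - j))"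
        unfolding X_def by (rule conv_tri2[OF la la la ne])
      also have "\<dots> = ?t (\<lambda>k i j. e k * ?E1 k i j)"
        by (rule tri_cong(1)) (unfold e_def e'_def, rule phase_factor2)
      also have "\<dots> = e k * ?t ?E1" by (rule tri_cmult_mult(2))
      finally show ?thesis .
    qed
    have Y: "Y k = e k * ?t (\<lambda>k i j. ?d (k - j) * ?E2 k i j)"
    proof -
      have "Y k = tri (\<lambda>k i j. ?d (k - j)) w w w k"
        unfolding Y_def by (rule conv_tri1[OF lw lw lw norm_dinv_symbol])
      also have "\<dots> = e k * ?t (\<lambda>k i j. ?d (k - j) * ?E2 k i j)"
        unfolding w_def by (rule tri_phase_mult) (simp add: e_def)
      finally show ?thesis .
    qed
    have Z: "Z k = ?t (\<lambda>k i j. ?d (k - j))"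
      unfolding Z_def by (rule conv_tri1[OF la la la norm_dinv_symbol])
    note sb = tri_bounded_summable[OF la la la]
    have s1: "tri_summable ?E1 a a a k" by (rule sb[where M = 1]) (simp only: nE)
    have s2: "tri_summable (\<lambda>k i j. ?d (k - j) * ?E2 k i j) a a a k"
      by (rule sb[where M = 1]) (simp only: norm_mult nE mult_1_right norm_dinv_symbol)
    have s3: "tri_summable (\<lambda>k i j. ?d (k - j)) a a a k"
      by (rule sb[where M = 1]) (rule norm_dinv_symbol)
    have s4: "tri_summable (\<lambda>_ _ _. 1) a a a k" by (rule sb[where M = 1]) simp
    have "?t (filt_mult \<mu> \<tau>) = ?t (\<lambda>k i j. (((- of_real \<mu> / 2 * (?d k)\<^sup>2) * ?E1 k i j + (of_real \<mu> / 2 * (?d k)\<^sup>2) * 1)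
        + (of_real \<mu> * ?d k) * (?d (k - j) * ?E2 k i j)) + (- of_real \<mu> * ?d k) * ?d (k - j))"
      by (rule tri_cong(1)) (simp add: filt_mult_def algebra_simps)
    also have "\<dots> = (- of_real \<mu> / 2 * (?d k)\<^sup>2) * ?t ?E1 + (of_real \<mu> / 2 * (?d k)\<^sup>2) * N k
        + (of_real \<mu> * ?d k) * ?t (\<lambda>k i j. ?d (k - j) * ?E2 k i j) + (- of_real \<mu> * ?d k) * Z k"
    proof -
      note c1 = tri_cmult_mult(1)[OF s1, of "\<lambda>k. - of_real \<mu> / 2 * (?d k)\<^sup>2"]
      note c4 = tri_cmult_mult(1)[OF s4, of "\<lambda>k. of_real \<mu> / 2 * (?d k)\<^sup>2"]
      note c2 = tri_cmult_mult(1)[OF s2, of "\<lambda>k. of_real \<mu> * ?d k"]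
      note c3 = tri_cmult_mult(1)[OF s3, of "\<lambda>k. - of_real \<mu> * ?d k"]
      show ?thesis
        unfolding tri_add_mult(2)[OF tri_add_mult(1)[OF tri_add_mult(1)[OF c1 c4] c2] c3]
          tri_add_mult(2)[OF tri_add_mult(1)[OF c1 c4] c2] tri_add_mult(2)[OF c1 c4]
          tri_cmult_mult(2)[of "\<lambda>k. - of_real \<mu> / 2 * (?d k)\<^sup>2"] tri_cmult_mult(2)[of "\<lambda>k. of_real \<mu> / 2 * (?d k)\<^sup>2"]
          tri_cmult_mult(2)[of "\<lambda>k. of_real \<mu> * ?d k"] tri_cmult_mult(2)[of "\<lambda>k. - of_real \<mu> * ?d k"] Z N_def ..
    qed
    finally have F: "?t (filt_mult \<mu> \<tau>) = (- of_real \<mu> / 2 * (?d k)\<^sup>2) * ?t ?E1 + (of_real \<mu> / 2 * (?d k)\<^sup>2) * N k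
        + (of_real \<mu> * ?d k) * ?t (\<lambda>k i j. ?d (k - j) * ?E2 k i j) + (- of_real \<mu> * ?d k) * Z k" .
    have e0: "(if k = 0 then z0 else 0) = e k * (if k = 0 then z0 else 0)" by (simp add: e_def)
    show ?thesis
      unfolding \<Psi>_def F p1_def p2_def p3_def p4_def p5_def X Y \<rho>_def[symmetric] z0_def[symmetric]
      by (subst e0) (simp add: algebra_simps power2_eq_square)
  qed
  then show ?thesis unfolding Phi by simp
qed

text \<open>Summation and time integration are interchanged under the majorant of
  \<open>conv3\<close>; each phase then integrates to \<open>osc\<close>.\<close>

lemma unemb_duhamel:
  assumes \<tau>: "0 \<le> \<tau>"
  shows "unemb r (duhamel r \<mu> \<tau> x) k = tri (duh_mult \<mu> \<tau>) (unemb r x) (unemb r x) (unemb r x) k"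
proof -
  let ?a = "unemb r x"
  have la: "l1seq ?a" using unemb_l1seq[OF r] .
  let ?f = "\<lambda>p s. case p of (i, j) \<Rightarrow> phase_mult \<mu> s k i j * (?a i * cnj (?a (i + j - k)) * ?a j)"
  let ?g = "\<lambda>p. \<bar>\<mu>\<bar> * (case p of (i, j) \<Rightarrow> cmod (?a i) * cmod (?a (i + j - k)) * cmod (?a j))"
  have "bounded_linear (\<lambda>b. unemb r b k)"
    unfolding unemb_def by (intro bounded_linear_compose[OF bounded_linear_divide bounded_linear_coord])
  from integral_linear[OF cubic_op_phase_mult_integrable[OF r] this]
  have "unemb r (duhamel r \<mu> \<tau> x) k = integral {0..\<tau>} (\<lambda>s. unemb r (cubic_op r (phase_mult \<mu> s) x) k)"
    unfolding duhamel_def by (simp add: o_def)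
  also have "\<dots> = integral {0..\<tau>} (\<lambda>s. \<Sum>\<^sub>\<infinity>p. ?f p s)"
    by (simp add: unemb_def[of r "cubic_op r _ _"] coord_tri_op[OF r admissible_phase_mult] tri_def)
  finally have 1: "unemb r (duhamel r \<mu> \<tau> x) k = integral {0..\<tau>} (\<lambda>s. \<Sum>\<^sub>\<infinity>p. ?f p s)" .
  have "((\<lambda>p. integral {0..\<tau>} (?f p)) has_sum integral {0..\<tau>} (\<lambda>s. \<Sum>\<^sub>\<infinity>p. ?f p s)) UNIV"
  proof (rule infsum_integral[where g = ?g])
    show "continuous_on {0..\<tau>} (?f p)" for p
      unfolding phase_mult_def by (cases p) (auto intro!: continuous_intros)
    show "cmod (?f p t) \<le> ?g p" for p t
      by (cases p) (simp add: norm_mult norm_phase_mult)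
    show "?g summable_on UNIV"
      by (intro summable_on_cmult_right conv3_summable la)
  qed
  moreover have "integral {0..\<tau>} (?f p) = (case p of (i, j) \<Rightarrow> duh_mult \<mu> \<tau> k i j * (?a i * cnj (?a (i + j - k)) * ?a j))" for p
  proof (cases p)
    case (Pair i j)
    show ?thesis
      unfolding Pair prod.case phase_mult_def duh_mult_def osc_def integral_mult_left integral_mult_right ..
  qed
  ultimately show ?thesis unfolding 1 tri_def by (simp add: infsumI)
qed

lemma Phi_unemb:
  assumes \<tau>: "0 \<le> \<tau>"
  shows "Phi_c2 \<mu> \<tau> (fser (unemb r x)) = fser (unemb r (free_group \<tau> (phi_ell2 r \<mu> \<tau> x)))"
proof -
  let ?a = "unemb r x"
  have R: "res_rem \<mu> \<tau> ?a \<in> hseq r"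
    using res_rem_lipschitz(1)[of r ?a "norm x" ?a] r \<tau> by simp
  have "unemb r (phi_ell2 r \<mu> \<tau> x) k = tri (duh_mult \<mu> \<tau>) ?a ?a ?a k + res_rem \<mu> \<tau> ?a k + tri (rem_mult \<mu> \<tau>) ?a ?a ?a k" for k
  proof -
    have "unemb r (u + v + w) k = unemb r u k + unemb r v k + unemb r w k" for u v w
      by (simp add: unemb_def add_divide_distrib)
    moreover have "unemb r (cubic_op r (rem_mult \<mu> \<tau>) x) k = tri (rem_mult \<mu> \<tau>) ?a ?a ?a k"
      using coord_tri_op[OF r admissible_rem_mult[OF \<tau>], of \<mu> x x x k] by (simp add: unemb_def[of r "cubic_op r _ _"])
    ultimately show ?thesis
      by (simp add: phi_ell2_def unemb_duhamel[OF \<tau>] R)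
  qed
  then show ?thesis
    unfolding Phi_fser[OF unemb_hseq] filt_identity[OF unemb_hseq \<tau>]
    by (simp only: unemb_free_group[abs_def])
qed

lemma remainder_lipschitz:
  assumes "0 \<le> \<tau>" "norm x \<le> R" "norm y \<le> R"
  shows "norm ((phi_ell2 r \<mu> \<tau> x - duhamel r \<mu> \<tau> x) - (phi_ell2 r \<mu> \<tau> y - duhamel r \<mu> \<tau> y))
    \<le> (48 * \<mu>\<^sup>2 * R ^ 4 + 12 * \<bar>\<mu>\<bar> * tri_const r * R\<^sup>2) * \<tau>\<^sup>2 * norm (x - y)"
proof -
  let ?a = "unemb r x" and ?b = "unemb r y"
  have r1: "1 \<le> r" using r by simp
  have h: "hnorm r ?a \<le> R" "hnorm r ?b \<le> R" using assms by auto
  note E = res_rem_lipschitz[OF r1 unemb_hseq h(1) unemb_hseq h(2) assms(1), of \<mu>]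
  note E' = res_rem_lipschitz(1)[OF r1 unemb_hseq h(2) unemb_hseq h(1) assms(1), of \<mu>]
  have "norm (emb r (res_rem \<mu> \<tau> ?a) - emb r (res_rem \<mu> \<tau> ?b)) \<le> 48 * \<mu>\<^sup>2 * R ^ 4 * \<tau>\<^sup>2 * norm (x - y)"
    using E(2) unfolding hseq_diff(2)[OF E(1) E', symmetric] norm_emb[OF hseq_diff(1)[OF E(1) E']]
    by (simp flip: unemb_diff)
  moreover have "norm (cubic_op r (rem_mult \<mu> \<tau>) x - cubic_op r (rem_mult \<mu> \<tau>) y)
      \<le> 3 * (4 * \<bar>\<mu>\<bar> * \<tau>\<^sup>2 * tri_const r * R\<^sup>2) * norm (x - y)"
    by (rule cubic_op_lipschitz[OF r admissible_rem_mult[OF assms(1)] assms(2,3)])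
  moreover have eq: "(phi_ell2 r \<mu> \<tau> x - duhamel r \<mu> \<tau> x) - (phi_ell2 r \<mu> \<tau> y - duhamel r \<mu> \<tau> y)
      = (emb r (res_rem \<mu> \<tau> ?a) - emb r (res_rem \<mu> \<tau> ?b)) + (cubic_op r (rem_mult \<mu> \<tau>) x - cubic_op r (rem_mult \<mu> \<tau>) y)"
    by (simp add: phi_ell2_def)
  ultimately have "norm ((phi_ell2 r \<mu> \<tau> x - duhamel r \<mu> \<tau> x) - (phi_ell2 r \<mu> \<tau> y - duhamel r \<mu> \<tau> y))
      \<le> 48 * \<mu>\<^sup>2 * R ^ 4 * \<tau>\<^sup>2 * norm (x - y) + 3 * (4 * \<bar>\<mu>\<bar> * \<tau>\<^sup>2 * tri_const r * R\<^sup>2) * norm (x - y)"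
    unfolding eq by (intro order_trans[OF norm_triangle_ineq add_mono])
  also have "\<dots> = (48 * \<mu>\<^sup>2 * R ^ 4 + 12 * \<bar>\<mu>\<bar> * tri_const r * R\<^sup>2) * \<tau>\<^sup>2 * norm (x - y)"
    by (simp add: algebra_simps)
  finally show ?thesis .
qed

end

theorem lemma4p4:
  fixes \<mu> r :: real
  assumes "r > 3 / 2"
  shows "\<forall>R>0. \<exists>C>0. \<forall>\<tau> w0 v0.
    0 < \<tau> \<and> \<tau> \<le> 1 \<and> w0 \<in> sobolev_ball r R \<and> v0 \<in> sobolev_ball r R \<longrightarrow>
      (Phi_c2 \<mu> \<tau> w0 - Phi_c2 \<mu> \<tau> v0 \<in> sobolev r \<and>
       sobolev_norm r (Phi_c2 \<mu> \<tau> w0 - Phi_c2 \<mu> \<tau> v0) \<le> C * \<tau> * sobolev_norm r (w0 - v0)) \<and>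
      ((nls_propagator \<mu> r \<tau> w0 - G_c2 \<mu> \<tau> w0) - (nls_propagator \<mu> r \<tau> v0 - G_c2 \<mu> \<tau> v0) \<in> sobolev r \<and>
       sobolev_norm r ((nls_propagator \<mu> r \<tau> w0 - G_c2 \<mu> \<tau> w0) - (nls_propagator \<mu> r \<tau> v0 - G_c2 \<mu> \<tau> v0))
         \<le> C * \<tau>\<^sup>2 * sobolev_norm r (w0 - v0))"
proof (intro allI impI, goal_cases)
  case (1 R)
  note r = assms
  obtain C2 where C2: "0 \<le> C2"
    "\<And>T x0 x y0 y. \<lbrakk>trajectory r \<mu> T x0 x; trajectory r \<mu> T y0 y; 0 \<le> T; T \<le> 1; norm x0 \<le> R; norm y0 \<le> R\<rbrakk> \<Longrightarrow>
      norm ((x T - x0 - duhamel r \<mu> T x0) - (y T - y0 - duhamel r \<mu> T y0)) \<le> C2 * T\<^sup>2 * norm (x0 - y0)"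
    using picard_remainder[OF r] by blast
  define C1 where "C1 = 48 * \<mu>\<^sup>2 * R ^ 4 + 12 * \<bar>\<mu>\<bar> * tri_const r * R\<^sup>2"
  define C0 where "C0 = 9 * (\<bar>\<mu>\<bar> * tri_const r * R\<^sup>2)"
  have C1: "0 \<le> C1" and C0: "0 \<le> C0" by (simp_all add: C1_def C0_def)
  \<comment> \<open>\<open>C0\<close> serves the Duhamel term, which is of first order in
    \<open>\<tau>\<close>, \<open>C1\<close> the two remainders of the scheme and \<open>C2\<close>
    the Picard remainder; the 1 guarantees positivity.\<close>
  define C where "C = C0 + C1 + C2 + 1"
  show ?case
  proof (intro exI[of _ C] conjI[of "0 < C"] allI impI, goal_cases)
    case 1
    show ?case using C0 C1 C2 by (simp add: C_def)
  next
    case (2 \<tau> w0 v0)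
    then have \<tau>: "0 \<le> \<tau>" "\<tau> \<le> 1" by simp_all
    have w: "w0 \<in> sobolev r" "sobolev_norm r w0 \<le> R"
      and v: "v0 \<in> sobolev r" "sobolev_norm r v0 \<le> R" using 2 by (auto simp: sobolev_ball_def)
    define x y where "x = emb r (fourier_coeff w0)" and "y = emb r (fourier_coeff v0)"
    have w0: "w0 = fser (unemb r x)" and v0: "v0 = fser (unemb r y)"
      unfolding x_def y_def by (rule emb_fourier[OF r w(1)], rule emb_fourier[OF r v(1)])
    have "sobolev_norm r (fser (unemb r b)) = norm b" for b
      using fser_sobolev(2)[OF r_half[OF r] unemb_hseq, of b] by simp
    then have x: "norm x \<le> R" and y: "norm y \<le> R" using w(2) v(2) w0 v0 by metis+
    have dist: "sobolev_norm r (w0 - v0) = norm (x - y)"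
      unfolding w0 v0 by (rule sobolev_norm_diff(1)[OF r])
    let ?\<Phi> = "phi_ell2 r \<mu> \<tau>" and ?D = "duhamel r \<mu> \<tau>"
    note diffs = sobolev_norm_diff[OF r]
    have fg: "fser (unemb r (free_group \<tau> a)) - fser (unemb r (free_group \<tau> b)) = fser (unemb r (free_group \<tau> (a - b)))" for a b
      by (rule ext) (simp add: free_group_diff unemb_diff fser_diff unemb_l1seq[OF r])
    have fgn: "fser (unemb r (free_group \<tau> a)) - fser (unemb r (free_group \<tau> b)) \<in> sobolev r"
      "sobolev_norm r (fser (unemb r (free_group \<tau> a)) - fser (unemb r (free_group \<tau> b))) = norm (a - b)" for a b
      using diffs(2) diffs(1)[of "free_group \<tau> a" "free_group \<tau> b"] by (simp_all add: free_group_diff[symmetric])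
    have \<Phi>: "Phi_c2 \<mu> \<tau> w0 = fser (unemb r (free_group \<tau> (?\<Phi> x)))" "Phi_c2 \<mu> \<tau> v0 = fser (unemb r (free_group \<tau> (?\<Phi> y)))"
      unfolding w0 v0 by (rule Phi_unemb[OF r \<tau>(1)])+
    have remd: "norm ((?\<Phi> x - ?D x) - (?\<Phi> y - ?D y)) \<le> C1 * \<tau>\<^sup>2 * norm (x - y)"
      unfolding C1_def by (rule remainder_lipschitz[OF r \<tau>(1) x y])
    have duh: "norm (?D x - ?D y) \<le> C0 * \<tau> * norm (x - y)"
      unfolding C0_def by (rule duhamel_lipschitz[OF r \<tau>(1) x y])
    have one: "norm (?\<Phi> x - ?\<Phi> y) \<le> C * \<tau> * norm (x - y)"
    proof -
      have "\<tau>\<^sup>2 \<le> \<tau>" using \<tau> by (simp add: power2_eq_square mult_left_le)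
      then have "C1 * \<tau>\<^sup>2 * norm (x - y) \<le> C1 * \<tau> * norm (x - y)"
        using C1 by (intro mult_right_mono mult_left_mono) auto
      moreover have "norm (?\<Phi> x - ?\<Phi> y) \<le> norm ((?\<Phi> x - ?D x) - (?\<Phi> y - ?D y)) + norm (?D x - ?D y)"
        using norm_triangle_ineq[of "(?\<Phi> x - ?D x) - (?\<Phi> y - ?D y)" "?D x - ?D y"] by simp
      ultimately have "norm (?\<Phi> x - ?\<Phi> y) \<le> (C0 + C1) * \<tau> * norm (x - y)"
        using remd duh by (simp add: algebra_simps)
      also have "\<dots> \<le> C * \<tau> * norm (x - y)"
        using C2(1) \<tau> by (intro mult_right_mono) (auto simp: C_def)
      finally show ?thesis .
    qed
    obtain X where X: "trajectory r \<mu> \<tau> x X" using trajectory_exists[OF r \<tau>] by blast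
    obtain Y where Y: "trajectory r \<mu> \<tau> y Y" using trajectory_exists[OF r \<tau>] by blast
    have flow: "nls_propagator \<mu> r \<tau> w0 = fser (unemb r (free_group \<tau> (X \<tau>)))"
      "nls_propagator \<mu> r \<tau> v0 = fser (unemb r (free_group \<tau> (Y \<tau>)))"
      using nls_propagator_eq[OF r w(1) \<tau>, of \<mu> X] nls_propagator_eq[OF r v(1) \<tau>, of \<mu> Y] X Y
      by (simp_all add: x_def y_def modes_def)
    have G: "G_c2 \<mu> \<tau> (fser (unemb r b)) = fser (unemb r (free_group \<tau> (b + ?\<Phi> b)))" for b
    proof (rule ext)
      fix t
      have "schroedinger_group \<tau> (fser (unemb r b)) = fser (unemb r (free_group \<tau> b))"
        unfolding schroedinger_group_eq unemb_free_group[abs_def] by (simp add: fourier_coeff_fser unemb_l1seq[OF r])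
      then have "G_c2 \<mu> \<tau> (fser (unemb r b)) t = fser (unemb r (free_group \<tau> b)) t + fser (unemb r (free_group \<tau> (?\<Phi> b))) t"
        by (simp add: G_c2_def Phi_unemb[OF r \<tau>(1)])
      also have "\<dots> = fser (unemb r (free_group \<tau> (b + ?\<Phi> b))) t"
        unfolding free_group_add by (rule linear_add[OF bounded_linear.linear[OF bounded_linear_eval[OF r]], symmetric])
      finally show "G_c2 \<mu> \<tau> (fser (unemb r b)) t = fser (unemb r (free_group \<tau> (b + ?\<Phi> b))) t" .
    qed
    let ?u = "X \<tau> - (x + ?\<Phi> x)" and ?v = "Y \<tau> - (y + ?\<Phi> y)"
    have FG: "nls_propagator \<mu> r \<tau> w0 - G_c2 \<mu> \<tau> w0 = fser (unemb r (free_group \<tau> ?u))"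
      "nls_propagator \<mu> r \<tau> v0 - G_c2 \<mu> \<tau> v0 = fser (unemb r (free_group \<tau> ?v))"
      unfolding flow by (simp_all only: w0 v0 G fg)
    have two: "norm (?u - ?v) \<le> C * \<tau>\<^sup>2 * norm (x - y)"
    proof -
      \<comment> \<open>The exact flow and the scheme contain the same Duhamel term; subtracting it
        from both leaves only quantities of second order in \<open>\<tau>\<close>.\<close>
      have "?u - ?v = ((X \<tau> - x - ?D x) - (Y \<tau> - y - ?D y)) - ((?\<Phi> x - ?D x) - (?\<Phi> y - ?D y))"
        by (simp add: algebra_simps)
      then have "norm (?u - ?v) \<le> norm ((X \<tau> - x - ?D x) - (Y \<tau> - y - ?D y)) + norm ((?\<Phi> x - ?D x) - (?\<Phi> y - ?D y))"
        by (simp only: norm_triangle_ineq4)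
      also have "\<dots> \<le> C2 * \<tau>\<^sup>2 * norm (x - y) + C1 * \<tau>\<^sup>2 * norm (x - y)"
        by (intro add_mono remd C2(2) X Y \<tau> x y)
      also have "\<dots> = (C2 + C1) * \<tau>\<^sup>2 * norm (x - y)" by (simp add: algebra_simps)
      also have "\<dots> \<le> C * \<tau>\<^sup>2 * norm (x - y)"
        using C0 by (intro mult_right_mono) (auto simp: C_def)
      finally show ?thesis .
    qed
    show ?case
      unfolding dist FG \<Phi> using fgn one two by simp
  qed
qed

end
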